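(* Let $G=(V,E)$ be a directed tree with $|V|=n$, let each $f_i:\mathbb{R}\to\mathbb{R}$ ($i\in V$) be differentiable and strongly convex, and let $0\le\lambda_{i,j},\mu_{i,j}\le+\infty$ for $(i,j)\in E$. Then the output $x^{(n)}$ of the ASRA algorithm (described in full in the context) is the optimal solution of $$\min_{x\in\mathbb{R}^{|V|}}\ \sum_{i\in V}f_i(x_i)+\sum_{(i,j)\in E}\lambda_{i,j}(x_i-x_j)_+ +\sum_{(i,j)\in E}\mu_{i,j}(x_j-x_i)_+ .$$
   Context: **Problem conventions.** A directed tree is a finite directed graph whose underlying undirected graph is a tree. $(x)_+=\max(0,x)$. If $\lambda_{i,j}=+\infty$ the term $\lambda_{i,j}(x_i-x_j)_+$ means the constraint $x_i\le x_j$; if $\mu_{i,j}=+\infty$ the term $\mu_{i,j}(x_j-x_i)_+$ means the constraint $x_i\ge x_j$. $f^*$ denotes the convex conjugate; for $f$ differentiable and strongly convex on $\mathbb{R}$, $(f^* )'$ is the inverse function of $f'$. **Normalization.** Before running the algorithm, $G$ is re-oriented into an arborescence (a directed tree with exactly one node of in-degree zero, the root) with the same underlying tree: if an edge $(j,i)\in E$ is reversed to $(i,j)$, put $\hat\lambda_{i,j}=\mu_{j,i}$, $\hat\mu_{i,j}=\lambda_{j,i}$; parameters of other edges are unchanged. The problem is unchanged by this. Nodes are then labelled $1,\dots,n$ with root $1$ and $i<j$ for every edge $(i,j)$. For $1\le m\le n$ let $G_m=(V_m,E_m)$ be the subtree induced on $V_m=\{1,\dots,m\}$; then $E_{m+1}\setminus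 E_m=\{(i_m,m+1)\}$ with $i_m\in V_m$. **ASRA.** Set $x^{(1)}_1=(f_1^* )'(0)$, $z^{(1)}=\emptyset$. For $m=1,\dots,n-1$ set $(x^{(m+1)},z^{(m+1)})=\mathrm{generate}(x^{(m)},z^{(m)},G_{m+1})$. Return $(x^{(n)},z^{(n)})$. **generate.** Put $t_0=0$, $x^*_i(0)=x^{(m)}_i$ ($i\in V_m$), $x^*_{m+1}(0)=(f_{m+1}^* )'(0)$, $z^*(0)=z^{(m)}$. If $f'_{m+1}(x^{(m)}_{i_m})=0$, set $t^*=0$. Otherwise let $\mathcal A^0$ assign to each $(i,j)\in E_m$ the sign $\#\in\{<,=,>\}$ with $x^*_i(0)\,\#\,x^*_j(0)$ ($\mathcal A_\#$ denotes the set of edges with sign $\#$), and for $q=0,1,2,\dots$ repeat update$^-$ (if $f'_{m+1}(x^{(m)}_{i_m})>0$) or update$^+$ (if $f'_{m+1}(x^{(m)}_{i_m})<0$) to get $(t_{q+1},x^*(t_{q+1}),z^*(t_{q+1}),\mathcal A^{q+1})$ from $(t_q,x^*(t_q),z^*(t_q),\mathcal A^q)$, until $t^*$ is declared found. Output $x^{(m+1)}=x^*(t^* )$, $z^{(m+1)}_{i,j}=z^*_{i,j}(t^* )$ for $(i,j)\in E_m$, $z^{(m+1)}_{i_m,m+1}=t^*$. **Formulas used in both updates.** Let $B^q=(V_{B^q},E_{B^q})$ be the connected component containing $i_m$ of the graph $(V_m,\mathcal A^q_=)$ (edges viewed as undirected for connectivity). For $i,j\in V_{B^q}$ write $j\triangleleft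 i$ if the undirected path from $i_m$ to $i$ is strictly contained in the one from $i_m$ to $j$; $C_i=\{j\in V_{B^q}: j\triangleleft i\}\cup\{i\}$. For a node set $S\subseteq V_{B^q}$ let $\sigma(S)=\sum_{(l,k)\in E_m,\,l\in S,\,k\notin V_{B^q}}z^*_{l,k}(t_q)-\sum_{(k,l)\in E_m,\,l\in S,\,k\notin V_{B^q}}z^*_{k,l}(t_q)$, and $\beta^q=\sigma(V_{B^q})$. Define - $x^q_i(t)=x^*_i(t_q)$ for $i\in V_m\setminus V_{B^q}$; $x^q_i(t)=x_{B^q}(t):=\big((\sum_{l\in V_{B^q}}f_l)^*\big)'(t+\beta^q)$ for $i\in V_{B^q}$; $x^q_{m+1}(t)=(f_{m+1}^* )'(-t)$; - for $(i,j)\in E_{B^q}$: $z^q_{i,j}(t)=\sum_{l\in C_i}f_l'(x^q_l(t))-\sigma(C_i)$ if $i\triangleleft j$, and $z^q_{i,j}(t)=-\sum_{l\in C_j}f_l'(x^q_l(t))+\sigma(C_j)$ if $j\triangleleft i$; - $\tilde z^q_{i,j}(t)=z^q_{i,j}(t)$ for $(i,j)\in E_{B^q}$ and $\tilde z^q_{i,j}(t)=z^*_{i,j}(t_q)$ for $(i,j)\in E_m\setminus E_{B^q}$. Let $\Omega^q_+=\{(i,j)\in E_m: i\in V_{B^q},j\notin V_{B^q}\}$ and $\Omega^q_-=\{(i,j)\in E_m: i\notin V_{B^q},j\in V_{B^q}\}$. **update$^-$.** (1) For $(i,j)\in E_{B^q}$ let $\Delta t_{i,j}\le0$ solve $z^q_{i,j}(t_q+\Delta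 t_{i,j})=-\lambda_{i,j}$ if $i\triangleleft j$, resp. $=\mu_{i,j}$ if $j\triangleleft i$ ($\Delta t_{i,j}=-\infty$ if that bound is infinite); $\Delta(E_{B^q})=\max_{E_{B^q}}\Delta t_{i,j}$ ($-\infty$ if $E_{B^q}=\emptyset$). (2) $\Delta(\Omega^q_+)$ is the $\Delta$ with $x_{B^q}(t_q+\Delta)=\max_{(i,j)\in\Omega^q_+\cap\mathcal A^q_>}x^*_j(t_q)$, and $\Delta(\Omega^q_-)$ is the $\Delta$ with $x_{B^q}(t_q+\Delta)=\max_{(i,j)\in\Omega^q_-\cap\mathcal A^q_<}x^*_i(t_q)$ (each $-\infty$ if the index set is empty). (3) $\Delta t_q=\max\{\Delta(E_{B^q}),\Delta(\Omega^q_+),\Delta(\Omega^q_-)\}$; $\Delta\tilde t_q$ is the solution of $x^q_{i_m}(t_q+\Delta\tilde t_q)=x^q_{m+1}(t_q+\Delta\tilde t_q)$; $t_{q+1}=\max\{t_q+\Delta t_q,\ t_q+\Delta\tilde t_q,\ -\lambda_{i_m,m+1}\}$. (4) $x^*(t_{q+1})=x^q(t_{q+1})$, $z^*(t_{q+1})=\tilde z^q(t_{q+1})$. (5) If $t_{q+1}=-\lambda_{i_m,m+1}$ or $x^*_{i_m}(t_{q+1})=x^*_{m+1}(t_{q+1})$, declare $t^*=t_{q+1}$. Otherwise let $\mathcal M(E^+_{B^q})$ (resp. $\mathcal M(E^-_{B^q})$) be the set of $(i,j)\in E_{B^q}$ with $\Delta t_{i,j}=\Delta t_q$ and $i\triangleleft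 j$ (resp. $j\triangleleft i$); $\mathcal M(\Omega^q_+)=\{(i,j)\in\Omega^q_+\cap\mathcal A^q_>: x^q_i(t_q+\Delta t_q)=x^*_j(t_q)\}$; $\mathcal M(\Omega^q_-)=\{(i,j)\in\Omega^q_-\cap\mathcal A^q_<: x^q_j(t_q+\Delta t_q)=x^*_i(t_q)\}$; and set $\mathcal A^{q+1}_= =(\mathcal A^q_=\cup\mathcal M(\Omega^q_+)\cup\mathcal M(\Omega^q_-))\setminus(\mathcal M(E^+_{B^q})\cup\mathcal M(E^-_{B^q}))$, $\mathcal A^{q+1}_> =(\mathcal A^q_>\cup\mathcal M(E^+_{B^q}))\setminus\mathcal M(\Omega^q_+)$, $\mathcal A^{q+1}_< =(\mathcal A^q_<\cup\mathcal M(E^-_{B^q}))\setminus\mathcal M(\Omega^q_-)$. **update$^+$.** (1) For $(i,j)\in E_{B^q}$ let $\Delta t_{i,j}\ge0$ solve $z^q_{i,j}(t_q+\Delta t_{i,j})=\mu_{i,j}$ if $i\triangleleft j$, resp. $=-\lambda_{i,j}$ if $j\triangleleft i$ ($+\infty$ if that bound is infinite); $\Delta(E_{B^q})=\min_{E_{B^q}}\Delta t_{i,j}$ ($+\infty$ if empty). (2) $\Delta(\Omega^q_+)$ is the $\Delta$ with $x_{B^q}(t_q+\Delta)=\min_{(i,j)\in\Omega^q_+\cap\mathcal A^q_<}x^*_j(t_q)$; $\Delta(\Omega^q_-)$ is the $\Delta$ with $x_{B^q}(t_q+\Delta)=\min_{(i,j)\in\Omega^q_-\cap\mathcal A^q_>}x^*_i(t_q)$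 ($+\infty$ if empty). (3) $\Delta t_q=\min\{\Delta(E_{B^q}),\Delta(\Omega^q_+),\Delta(\Omega^q_-)\}$; $\Delta\tilde t_q$ as in update$^-$; $t_{q+1}=\min\{t_q+\Delta t_q,\ t_q+\Delta\tilde t_q,\ \mu_{i_m,m+1}\}$. (4) As in update$^-$. (5) If $t_{q+1}=\mu_{i_m,m+1}$ or $x^*_{i_m}(t_{q+1})=x^*_{m+1}(t_{q+1})$, declare $t^*=t_{q+1}$. Otherwise, with $\mathcal M(E^\pm_{B^q})$ defined as in update$^-$, $\mathcal M(\Omega^q_+)=\{(i,j)\in\Omega^q_+\cap\mathcal A^q_<: x^q_i(t_q+\Delta t_q)=x^*_j(t_q)\}$, $\mathcal M(\Omega^q_-)=\{(i,j)\in\Omega^q_-\cap\mathcal A^q_>: x^q_j(t_q+\Delta t_q)=x^*_i(t_q)\}$, set $\mathcal A^{q+1}_=$ by the same formula as in update$^-$, $\mathcal A^{q+1}_> =(\mathcal A^q_>\cup\mathcal M(E^-_{B^q}))\setminus\mathcal M(\Omega^q_-)$, $\mathcal A^{q+1}_< =(\mathcal A^q_<\cup\mathcal M(E^+_{B^q}))\setminus\mathcal M(\Omega^q_+)$. *)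

theory Defs
  imports "HOL-Analysis.Analysis" "HOL-Library.While_Combinator"
begin

section \<open>Convexity notions\<close>

definition strongly_convex :: "(real \<Rightarrow> real) \<Rightarrow> bool" where
  "strongly_convex f \<longleftrightarrow>
     (\<exists>c>0. \<forall>x y. \<forall>u\<in>{0..1}.
        f ((1 - u) * x + u * y) \<le> (1 - u) * f x + u * f y - c / 2 * u * (1 - u) * (x - y)\<^sup>2)"

text \<open>For strongly convex functions the supremum is finite everywhere, so a real-valued
  conjugate suffices.\<close>

definition convex_conjugate :: "(real \<Rightarrow> real) \<Rightarrow> real \<Rightarrow> real" where
  "convex_conjugate f y = (SUP x. y * x - f x)"


section \<open>Directed trees\<close>

definition undirected_path :: "('a \<times> 'a) set \<Rightarrow> 'a \<Rightarrow> 'a list \<Rightarrow> 'a \<Rightarrow> bool" where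
  "undirected_path E u p v \<longleftrightarrow>
     p \<noteq> [] \<and> hd p = u \<and> last p = v \<and> distinct p \<and>
     successively (\<lambda>a b. (a, b) \<in> E \<union> E\<inverse>) p"

definition undirected_cycle :: "('a \<times> 'a) set \<Rightarrow> 'a list \<Rightarrow> bool" where
  "undirected_cycle E c \<longleftrightarrow>
     3 \<le> length c \<and> distinct c \<and>
     successively (\<lambda>a b. (a, b) \<in> E \<union> E\<inverse>) c \<and> (last c, hd c) \<in> E \<union> E\<inverse>"

text \<open>Asymmetry excludes loops and antiparallel pairs of edges, i.e. cycles of length one and
  two of the underlying undirected (multi)graph.\<close>

definition directed_tree :: "'a set \<Rightarrow> ('a \<times> 'a) set \<Rightarrow> bool" where
  "directed_tree V E \<longleftrightarrow>
     finite V \<and> V \<noteq> {} \<and> E \<subseteq> V \<times> V \<and> asym E \<and>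
     (\<forall>u\<in>V. \<forall>v\<in>V. (u, v) \<in> (E \<union> E\<inverse>)\<^sup>*) \<and>
     (\<nexists>c. undirected_cycle E c)"

definition in_degree :: "('a \<times> 'a) set \<Rightarrow> 'a \<Rightarrow> nat" where
  "in_degree E v = card {e \<in> E. snd e = v}"

definition arborescence :: "'a set \<Rightarrow> ('a \<times> 'a) set \<Rightarrow> bool" where
  "arborescence V E \<longleftrightarrow> directed_tree V E \<and> (\<exists>!r. r \<in> V \<and> in_degree E r = 0)"


section \<open>The optimization problem\<close>

text \<open>In \<^typ>\<open>ereal\<close> we have \<open>\<infinity> * 0 = 0\<close> and \<open>\<infinity> * a = \<infinity>\<close> for \<open>a > 0\<close>, so that an infinite
  weight is exactly the constraint \<open>x i \<le> x j\<close> (for \<open>lam\<close>) or \<open>x i \<ge> x j\<close> (for \<open>mu\<close>).\<close>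

definition objective ::
  "'a set \<Rightarrow> ('a \<times> 'a) set \<Rightarrow> ('a \<Rightarrow> real \<Rightarrow> real) \<Rightarrow> ('a \<Rightarrow> 'a \<Rightarrow> ereal) \<Rightarrow> ('a \<Rightarrow> 'a \<Rightarrow> ereal)
     \<Rightarrow> ('a \<Rightarrow> real) \<Rightarrow> ereal" where
  "objective V E f lam mu x =
     ereal (\<Sum>i\<in>V. f i (x i))
     + (\<Sum>(i, j)\<in>E. lam i j * ereal (max 0 (x i - x j)))
     + (\<Sum>(i, j)\<in>E. mu i j * ereal (max 0 (x j - x i)))"

text \<open>The space of real vectors indexed by \<open>V\<close> is \<open>V \<rightarrow>\<^sub>E UNIV\<close>.\<close>

definition the_optimal_solution ::
  "'a set \<Rightarrow> ('a \<times> 'a) set \<Rightarrow> ('a \<Rightarrow> real \<Rightarrow> real) \<Rightarrow> ('a \<Rightarrow> 'a \<Rightarrow> ereal) \<Rightarrow> ('a \<Rightarrow> 'a \<Rightarrow> ereal)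
     \<Rightarrow> ('a \<Rightarrow> real) \<Rightarrow> bool" where
  "the_optimal_solution V E f lam mu x \<longleftrightarrow>
     {y. is_arg_min (objective V E f lam mu) (\<lambda>y. y \<in> V \<rightarrow>\<^sub>E UNIV) y} = {x}"


section \<open>The algorithm on a labelled arborescence\<close>

text \<open>The fields \<open>eq_set\<close>, \<open>gt_set\<close>, \<open>lt_set\<close> are the sets of edges with sign \<open>=\<close>, \<open>>\<close>, \<open><\<close>;
  \<open>found\<close> records that \<open>t\<^sup>*\<close> has been declared, in which case it is the value of \<open>time\<close>.\<close>

record asra_state =
  time :: real
  xval :: "nat \<Rightarrow> real"
  zval :: "nat \<times> nat \<Rightarrow> real"
  eq_set :: "(nat \<times> nat) set"
  gt_set :: "(nat \<times> nat) set"
  lt_set :: "(nat \<times> nat) set"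
  found :: bool

locale labelled_problem =
  fixes E :: "(nat \<times> nat) set"
    and f :: "nat \<Rightarrow> real \<Rightarrow> real"
    and lam mu :: "nat \<Rightarrow> nat \<Rightarrow> ereal"
begin

definition Em :: "nat \<Rightarrow> (nat \<times> nat) set" where
  "Em m = {(i, j) \<in> E. i \<in> {1..m} \<and> j \<in> {1..m}}"

text \<open>The node \<open>i\<^sub>m\<close> to which \<open>m + 1\<close> is attached.\<close>

definition attach :: "nat \<Rightarrow> nat" where
  "attach m = (THE i. i \<in> {1..m} \<and> (i, m + 1) \<in> E)"

definition VB :: "nat \<Rightarrow> asra_state \<Rightarrow> nat set" where
  "VB m s = {i \<in> {1..m}. (attach m, i) \<in> (eq_set s \<union> (eq_set s)\<inverse>)\<^sup>*}"

definition EB :: "nat \<Rightarrow> asra_state \<Rightarrow> (nat \<times> nat) set" where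
  "EB m s = {(i, j) \<in> eq_set s. i \<in> VB m s \<and> j \<in> VB m s}"

definition path_to :: "nat \<Rightarrow> asra_state \<Rightarrow> nat \<Rightarrow> nat list" where
  "path_to m s i = (THE p. undirected_path (EB m s) (attach m) p i)"

text \<open>\<open>beyond m s j i\<close> is \<open>j \<triangleleft> i\<close>: node \<open>j\<close> lies farther from \<open>i\<^sub>m\<close> than \<open>i\<close>, with \<open>i\<close> on the way.\<close>

definition beyond :: "nat \<Rightarrow> asra_state \<Rightarrow> nat \<Rightarrow> nat \<Rightarrow> bool" where
  "beyond m s j i \<longleftrightarrow>
     i \<in> VB m s \<and> j \<in> VB m s \<and> set (path_to m s i) \<subset> set (path_to m s j)"

definition CB :: "nat \<Rightarrow> asra_state \<Rightarrow> nat \<Rightarrow> nat set" where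
  "CB m s i = {j \<in> VB m s. beyond m s j i} \<union> {i}"

definition sigma :: "nat \<Rightarrow> asra_state \<Rightarrow> nat set \<Rightarrow> real" where
  "sigma m s S =
     (\<Sum>e\<in>{(l, k) \<in> Em m. l \<in> S \<and> k \<notin> VB m s}. zval s e)
     - (\<Sum>e\<in>{(k, l) \<in> Em m. l \<in> S \<and> k \<notin> VB m s}. zval s e)"

definition xB :: "nat \<Rightarrow> asra_state \<Rightarrow> real \<Rightarrow> real" where
  "xB m s t =
     deriv (convex_conjugate (\<lambda>y. \<Sum>l\<in>VB m s. f l y)) (t + sigma m s (VB m s))"

definition xq :: "nat \<Rightarrow> asra_state \<Rightarrow> real \<Rightarrow> nat \<Rightarrow> real" where
  "xq m s t i =
     (if i = m + 1 then deriv (convex_conjugate (f (m + 1))) (- t)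
      else if i \<in> VB m s then xB m s t
      else xval s i)"

text \<open>Used for edges of \<^const>\<open>EB\<close> only, where exactly one of \<open>i \<triangleleft> j\<close> and \<open>j \<triangleleft> i\<close> holds.\<close>

definition zq :: "nat \<Rightarrow> asra_state \<Rightarrow> real \<Rightarrow> nat \<times> nat \<Rightarrow> real" where
  "zq m s t e = (case e of (i, j) \<Rightarrow>
     if beyond m s i j
     then (\<Sum>l\<in>CB m s i. deriv (f l) (xq m s t l)) - sigma m s (CB m s i)
     else - (\<Sum>l\<in>CB m s j. deriv (f l) (xq m s t l)) + sigma m s (CB m s j))"

definition ztilde :: "nat \<Rightarrow> asra_state \<Rightarrow> real \<Rightarrow> nat \<times> nat \<Rightarrow> real" where
  "ztilde m s t e = (if e \<in> EB m s then zq m s t e else zval s e)"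

definition Omega_plus :: "nat \<Rightarrow> asra_state \<Rightarrow> (nat \<times> nat) set" where
  "Omega_plus m s = {(i, j) \<in> Em m. i \<in> VB m s \<and> j \<notin> VB m s}"

definition Omega_minus :: "nat \<Rightarrow> asra_state \<Rightarrow> (nat \<times> nat) set" where
  "Omega_minus m s = {(i, j) \<in> Em m. i \<notin> VB m s \<and> j \<in> VB m s}"

definition meet_time :: "nat \<Rightarrow> asra_state \<Rightarrow> real" where
  "meet_time m s =
     (THE d. xq m s (time s + d) (attach m) = xq m s (time s + d) (m + 1))"


subsection \<open>Downward update\<close>

definition edge_time_minus :: "nat \<Rightarrow> asra_state \<Rightarrow> nat \<times> nat \<Rightarrow> ereal" where
  "edge_time_minus m s e = (case e of (i, j) \<Rightarrow>
     let bound = (if beyond m s i j then - lam i j else mu i j) in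
     if \<bar>bound\<bar> = \<infinity> then -\<infinity>
     else ereal (THE d. d \<le> 0 \<and> ereal (zq m s (time s + d) (i, j)) = bound))"

definition Delta_E_minus :: "nat \<Rightarrow> asra_state \<Rightarrow> ereal" where
  "Delta_E_minus m s =
     (if EB m s = {} then -\<infinity> else Max (edge_time_minus m s ` EB m s))"

definition Delta_Omega_plus_minus :: "nat \<Rightarrow> asra_state \<Rightarrow> ereal" where
  "Delta_Omega_plus_minus m s =
     (let M = Omega_plus m s \<inter> gt_set s in
      if M = {} then -\<infinity>
      else ereal (THE d. xB m s (time s + d) = Max ((\<lambda>(i, j). xval s j) ` M)))"

definition Delta_Omega_minus_minus :: "nat \<Rightarrow> asra_state \<Rightarrow> ereal" where
  "Delta_Omega_minus_minus m s =
     (let M = Omega_minus m s \<inter> lt_set s in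
      if M = {} then -\<infinity>
      else ereal (THE d. xB m s (time s + d) = Max ((\<lambda>(i, j). xval s i) ` M)))"

definition Delta_minus :: "nat \<Rightarrow> asra_state \<Rightarrow> ereal" where
  "Delta_minus m s =
     max (Delta_E_minus m s) (max (Delta_Omega_plus_minus m s) (Delta_Omega_minus_minus m s))"

text \<open>The new time is the maximum of the real \<open>time s + meet_time m s\<close> and two terms different
  from \<open>\<infinity>\<close>, hence real. When the iteration continues, it equals
  \<open>time s + Delta_minus m s\<close>, so \<open>Delta_minus m s\<close> is then real too.\<close>

definition update_minus :: "nat \<Rightarrow> asra_state \<Rightarrow> asra_state" where
  "update_minus m s =
     (let D = Delta_minus m s;
          t' = real_of_ereal
                 (max (ereal (time s) + D)
                   (max (ereal (time s + meet_time m s)) (- lam (attach m) (m + 1))));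
          s' = s\<lparr>time := t', xval := xq m s t', zval := ztilde m s t'\<rparr>
      in
      if ereal t' = - lam (attach m) (m + 1) \<or> xval s' (attach m) = xval s' (m + 1)
      then s'\<lparr>found := True\<rparr>
      else
        let d = real_of_ereal D;
            MEp = {(i, j) \<in> EB m s. edge_time_minus m s (i, j) = D \<and> beyond m s i j};
            MEm = {(i, j) \<in> EB m s. edge_time_minus m s (i, j) = D \<and> beyond m s j i};
            MOp = {(i, j) \<in> Omega_plus m s \<inter> gt_set s. xq m s (time s + d) i = xval s j};
            MOm = {(i, j) \<in> Omega_minus m s \<inter> lt_set s. xq m s (time s + d) j = xval s i}
        in s'\<lparr>eq_set := (eq_set s \<union> MOp \<union> MOm) - (MEp \<union> MEm),
              gt_set := (gt_set s \<union> MEp) - MOp,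
              lt_set := (lt_set s \<union> MEm) - MOm\<rparr>)"


subsection \<open>Upward update\<close>

definition edge_time_plus :: "nat \<Rightarrow> asra_state \<Rightarrow> nat \<times> nat \<Rightarrow> ereal" where
  "edge_time_plus m s e = (case e of (i, j) \<Rightarrow>
     let bound = (if beyond m s i j then mu i j else - lam i j) in
     if \<bar>bound\<bar> = \<infinity> then \<infinity>
     else ereal (THE d. 0 \<le> d \<and> ereal (zq m s (time s + d) (i, j)) = bound))"

definition Delta_E_plus :: "nat \<Rightarrow> asra_state \<Rightarrow> ereal" where
  "Delta_E_plus m s =
     (if EB m s = {} then \<infinity> else Min (edge_time_plus m s ` EB m s))"

definition Delta_Omega_plus_plus :: "nat \<Rightarrow> asra_state \<Rightarrow> ereal" where
  "Delta_Omega_plus_plus m s =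
     (let M = Omega_plus m s \<inter> lt_set s in
      if M = {} then \<infinity>
      else ereal (THE d. xB m s (time s + d) = Min ((\<lambda>(i, j). xval s j) ` M)))"

definition Delta_Omega_minus_plus :: "nat \<Rightarrow> asra_state \<Rightarrow> ereal" where
  "Delta_Omega_minus_plus m s =
     (let M = Omega_minus m s \<inter> gt_set s in
      if M = {} then \<infinity>
      else ereal (THE d. xB m s (time s + d) = Min ((\<lambda>(i, j). xval s i) ` M)))"

definition Delta_plus :: "nat \<Rightarrow> asra_state \<Rightarrow> ereal" where
  "Delta_plus m s =
     min (Delta_E_plus m s) (min (Delta_Omega_plus_plus m s) (Delta_Omega_minus_plus m s))"

definition update_plus :: "nat \<Rightarrow> asra_state \<Rightarrow> asra_state" where
  "update_plus m s =
     (let D = Delta_plus m s;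
          t' = real_of_ereal
                 (min (ereal (time s) + D)
                   (min (ereal (time s + meet_time m s)) (mu (attach m) (m + 1))));
          s' = s\<lparr>time := t', xval := xq m s t', zval := ztilde m s t'\<rparr>
      in
      if ereal t' = mu (attach m) (m + 1) \<or> xval s' (attach m) = xval s' (m + 1)
      then s'\<lparr>found := True\<rparr>
      else
        let d = real_of_ereal D;
            MEp = {(i, j) \<in> EB m s. edge_time_plus m s (i, j) = D \<and> beyond m s i j};
            MEm = {(i, j) \<in> EB m s. edge_time_plus m s (i, j) = D \<and> beyond m s j i};
            MOp = {(i, j) \<in> Omega_plus m s \<inter> lt_set s. xq m s (time s + d) i = xval s j};
            MOm = {(i, j) \<in> Omega_minus m s \<inter> gt_set s. xq m s (time s + d) j = xval s i}
        in s'\<lparr>eq_set := (eq_set s \<union> MOp \<union> MOm) - (MEp \<union> MEm),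
              gt_set := (gt_set s \<union> MEm) - MOm,
              lt_set := (lt_set s \<union> MEp) - MOp\<rparr>)"


subsection \<open>Main loop\<close>

text \<open>The result is \<^const>\<open>None\<close> if the repetition of the updates does not terminate.\<close>

definition generate ::
  "nat \<Rightarrow> (nat \<Rightarrow> real) \<times> (nat \<times> nat \<Rightarrow> real) \<Rightarrow> ((nat \<Rightarrow> real) \<times> (nat \<times> nat \<Rightarrow> real)) option" where
  "generate m xz = (case xz of (x, z) \<Rightarrow>
     let x0 = x(m + 1 := deriv (convex_conjugate (f (m + 1))) 0);
         d0 = deriv (f (m + 1)) (x (attach m));
         s0 = \<lparr>time = 0, xval = x0, zval = z,
               eq_set = {(i, j) \<in> Em m. x0 i = x0 j},
               gt_set = {(i, j) \<in> Em m. x0 i > x0 j},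
               lt_set = {(i, j) \<in> Em m. x0 i < x0 j},
               found = (d0 = 0)\<rparr>
     in map_option (\<lambda>s. (xval s, (zval s)((attach m, m + 1) := time s)))
          (while_option (\<lambda>s. \<not> found s) (if d0 > 0 then update_minus m else update_plus m) s0))"

text \<open>Iterates are only meaningful on the nodes and edges of the current subtree; elsewhere they
  carry arbitrary values that are never read.\<close>

definition run :: "nat \<Rightarrow> ((nat \<Rightarrow> real) \<times> (nat \<times> nat \<Rightarrow> real)) option" where
  "run n = fold (\<lambda>m r. Option.bind r (generate m)) [1..<n]
     (Some (undefined(1 := deriv (convex_conjugate (f 1)) 0), undefined))"

end


section \<open>Normalization and the complete algorithm\<close>

text \<open>\<open>A\<close> is the re-oriented edge set and \<open>l\<close> the labelling \<open>1, \<dots>, n\<close> of the nodes. Both are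
  choices left open by the algorithm.\<close>

definition normalization ::
  "'a set \<Rightarrow> ('a \<times> 'a) set \<Rightarrow> ('a \<times> 'a) set \<Rightarrow> (nat \<Rightarrow> 'a) \<Rightarrow> bool" where
  "normalization V E A l \<longleftrightarrow>
     arborescence V A \<and> A \<union> A\<inverse> = E \<union> E\<inverse> \<and>
     bij_betw l {1..card V} V \<and> in_degree A (l 1) = 0 \<and>
     (\<forall>i\<in>{1..card V}. \<forall>j\<in>{1..card V}. (l i, l j) \<in> A \<longrightarrow> i < j)"

text \<open>Every directed tree can be normalized.\<close>

lemma normalization_exists:
  assumes T: "directed_tree V E"
  shows "\<exists>A l. normalization V E A l"
proof -
  define U where "U = E \<union> E\<inverse>"
  define n where "n = card V"
  from T have fin: "finite V" and ne: "V \<noteq> {}" and EV: "E \<subseteq> V \<times> V" and as: "asym E"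
    and con: "\<And>u v. u \<in> V \<Longrightarrow> v \<in> V \<Longrightarrow> (u, v) \<in> U\<^sup>*" and cyc: "\<nexists>c. undirected_cycle E c"
    unfolding directed_tree_def U_def by auto
  have UV: "U \<subseteq> V \<times> V" and Usym: "\<And>a b. (a, b) \<in> U \<Longrightarrow> (b, a) \<in> U"
    using EV unfolding U_def by auto
  have Uirr: "(a, a) \<notin> U" for a using as unfolding U_def by (auto dest: asymD)
  have npos: "0 < n" using fin ne unfolding n_def by (simp add: card_gt_0_iff)
  have "\<exists>xs. length xs = k \<and> distinct xs \<and> set xs \<subseteq> V \<and>
          (\<forall>j<k. 0 < j \<longrightarrow> (\<exists>i<j. (xs ! i, xs ! j) \<in> U))" if "1 \<le> k" "k \<le> n" for k
    using that
  proof (induction k rule: dec_induct)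
    case base
    from ne obtain r where "r \<in> V" by blast
    then show ?case by (intro exI[of _ "[r]"]) auto
  next
    case (step k)
    then obtain xs where xs: "length xs = k" "distinct xs" "set xs \<subseteq> V"
      "\<And>j. j < k \<Longrightarrow> 0 < j \<Longrightarrow> \<exists>i<j. (xs ! i, xs ! j) \<in> U" by auto
    have "card (set xs) < card V"
      using xs step.prems by (simp add: distinct_card n_def)
    then have "set xs \<noteq> V" by auto
    with xs(3) obtain v where v: "v \<in> V" "v \<notin> set xs" by blast
    from xs(1) step.hyps have "xs \<noteq> []" by auto
    then have u: "hd xs \<in> set xs" by simp
    from con[of "hd xs" v] u v xs(3) have "(hd xs, v) \<in> U\<^sup>*" by blast
    then have "v \<notin> set xs \<longrightarrow> (\<exists>a b. (a, b) \<in> U \<and> a \<in> set xs \<and> b \<notin> set xs)"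
      using u by (induction rule: rtrancl_induct) auto
    with v obtain a b where ab: "(a, b) \<in> U" "a \<in> set xs" "b \<notin> set xs" by blast
    from ab(2) xs(1) obtain i where i: "i < k" "xs ! i = a" by (auto simp: in_set_conv_nth)
    show ?case
    proof (intro exI[of _ "xs @ [b]"] conjI allI impI)
      fix j assume j: "j < Suc k" "0 < j"
      show "\<exists>i<j. ((xs @ [b]) ! i, (xs @ [b]) ! j) \<in> U"
      proof (cases "j < k")
        case True
        with xs(4)[of j] j(2) obtain i' where "i' < j" "(xs ! i', xs ! j) \<in> U" by blast
        with True xs(1) show ?thesis by (intro exI[of _ i']) (auto simp: nth_append)
      next
        case False
        with j have "j = k" by simp
        with i ab xs(1) show ?thesis by (intro exI[of _ i]) (auto simp: nth_append)
      qed
    qed (use xs ab UV in auto)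
  qed
  from this[of n] npos obtain xs where len: "length xs = n" and dist: "distinct xs"
    and sub: "set xs \<subseteq> V" and par: "\<And>j. j < n \<Longrightarrow> 0 < j \<Longrightarrow> \<exists>i<j. (xs ! i, xs ! j) \<in> U"
    by auto
  have "card (set xs) = card V" using len dist distinct_card n_def by metis
  with sub fin have setxs: "set xs = V" by (simp add: card_subset_eq)
  define A where "A = {(a, b). (a, b) \<in> U \<and> (\<exists>i j. i < j \<and> j < n \<and> a = xs ! i \<and> b = xs ! j)}"
  define l where "l i = xs ! (i - 1)" for i :: nat
  have inj: "i = j" if "i < n" "j < n" "xs ! i = xs ! j" for i j
    using that dist len by (simp add: nth_eq_iff_index_eq)
  have A_iff: "(xs ! i, xs ! j) \<in> A \<longleftrightarrow> (xs ! i, xs ! j) \<in> U \<and> i < j" if "i < n" "j < n" for i j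
    unfolding A_def using that inj by (auto dest: order.strict_trans) (metis order.strict_trans)
  have AV: "A \<subseteq> V \<times> V" using UV unfolding A_def by auto
  have AU: "A \<union> A\<inverse> = U"
  proof (intro equalityI subrelI)
    fix a b assume "(a, b) \<in> A \<union> A\<inverse>"
    then show "(a, b) \<in> U" unfolding A_def using Usym by auto
  next
    fix a b assume ab: "(a, b) \<in> U"
    then have "a \<in> set xs" "b \<in> set xs" using UV setxs by auto
    then obtain i j where ij: "i < n" "a = xs ! i" "j < n" "b = xs ! j"
      using len by (metis in_set_conv_nth)
    have "i \<noteq> j" using ab ij Uirr by auto
    then show "(a, b) \<in> A \<union> A\<inverse>" using ij ab Usym A_iff[of i j] A_iff[of j i]
      by (auto simp: neq_iff)
  qed
  have "asym A"
  proof (rule asymI)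
    fix a b assume ab: "(a, b) \<in> A"
    then obtain i j where ij: "i < j" "j < n" "a = xs ! i" "b = xs ! j" unfolding A_def by auto
    then show "(b, a) \<notin> A" using A_iff[of j i] by auto
  qed
  moreover have "\<nexists>c. undirected_cycle A c"
    using cyc AU unfolding undirected_cycle_def U_def by simp
  ultimately have treeA: "directed_tree V A"
    unfolding directed_tree_def using fin ne AV con AU by simp
  have finA: "finite A" using AV fin by (meson finite_SigmaI finite_subset)
  have deg: "in_degree A v = 0 \<longleftrightarrow> (\<forall>a. (a, v) \<notin> A)" for v
    unfolding in_degree_def using finA by auto
  have root: "in_degree A (xs ! 0) = 0"
    unfolding deg
  proof (intro allI notI)
    fix a assume "(a, xs ! 0) \<in> A"
    then obtain i j where "i < j" "j < n" "xs ! 0 = xs ! j" unfolding A_def by auto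
    with inj[of 0 j] npos show False by auto
  qed
  have uniq: "v = xs ! 0" if v: "v \<in> V" "in_degree A v = 0" for v
  proof -
    from v(1) setxs len obtain j where j: "j < n" "v = xs ! j" by (metis in_set_conv_nth)
    have "j = 0"
    proof (rule ccontr)
      assume "j \<noteq> 0"
      with par[of j] j obtain i where "i < j" "(xs ! i, xs ! j) \<in> U" by auto
      with j v(2) deg A_iff[of i j] show False by auto
    qed
    with j show ?thesis by simp
  qed
  have "xs ! 0 \<in> V" using setxs len npos by auto
  with root uniq treeA have arb: "arborescence V A" unfolding arborescence_def by blast
  have "bij_betw l {1..n} V"
  proof (rule bij_betw_imageI)
    show "inj_on l {1..n}"
    proof (rule inj_onI)
      fix i j assume ij: "i \<in> {1..n}" "j \<in> {1..n}" "l i = l j"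
      then have "i - 1 < n" "j - 1 < n" by auto
      with inj[of "i - 1" "j - 1"] ij have "i - 1 = j - 1" unfolding l_def by simp
      with ij show "i = j" by auto
    qed
    have "v \<in> l ` {1..n}" if "v \<in> V" for v
    proof -
      from that setxs len obtain j where "j < n" "v = xs ! j" by (metis in_set_conv_nth)
      then show ?thesis unfolding l_def by (intro image_eqI[of _ _ "Suc j"]) auto
    qed
    moreover have "l i \<in> V" if "i \<in> {1..n}" for i
      proof -
      from that have "i - 1 < length xs" using len by auto
      then show ?thesis unfolding l_def using setxs nth_mem by blast
    qed
    ultimately show "l ` {1..n} = V" by blast
  qed
  moreover have "i < j" if "i \<in> {1..n}" "j \<in> {1..n}" "(l i, l j) \<in> A" for i j
  proof -
    from that have "i - 1 < n" "j - 1 < n" by auto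
    with A_iff[of "i - 1" "j - 1"] that(3) have "i - 1 < j - 1" unfolding l_def by simp
    then show ?thesis by simp
  qed
  ultimately have "normalization V E A l"
    unfolding normalization_def using arb AU root by (simp add: n_def U_def l_def)
  then show ?thesis by blast
qed

definition asra ::
  "'a set \<Rightarrow> ('a \<times> 'a) set \<Rightarrow> ('a \<Rightarrow> real \<Rightarrow> real) \<Rightarrow> ('a \<Rightarrow> 'a \<Rightarrow> ereal) \<Rightarrow> ('a \<Rightarrow> 'a \<Rightarrow> ereal)
     \<Rightarrow> ('a \<times> 'a) set \<Rightarrow> (nat \<Rightarrow> 'a) \<Rightarrow> ('a \<Rightarrow> real) option" where
  "asra V E f lam mu A l =
     (let n = card V;
          lam' = (\<lambda>i j. if (i, j) \<in> E then lam i j else mu j i);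
          mu' = (\<lambda>i j. if (i, j) \<in> E then mu i j else lam j i);
          E' = {(i, j). i \<in> {1..n} \<and> j \<in> {1..n} \<and> (l i, l j) \<in> A}
      in map_option (\<lambda>(x, z). \<lambda>v\<in>V. x (the_inv_into {1..n} l v))
           (labelled_problem.run E' (\<lambda>i. f (l i)) (\<lambda>i j. lam' (l i) (l j)) (\<lambda>i j. mu' (l i) (l j)) n))"


end

theory Submission
  imports Defs
begin

text \<open>
  Let \<open>z i j\<close> be a multiplier in \<open>[- lam i j, mu i j]\<close> that equals \<open>- lam i j\<close> if \<open>x i > x j\<close> and
  \<open>mu i j\<close> if \<open>x i < x j\<close>. A point \<open>x\<close> is optimal as soon as some such \<open>z\<close> has divergence
  \<open>(f l)' (x l)\<close> at every node \<open>l\<close>: add up the tangent inequalities of the \<open>f l\<close>. Attaching the node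
  \<open>m + 1\<close> means to move the multiplier \<open>t\<close> of the new edge away from \<open>0\<close> until the new edge
  satisfies the same conditions, while they are kept for all other edges. Only the
  block of nodes tied to \<open>i\<^sub>m\<close> moves; on a tree its flow is determined by the divergences, which
  gives the formula of the algorithm and the monotonicity of each edge flow in \<open>t\<close>.
  In one phase the block moves in one direction only. Therefore every edge passes monotonically
  through the three signs, seen from \<open>i\<^sub>m\<close>, and the iteration stops.
\<close>

section \<open>Strongly convex functions on the real line\<close>

text \<open>Ties shape the argument. An update may leave \<open>t\<close> unchanged, since several
  edges can reach a bound or a common value at the same time. Progress therefore cannot be measured
  in \<open>t\<close>, and a sign may disagree with the end values to the extent that they are
  equal; what survives is the weak order together with a flow at the bound that the sign demands.
  Progress is counted on the edges instead, each seen from the node \<open>i_m\<close>. Which end is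
  the far one depends on the whole tree and not on the current block, so that counts taken in
  different updates are comparable. All monotonicity has one source: the sum of the derivatives
  \<open>(f l)'\<close> over a nonempty set of nodes is a strictly increasing bijection of the
  reals, being the derivative of a strongly convex function. This gives existence and uniqueness of
  the block value, of the times at which flows reach finite bounds, and of the meeting time with the
  new node. Infinite weights need no separate theory: multipliers are real, so an edge whose end
  values violate its constraint could not satisfy the optimality condition.\<close>

definition smooth_strongly_convex :: "(real \<Rightarrow> real) \<Rightarrow> bool" where
  "smooth_strongly_convex g \<longleftrightarrow> (\<forall>x. g differentiable (at x)) \<and> strongly_convex g"

lemma smooth_strongly_convex_DERIV:
  assumes "smooth_strongly_convex g"
  shows "(g has_real_derivative deriv g x) (at x)"
  using assms DERIV_deriv_iff_real_differentiable unfolding smooth_strongly_convex_def by blast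

text \<open>Along the segment from \<open>x\<close> to \<open>y\<close>, strong convexity bounds the
  difference quotient of \<open>g\<close>. Letting \<open>u\<close> tend to 0 from the right turns
  the quotient into the derivative and the factor \<open>1 - u\<close> into 1.\<close>

lemma smooth_strongly_convex_below:
  assumes g: "smooth_strongly_convex g"
  obtains c where "0 < c"
    and "\<And>x y. g x + deriv g x * (y - x) + c / 2 * (y - x)\<^sup>2 \<le> g y"
proof -
  from g obtain c where c: "0 < c"
    and conv: "\<And>x y u. u \<in> {0..1} \<Longrightarrow>
        g ((1 - u) * x + u * y) \<le> (1 - u) * g x + u * g y - c / 2 * u * (1 - u) * (x - y)\<^sup>2"
    unfolding smooth_strongly_convex_def strongly_convex_def by blast
  have "g x + deriv g x * (y - x) + c / 2 * (y - x)\<^sup>2 \<le> g y" for x y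
  proof -
    define h where "h u = g (x + u * (y - x))" for u
    have "(h has_real_derivative deriv g x * (y - x)) (at 0)"
      unfolding h_def
      by (rule DERIV_chain2[where g = "\<lambda>u. x + u * (y - x)"])
        (use smooth_strongly_convex_DERIV[OF g] in \<open>auto intro!: derivative_eq_intros\<close>)
    then have "((\<lambda>u. (h u - h 0) / u) \<longlongrightarrow> deriv g x * (y - x)) (at_right 0)"
      unfolding has_field_derivative_iff by (auto simp: filterlim_at_split)
    moreover have "((\<lambda>u. g y - g x - c / 2 * (1 - u) * (x - y)\<^sup>2) \<longlongrightarrow>
        g y - g x - c / 2 * (1 - 0) * (x - y)\<^sup>2) (at_right 0)"
      by (intro tendsto_intros)
    moreover have "\<forall>\<^sub>F u in at_right 0. (h u - h 0) / u \<le> g y - g x - c / 2 * (1 - u) * (x - y)\<^sup>2"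
      unfolding eventually_at_right_field
    proof (intro exI[of _ 1] conjI allI impI)
      fix u :: real assume u: "0 < u" "u < 1"
      have "h u = g ((1 - u) * x + u * y)" unfolding h_def by (simp add: algebra_simps)
      also have "\<dots> \<le> (1 - u) * g x + u * g y - c / 2 * u * (1 - u) * (x - y)\<^sup>2"
        using conv u by simp
      finally have "h u - h 0 \<le> u * (g y - g x - c / 2 * (1 - u) * (x - y)\<^sup>2)"
        unfolding h_def by (simp add: algebra_simps)
      then show "(h u - h 0) / u \<le> g y - g x - c / 2 * (1 - u) * (x - y)\<^sup>2"
        using u by (simp add: pos_divide_le_eq mult.commute)
    qed simp
    ultimately have "deriv g x * (y - x) \<le> g y - g x - c / 2 * (1 - 0) * (x - y)\<^sup>2"
      by (intro tendsto_le[OF _ _ _]) auto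
    then show ?thesis by (simp add: power2_commute)
  qed
  with c that show thesis by blast
qed

lemma smooth_strongly_convex_tangent:
  assumes "smooth_strongly_convex g"
  shows "g x + deriv g x * (y - x) \<le> g y"
    and "y \<noteq> x \<Longrightarrow> g x + deriv g x * (y - x) < g y"
proof -
  obtain c where c: "0 < c" "g x + deriv g x * (y - x) + c / 2 * (y - x)\<^sup>2 \<le> g y"
    using smooth_strongly_convex_below[OF assms] by metis
  have "0 \<le> c / 2 * (y - x)\<^sup>2" using c by simp
  with c(2) show "g x + deriv g x * (y - x) \<le> g y" by linarith
  assume "y \<noteq> x"
  then have "0 < c / 2 * (y - x)\<^sup>2" using c by simp
  with c(2) show "g x + deriv g x * (y - x) < g y" by linarith
qed

text \<open>Adding the quadratic lower bounds at \<open>x\<close> and at \<open>y\<close> cancels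
  the function values. The estimate makes the inverse of \<open>deriv g\<close> Lipschitz with
  constant \<open>1 / c\<close>, which is what the conjugate needs.\<close>

lemma deriv_strongly_monotone:
  assumes "smooth_strongly_convex g"
  obtains c where "0 < c" and "\<And>x y. c * \<bar>x - y\<bar> \<le> \<bar>deriv g x - deriv g y\<bar>"
proof -
  obtain c where c: "0 < c"
    and below: "\<And>x y. g x + deriv g x * (y - x) + c / 2 * (y - x)\<^sup>2 \<le> g y"
    using smooth_strongly_convex_below[OF assms] by metis
  have "c * \<bar>x - y\<bar> \<le> \<bar>deriv g x - deriv g y\<bar>" for x y
  proof (cases "x = y")
    case False
    have "c * (x - y)\<^sup>2 \<le> (deriv g x - deriv g y) * (x - y)"
      using below[of x y] below[of y x] by (simp add: algebra_simps power2_commute[of y x])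
    also have "\<dots> \<le> \<bar>deriv g x - deriv g y\<bar> * \<bar>x - y\<bar>"
      by (metis abs_ge_self abs_mult)
    finally have "(c * \<bar>x - y\<bar>) * \<bar>x - y\<bar> \<le> \<bar>deriv g x - deriv g y\<bar> * \<bar>x - y\<bar>"
      by (simp add: power2_eq_square)
    with False show ?thesis by simp
  qed simp
  with c that show thesis by blast
qed

lemma strict_mono_deriv:
  assumes "smooth_strongly_convex g"
  shows "strict_mono (deriv g)"
proof (rule strict_monoI)
  fix x y :: real assume "x < y"
  have "g x + deriv g x * (y - x) < g y" "g y + deriv g y * (x - y) < g x"
    using smooth_strongly_convex_tangent(2)[OF assms] \<open>x < y\<close> by auto
  then have "0 < (deriv g y - deriv g x) * (y - x)" by (simp add: algebra_simps)
  with \<open>x < y\<close> show "deriv g x < deriv g y" by (simp add: zero_less_mult_iff)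
qed

text \<open>A minimiser of \<open>g x - y * x\<close> has slope \<open>y\<close>. It exists because
  the quadratic lower bound at 0 confines the search to a compact interval.\<close>

lemma surj_deriv:
  assumes g: "smooth_strongly_convex g"
  shows "surj (deriv g)"
  unfolding surj_def
proof
  fix y :: real
  obtain c where c: "0 < c"
    and below: "\<And>x y. g x + deriv g x * (y - x) + c / 2 * (y - x)\<^sup>2 \<le> g y"
    using smooth_strongly_convex_below[OF g] by metis
  define h where "h x = g x - y * x" for x
  have dh: "(h has_real_derivative deriv g x - y) (at x)" for x
    unfolding h_def using smooth_strongly_convex_DERIV[OF g]
    by (auto intro!: derivative_eq_intros)
  \<comment> \<open>Beyond this radius the quadratic term with factor \<open>c / 2\<close> outweighs
    the linear term with slope \<open>deriv g 0 - y\<close>, so \<open>h\<close> is at least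
    \<open>h 0\<close> there.\<close>
  define R where "R = 2 * \<bar>deriv g 0 - y\<bar> / c"
  have R: "0 \<le> R" using c unfolding R_def by simp
  have "continuous_on {- R..R} h"
    using dh by (meson DERIV_isCont continuous_at_imp_continuous_on)
  then obtain a where a: "a \<in> {- R..R}" "\<And>x. x \<in> {- R..R} \<Longrightarrow> h a \<le> h x"
    using continuous_attains_inf[of "{- R..R}" h] R by auto
  have "h a \<le> h x" for x
  proof (cases "x \<in> {- R..R}")
    case False
    then have "R < \<bar>x\<bar>" by auto
    then have "\<bar>deriv g 0 - y\<bar> \<le> c / 2 * \<bar>x\<bar>" using c unfolding R_def by (simp add: field_simps)
    then have "\<bar>deriv g 0 - y\<bar> * \<bar>x\<bar> \<le> c / 2 * \<bar>x\<bar> * \<bar>x\<bar>" by (rule mult_right_mono) simp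
    then have "\<bar>(deriv g 0 - y) * x\<bar> \<le> c / 2 * x\<^sup>2" by (simp add: abs_mult power2_eq_square)
    then have "- ((deriv g 0 - y) * x) \<le> c / 2 * x\<^sup>2" by linarith
    moreover have "g 0 + deriv g 0 * x + c / 2 * x\<^sup>2 \<le> g x" using below[of 0 x] by simp
    ultimately have "h 0 \<le> h x" unfolding h_def left_diff_distrib by linarith
    with a(2)[of 0] R show ?thesis by simp
  qed (use a in auto)
  then have "deriv g a - y = 0"
    using DERIV_local_min[OF dh, of 1 a] by auto
  then have "y = deriv g a" by simp
  then show "\<exists>x. y = deriv g x" by blast
qed

text \<open>The supremum is attained at \<open>k z\<close>, the point where \<open>g\<close> has
  slope \<open>z\<close>. Testing the supremum at \<open>y + h\<close> with the point
  \<open>k y\<close>, and the one at \<open>y\<close> with \<open>k (y + h)\<close>, encloses the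
  increment of the conjugate between \<open>h * k y\<close> and \<open>h * k (y + h)\<close>. The
  Lipschitz bound for \<open>k\<close> then suffices; \<open>k\<close> itself is not
  differentiated.\<close>

lemma deriv_convex_conjugate:
  assumes g: "smooth_strongly_convex g"
  shows "deriv (convex_conjugate g) y = inv (deriv g) y"
proof -
  define k where "k = inv (deriv g)"
  have k: "deriv g (k y) = y" for y
    unfolding k_def using surj_deriv[OF g] by (rule surj_f_inv_f)
  have le: "z * x - g x \<le> z * k z - g (k z)" for z x
    using smooth_strongly_convex_tangent(1)[OF g, of "k z" x] k[of z] by (simp add: algebra_simps)
  have conj: "convex_conjugate g z = z * k z - g (k z)" for z
    unfolding convex_conjugate_def by (rule cSup_eq_maximum) (use le in auto)
  obtain c where c: "0 < c" "\<And>x y. c * \<bar>x - y\<bar> \<le> \<bar>deriv g x - deriv g y\<bar>"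
    using deriv_strongly_monotone[OF g] by metis
  have "((\<lambda>h. (convex_conjugate g (y + h) - convex_conjugate g y) / h - k y) \<longlongrightarrow> 0) (at 0)"
  proof (rule Lim_null_comparison)
    show "\<forall>\<^sub>F h in at 0. norm ((convex_conjugate g (y + h) - convex_conjugate g y) / h - k y)
        \<le> \<bar>h\<bar> / c"
      unfolding eventually_at_filter
    proof (intro always_eventually allI impI)
      fix h :: real assume h: "h \<noteq> 0"
      let ?D = "convex_conjugate g (y + h) - convex_conjugate g y - h * k y"
      have "0 \<le> ?D" using le[of "y + h" "k y"] unfolding conj by (simp add: algebra_simps)
      moreover have "?D \<le> h * (k (y + h) - k y)"
        using le[of y "k (y + h)"] unfolding conj by (simp add: algebra_simps)
      moreover have "h * (k (y + h) - k y) \<le> \<bar>h\<bar> * \<bar>k (y + h) - k y\<bar>"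
        by (metis abs_ge_self abs_mult)
      moreover have "\<bar>k (y + h) - k y\<bar> \<le> \<bar>h\<bar> / c"
        using c(2)[of "k (y + h)" "k y"] c(1) k by (simp add: field_simps)
      ultimately have "\<bar>?D\<bar> \<le> \<bar>h\<bar> * (\<bar>h\<bar> / c)"
        by (smt (verit) mult_left_mono abs_ge_zero)
      moreover have "(convex_conjugate g (y + h) - convex_conjugate g y) / h - k y = ?D / h"
        using h by (simp add: field_simps)
      ultimately show "norm ((convex_conjugate g (y + h) - convex_conjugate g y) / h - k y)
          \<le> \<bar>h\<bar> / c"
        using h by (simp add: abs_divide field_simps)
    qed
    have "((\<lambda>h::real. \<bar>h\<bar> / c) \<longlongrightarrow> \<bar>0\<bar> / c) (at 0)"
      using c(1) by (intro tendsto_intros) auto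
    then show "((\<lambda>h::real. \<bar>h\<bar> / c) \<longlongrightarrow> 0) (at 0)" by simp
  qed
  then have "(convex_conjugate g has_real_derivative k y) (at y)"
    unfolding DERIV_def using LIM_zero_iff by blast
  then show ?thesis unfolding k_def by (rule DERIV_imp_deriv)
qed

lemma smooth_strongly_convex_add:
  assumes g: "smooth_strongly_convex g" and h: "smooth_strongly_convex h"
  shows "smooth_strongly_convex (\<lambda>x. g x + h x)"
proof -
  from g obtain c where c: "0 < c" "\<And>x y u. u \<in> {0..1} \<Longrightarrow>
      g ((1 - u) * x + u * y) \<le> (1 - u) * g x + u * g y - c / 2 * u * (1 - u) * (x - y)\<^sup>2"
    unfolding smooth_strongly_convex_def strongly_convex_def by blast
  from h obtain d where d: "0 < d" "\<And>x y u. u \<in> {0..1} \<Longrightarrow>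
      h ((1 - u) * x + u * y) \<le> (1 - u) * h x + u * h y - d / 2 * u * (1 - u) * (x - y)\<^sup>2"
    unfolding smooth_strongly_convex_def strongly_convex_def by blast
  have "strongly_convex (\<lambda>x. g x + h x)"
    unfolding strongly_convex_def
  proof (intro exI[of _ "c + d"] conjI allI ballI)
    fix x y u :: real assume "u \<in> {0..1}"
    moreover have "(c + d) / 2 * u * (1 - u) * (x - y)\<^sup>2 =
        c / 2 * u * (1 - u) * (x - y)\<^sup>2 + d / 2 * u * (1 - u) * (x - y)\<^sup>2"
      by (simp add: add_divide_distrib distrib_right)
    ultimately show "g ((1 - u) * x + u * y) + h ((1 - u) * x + u * y)
        \<le> (1 - u) * (g x + h x) + u * (g y + h y) - (c + d) / 2 * u * (1 - u) * (x - y)\<^sup>2"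
      using c(2)[of u x y] d(2)[of u x y] unfolding distrib_left by linarith
  qed (use c d in simp)
  then show ?thesis using g h unfolding smooth_strongly_convex_def by simp
qed

lemma smooth_strongly_convex_sum:
  assumes "finite S" "S \<noteq> {}" "\<And>l. l \<in> S \<Longrightarrow> smooth_strongly_convex (f l)"
  shows "smooth_strongly_convex (\<lambda>x. \<Sum>l\<in>S. f l x)"
  using assms by (induction S rule: finite_ne_induct) (auto intro: smooth_strongly_convex_add)

lemma deriv_sum_smooth:
  assumes "\<And>l. l \<in> S \<Longrightarrow> smooth_strongly_convex (f l)"
  shows "deriv (\<lambda>x. \<Sum>l\<in>S. f l x) y = (\<Sum>l\<in>S. deriv (f l) y)"
  by (intro DERIV_imp_deriv DERIV_sum smooth_strongly_convex_DERIV assms)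

section \<open>Paths and flows in trees\<close>

lemma undirected_path_refl: "undirected_path E u [u] u"
  by (simp add: undirected_path_def)

lemma undirected_path_snoc:
  assumes "undirected_path E u p a" "(a, b) \<in> E \<union> E\<inverse>" "b \<notin> set p"
  shows "undirected_path E u (p @ [b]) b"
  using assms by (auto simp: undirected_path_def successively_append_iff)

lemma undirected_path_prefix:
  assumes "undirected_path E u (p @ b # q) v"
  shows "undirected_path E u (p @ [b]) b"
proof -
  have "p @ b # q = (p @ [b]) @ q" by simp
  with assms show ?thesis
    unfolding undirected_path_def by (metis (no_types, lifting) append_is_Nil_conv distinct_append
      hd_append2 last_snoc list.distinct(1) successively_append_iff)
qed

lemma undirected_path_mono:
  assumes "undirected_path F u p v" "F \<subseteq> E"
  shows "undirected_path E u p v"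
  using assms unfolding undirected_path_def
  by (auto elim!: successively_mono)

lemma undirected_path_last_edge:
  assumes "undirected_path E u (p @ [b]) v" "p \<noteq> []"
  shows "(last p, b) \<in> E \<union> E\<inverse>"
  using assms by (auto simp: undirected_path_def successively_append_iff)

lemma rtrancl_imp_undirected_path:
  assumes "(u, v) \<in> (E \<union> E\<inverse>)\<^sup>*"
  shows "\<exists>p. undirected_path E u p v"
  using assms
proof (induction rule: rtrancl_induct)
  case base
  then show ?case using undirected_path_refl by metis
next
  case (step a b)
  then obtain p where p: "undirected_path E u p a" by blast
  show ?case
  proof (cases "b \<in> set p")
    case True
    then obtain p1 p2 where "p = p1 @ b # p2" by (meson split_list)
    then show ?thesis using undirected_path_prefix p by metis
  next
    case False
    then show ?thesis using undirected_path_snoc p step.hyps by metis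
  qed
qed

text \<open>Two continuations that leave \<open>u\<close> through different neighbours meet again,
  at \<open>v\<close> at the latest; the two pieces up to a first meeting point close a cycle
  through \<open>u\<close>.\<close>

lemma undirected_path_unique:
  assumes acyc: "\<nexists>c. undirected_cycle E c"
    and "undirected_path E u p v" "undirected_path E u q v"
  shows "p = q"
  using assms(2,3)
proof (induction p arbitrary: u q)
  case Nil
  then show ?case by (simp add: undirected_path_def)
next
  case (Cons x p)
  let ?P = "\<lambda>a b. (a, b) \<in> E \<union> E\<inverse>"
  have x: "x = u" using Cons.prems by (simp add: undirected_path_def)
  obtain q' where q: "q = u # q'"
    using Cons.prems(2) by (cases q) (auto simp: undirected_path_def)
  show ?case
  proof (cases "p = [] \<or> q' = []")
    case True
    then have "u = v" using Cons.prems x q by (auto simp: undirected_path_def)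
    then have "p = [] \<and> q' = []"
      using Cons.prems x q by (auto simp: undirected_path_def split: if_splits dest: last_in_set)
    then show ?thesis using x q by simp
  next
    case False
    have pu: "undirected_path E (hd p) p v" "undirected_path E (hd q') q' v"
      and e: "?P u (hd p)" "?P u (hd q')" and nin: "u \<notin> set p" "u \<notin> set q'"
      using Cons.prems x q False by (auto simp: undirected_path_def successively_Cons)
    show ?thesis
    proof (cases "hd p = hd q'")
      case True
      then show ?thesis using Cons.IH pu x q by metis
    next
      case neq: False
      have "v \<in> set p" "v \<in> set q'"
        using pu unfolding undirected_path_def by (metis last_in_set)+
      then have "\<exists>w\<in>set p. w \<in> set q'" by blast
      \<comment> \<open>Taking the first node of \<open>p\<close> that lies on \<open>q'\<close>
        keeps \<open>p1\<close> disjoint from \<open>q'\<close>, so the closed walk repeats no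
        node.\<close>
      then obtain p1 w p2 where p: "p = p1 @ w # p2" "w \<in> set q'" "\<forall>y\<in>set p1. y \<notin> set q'"
        using split_list_first_prop[of p "\<lambda>w. w \<in> set q'"] by blast
      obtain q1 q2 where q': "q' = q1 @ w # q2" using p(2) by (meson split_list)
      define c where "c = u # p1 @ w # rev q1"
      \<comment> \<open>\<open>w\<close> cannot be the first node of both continuations, as these
        start differently; this supplies the third node that a cycle needs.\<close>
      have "p1 \<noteq> [] \<or> q1 \<noteq> []" using neq p q' by auto
      then have len: "3 \<le> length c"
        unfolding c_def by (cases p1; cases q1) auto
      have dist: "distinct c"
        using pu nin p q' unfolding c_def undirected_path_def by auto
      have s1: "successively ?P (u # p1 @ [w])"
        using undirected_path_prefix[of E u "u # p1" w p2 v] Cons.prems(1) x p(1)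
        unfolding undirected_path_def by simp
      have "successively ?P (q1 @ [w])"
        using undirected_path_prefix[of E "hd q'" q1 w q2 v] pu(2) q'
        unfolding undirected_path_def by simp
      then have "successively ?P (rev (q1 @ [w]))"
        unfolding successively_rev by (rule successively_mono) auto
      then have s2: "successively ?P (w # rev q1)" by simp
      have "successively ?P ((u # p1) @ (w # rev q1))"
        using s1[folded append_Cons] s2 unfolding successively_append_iff by auto
      then have succ: "successively ?P c" unfolding c_def by simp
      have "last c = hd q'" unfolding c_def q' by (cases q1) auto
      then have "(last c, hd c) \<in> E \<union> E\<inverse>" using e(2) unfolding c_def by auto
      then have "undirected_cycle E c"
        using len dist succ unfolding undirected_cycle_def by simp
      then show ?thesis using acyc by blast
    qed
  qed
qed

section \<open>Flows on a rooted tree and their divergences\<close>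

definition net_flow :: "('a \<times> 'a) set \<Rightarrow> ('a \<times> 'a \<Rightarrow> real) \<Rightarrow> 'a \<Rightarrow> 'a \<Rightarrow> real" where
  "net_flow F z l k = (if (l, k) \<in> F then z (l, k) else 0) - (if (k, l) \<in> F then z (k, l) else 0)"

lemma net_flow_swap: "net_flow F z k l = - net_flow F z l k"
  by (simp add: net_flow_def)

text \<open>\<open>r\<close> is a viewpoint and need not be the source of the directed edges: in the
  main use, the trees are looked at from the node to which the new one is attached.\<close>

locale rooted_tree =
  fixes N :: "'a set" and F :: "('a \<times> 'a) set" and r :: 'a
  assumes fin: "finite N"
    and F_sub: "F \<subseteq> N \<times> N"
    and F_asym: "asym F"
    and acyc: "\<nexists>c. undirected_cycle F c"
    and root: "r \<in> N"
    and reach: "i \<in> N \<Longrightarrow> (r, i) \<in> (F \<union> F\<inverse>)\<^sup>*"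
begin

definition route :: "'a \<Rightarrow> 'a list" where
  "route i = (THE p. undirected_path F r p i)"

lemma route_eq: "undirected_path F r p i \<Longrightarrow> route i = p"
  unfolding route_def using undirected_path_unique[OF acyc] by blast

lemma route_path: "i \<in> N \<Longrightarrow> undirected_path F r (route i) i"
  using rtrancl_imp_undirected_path[OF reach] route_eq by metis

lemma route_root: "route r = [r]"
  by (rule route_eq[OF undirected_path_refl])

lemma route_nonempty: "i \<in> N \<Longrightarrow> route i \<noteq> []"
  and last_route: "i \<in> N \<Longrightarrow> last (route i) = i"
  and hd_route: "i \<in> N \<Longrightarrow> hd (route i) = r"
  and distinct_route: "i \<in> N \<Longrightarrow> distinct (route i)"
  using route_path unfolding undirected_path_def by auto

lemma self_in_route: "i \<in> N \<Longrightarrow> i \<in> set (route i)"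
  using last_route route_nonempty last_in_set by metis

lemma root_in_route: "i \<in> N \<Longrightarrow> r \<in> set (route i)"
  using hd_route route_nonempty hd_in_set by metis

lemma route_prefix: "i \<in> N \<Longrightarrow> route i = p @ k # q \<Longrightarrow> route k = p @ [k]"
  using route_path undirected_path_prefix route_eq by metis

lemma route_subset: "i \<in> N \<Longrightarrow> set (route i) \<subseteq> N"
proof
  fix k assume i: "i \<in> N" and "k \<in> set (route i)"
  then obtain p q where pq: "route i = p @ k # q" by (meson split_list)
  show "k \<in> N"
  proof (cases p)
    case Nil
    then show ?thesis using hd_route[OF i] pq root by simp
  next
    case (Cons a b)
    then have "(last p, k) \<in> F \<union> F\<inverse>"
      using undirected_path_last_edge[of F r p k] route_path[OF i] pq undirected_path_prefix
      by (metis list.distinct(1))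
    then show ?thesis using F_sub by auto
  qed
qed

definition child :: "'a \<Rightarrow> 'a \<Rightarrow> bool" where
  "child c p \<longleftrightarrow> c \<in> N \<and> p \<in> N \<and> route c = route p @ [c]"

lemma child_edge: "child c p \<Longrightarrow> (p, c) \<in> F \<union> F\<inverse>"
  using undirected_path_last_edge[of F r "route p" c c] route_path[of c]
    route_nonempty[of p] last_route[of p]
  unfolding child_def by simp

text \<open>If \<open>b\<close> is not on the route to \<open>a\<close>, appending it gives the
  route to \<open>b\<close>. Otherwise the route cut off at \<open>b\<close> and continued by the
  edge is, by uniqueness of paths, the whole route to \<open>a\<close>.\<close>

lemma edge_child:
  assumes "(a, b) \<in> F \<union> F\<inverse>"
  shows "child a b \<or> child b a"
proof -
  have N: "a \<in> N" "b \<in> N" using assms F_sub by auto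
  have neq: "a \<noteq> b" using assms F_asym by (auto dest: asymD)
  show ?thesis
  proof (cases "b \<in> set (route a)")
    case False
    then have "undirected_path F r (route a @ [b]) b"
      using undirected_path_snoc route_path[OF N(1)] assms by metis
    then show ?thesis unfolding child_def using route_eq N by auto
  next
    case True
    then obtain p q where pq: "route a = p @ b # q" by (meson split_list)
    have b: "route b = p @ [b]" using route_prefix[OF N(1) pq] .
    have "a \<in> set q" using last_route[OF N(1)] pq neq by (auto split: if_splits)
    then have "a \<notin> set (p @ [b])" using distinct_route[OF N(1)] pq by auto
    then have "undirected_path F r ((p @ [b]) @ [a]) a"
      using undirected_path_snoc route_path[OF N(2)] assms b by fastforce
    then show ?thesis unfolding child_def using route_eq N b by metis
  qed
qed

lemma child_antisym: "child a b \<Longrightarrow> \<not> child b a"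
  unfolding child_def by (metis append_assoc append_is_Nil_conv append_self_conv list.distinct(1))

lemma not_child_root: "\<not> child r p"
  unfolding child_def using route_root route_nonempty by auto

lemma child_unique: "child c p \<Longrightarrow> child c q \<Longrightarrow> p = q"
  unfolding child_def using last_route by (metis butlast_snoc)

lemma parent_exists:
  assumes "c \<in> N" "c \<noteq> r"
  shows "\<exists>p. child c p"
proof -
  obtain q where q: "route c = q @ [c]"
    using last_route[OF assms(1)] route_nonempty[OF assms(1)] append_butlast_last_id by metis
  then have "q \<noteq> []" using hd_route[OF assms(1)] assms(2) by auto
  then have "route (last q) = q" "last q \<in> N"
    using route_prefix[OF assms(1), of "butlast q" "last q" "[c]"] q
      route_subset[OF assms(1)] append_butlast_last_id by auto
  then show ?thesis using q assms unfolding child_def by metis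
qed

text \<open>The node itself is included, so that for a block this is the set \<open>C_i\<close> of
  the algorithm.\<close>

definition descendants :: "'a \<Rightarrow> 'a set" where
  "descendants i = {j \<in> N. i \<in> set (route j)}"

lemma route_psubset_iff:
  assumes "i \<in> N" "j \<in> N"
  shows "set (route i) \<subset> set (route j) \<longleftrightarrow> i \<in> set (route j) \<and> i \<noteq> j"
proof
  assume "set (route i) \<subset> set (route j)"
  then show "i \<in> set (route j) \<and> i \<noteq> j" using self_in_route[OF assms(1)] by auto
next
  assume i: "i \<in> set (route j) \<and> i \<noteq> j"
  then obtain p q where pq: "route j = p @ i # q" by (meson split_list)
  then have "route i = p @ [i]" by (rule route_prefix[OF assms(2)])
  moreover have "j \<in> set q" using last_route[OF assms(2)] pq i by (auto split: if_splits)
  ultimately show "set (route i) \<subset> set (route j)"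
    using pq distinct_route[OF assms(2)] by auto
qed

lemma finite_descendants: "finite (descendants i)"
  unfolding descendants_def using fin by simp

lemma self_descendant: "i \<in> N \<Longrightarrow> i \<in> descendants i"
  unfolding descendants_def using self_in_route by simp

lemma descendants_root: "descendants r = N"
  unfolding descendants_def using root_in_route by auto

lemma descendants_eq:
  assumes "l \<in> N"
  shows "descendants l = insert l (\<Union>c\<in>{c. child c l}. descendants c)"
proof (intro equalityI subsetI)
  fix j assume "j \<in> descendants l"
  then have j: "j \<in> N" "l \<in> set (route j)" unfolding descendants_def by auto
  then obtain p q where pq: "route j = p @ l # q" by (meson split_list)
  show "j \<in> insert l (\<Union>c\<in>{c. child c l}. descendants c)"
  proof (cases q)
    case Nil
    then show ?thesis using last_route[OF j(1)] pq by simp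
  next
    case (Cons c q')
    then have "route c = (p @ [l]) @ [c]" using route_prefix[OF j(1), of "p @ [l]" c q'] pq by simp
    moreover have "route l = p @ [l]" using route_prefix[OF j(1) pq] .
    moreover have "c \<in> set (route j)" using pq Cons by simp
    moreover have "c \<in> N" using route_subset[OF j(1)] pq Cons by auto
    ultimately show ?thesis using assms j unfolding child_def descendants_def by auto
  qed
next
  fix j assume "j \<in> insert l (\<Union>c\<in>{c. child c l}. descendants c)"
  then consider "j = l" | c where "child c l" "j \<in> descendants c" by auto
  then show "j \<in> descendants l"
  proof cases
    case 1
    then show ?thesis using self_descendant assms by simp
  next
    case 2
    then obtain p q where pq: "route j = p @ c # q" unfolding descendants_def by (auto dest: split_list)
    then have "route c = p @ [c]" using route_prefix 2 unfolding descendants_def by blast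
    then have "p = route l" using 2 unfolding child_def by simp
    then have "l \<in> set (route j)" using self_in_route[OF assms] pq by simp
    then show ?thesis using 2 unfolding descendants_def by simp
  qed
qed

lemma not_descendant_child: "child c l \<Longrightarrow> l \<notin> descendants c"
  unfolding child_def descendants_def using distinct_route[of c] self_in_route[of l]
    route_prefix[of l _ c]
  by (metis (mono_tags, lifting) append_self_conv append.assoc append_Cons append_Nil
      distinct.simps(2) mem_Collect_eq not_Cons_self2 split_list list.distinct(1) append_is_Nil_conv)

text \<open>On the route to a common descendant, each of the two children would be the node directly
  after \<open>route l\<close>.\<close>

lemma descendants_disjoint:
  assumes "child c l" "child d l" "c \<noteq> d"
  shows "descendants c \<inter> descendants d = {}"
proof (rule ccontr)
  assume "descendants c \<inter> descendants d \<noteq> {}"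
  then obtain j where j: "j \<in> N" "c \<in> set (route j)" "d \<in> set (route j)"
    unfolding descendants_def by auto
  obtain p q where pq: "route j = p @ c # q" using j(2) by (meson split_list)
  obtain p' q' where pq': "route j = p' @ d # q'" using j(3) by (meson split_list)
  have "route c = p @ [c]" "route d = p' @ [d]" using route_prefix[OF j(1)] pq pq' by blast+
  then have "p = route l" "p' = route l" using assms unfolding child_def by auto
  then show False using pq pq' assms(3) by simp
qed

lemma finite_children: "finite {c. child c l}"
  by (rule finite_subset[OF _ fin]) (auto simp: child_def)

lemma sum_descendants:
  assumes "l \<in> N"
  shows "sum g (descendants l) = g l + (\<Sum>c | child c l. sum g (descendants c))"
proof -
  have "sum g (descendants l) = g l + sum g (\<Union>c\<in>{c. child c l}. descendants c)"
    unfolding descendants_eq[OF assms]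
    by (rule sum.insert) (use finite_children finite_descendants not_descendant_child in auto)
  also have "sum g (\<Union>c\<in>{c. child c l}. descendants c) = (\<Sum>c | child c l. sum g (descendants c))"
    by (rule sum.UNION_disjoint)
      (use finite_children finite_descendants descendants_disjoint in auto)
  finally show ?thesis .
qed

lemma net_flow_zero: "\<not> child l k \<Longrightarrow> \<not> child k l \<Longrightarrow> net_flow F z l k = 0"
  unfolding net_flow_def using edge_child[of l k] by auto

text \<open>The divergence at a node is the flow it sends to its parent minus what it receives from
  its children. Solving from the leaves towards \<open>r\<close> forces the flow on a parent edge to
  be the sum of \<open>g\<close> below it; at \<open>r\<close>, which has no parent, the same
  relation becomes the solvability condition. One direction recognises the flows of a given state,
  the other verifies the flows that the algorithm writes down.\<close>

lemma divergence_iff: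
  "(\<forall>l\<in>N. (\<Sum>k\<in>N. net_flow F z l k) = g l) \<longleftrightarrow>
     sum g N = 0 \<and> (\<forall>c p. child c p \<longrightarrow> net_flow F z c p = sum g (descendants c))"
proof -
  \<comment> \<open>The flow towards the parent, set to 0 at the root so that one recursion covers
    all nodes.\<close>
  define H where "H l = (if l = r then 0 else net_flow F z l (SOME p. child l p))" for l
  have H_child: "H c = net_flow F z c p" if "child c p" for c p
  proof -
    have "(SOME p. child c p) = p" using that child_unique by (metis someI_ex)
    then show ?thesis unfolding H_def using that not_child_root by auto
  qed
  have rec: "(\<Sum>k\<in>N. net_flow F z l k) = H l - (\<Sum>c | child c l. H c)" if l: "l \<in> N" for l
  proof -
    have "(\<Sum>k\<in>N. net_flow F z l k) =
        (\<Sum>k\<in>N. (if child l k then net_flow F z l k else 0) + (if child k l then net_flow F z l k else 0))"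
      by (rule sum.cong) (use net_flow_zero child_antisym in auto)
    also have "\<dots> = (\<Sum>k | k \<in> N \<and> child l k. net_flow F z l k)
        + (\<Sum>k | k \<in> N \<and> child k l. net_flow F z l k)"
      by (simp add: sum.distrib sum.inter_filter fin)
    also have "(\<Sum>k | k \<in> N \<and> child l k. net_flow F z l k) = H l"
    proof (cases "l = r")
      case True
      then show ?thesis using not_child_root by (simp add: H_def)
    next
      case False
      then obtain p where p: "child l p" using parent_exists[OF l] by blast
      then have "{k. k \<in> N \<and> child l k} = {p}" using child_unique unfolding child_def by blast
      then show ?thesis using H_child p by simp
    qed
    also have "(\<Sum>k | k \<in> N \<and> child k l. net_flow F z l k) = - (\<Sum>c | child c l. H c)"
      unfolding sum_negf[symmetric]
      by (rule sum.cong) (auto simp: child_def H_child net_flow_swap[of F z l])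
    finally show ?thesis by simp
  qed
  have D: "sum g (descendants l) - (\<Sum>c | child c l. sum g (descendants c)) = g l" if "l \<in> N" for l
    using sum_descendants[OF that, of g] by simp
  show ?thesis
  proof
    assume L: "\<forall>l\<in>N. (\<Sum>k\<in>N. net_flow F z l k) = g l"
    have HD: "H l = sum g (descendants l)" if "l \<in> N" for l
      using that
    proof (induction "card (descendants l)" arbitrary: l rule: less_induct)
      case less
      have "H c = sum g (descendants c)" if c: "child c l" for c
      proof (rule less.hyps)
        have "descendants c \<subset> descendants l"
          using descendants_eq[OF less.prems] c not_descendant_child[OF c] by blast
        then show "card (descendants c) < card (descendants l)"
          by (rule psubset_card_mono[OF finite_descendants])
      qed (use c child_def in auto)
      then have "(\<Sum>c | child c l. H c) = (\<Sum>c | child c l. sum g (descendants c))" by simp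
      moreover have "H l - (\<Sum>c | child c l. H c) = g l" using rec L less.prems by metis
      ultimately show ?case using D[OF less.prems] by linarith
    qed
    have "sum g N = 0" using HD[OF root] descendants_root by (simp add: H_def)
    moreover have "net_flow F z c p = sum g (descendants c)" if "child c p" for c p
      using HD[of c] H_child[OF that] that unfolding child_def by simp
    ultimately show "sum g N = 0 \<and>
        (\<forall>c p. child c p \<longrightarrow> net_flow F z c p = sum g (descendants c))" by blast
  next
    assume R: "sum g N = 0 \<and> (\<forall>c p. child c p \<longrightarrow> net_flow F z c p = sum g (descendants c))"
    have HD: "H l = sum g (descendants l)" if l: "l \<in> N" for l
    proof (cases "l = r")
      case True
      then show ?thesis using R descendants_root by (simp add: H_def)
    next
      case False
      then obtain p where "child l p" using parent_exists[OF l] by blast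
      then show ?thesis using R H_child by simp
    qed
    have "(\<Sum>c | child c l. H c) = (\<Sum>c | child c l. sum g (descendants c))" for l
      by (rule sum.cong) (use HD in \<open>auto simp: child_def\<close>)
    then show "\<forall>l\<in>N. (\<Sum>k\<in>N. net_flow F z l k) = g l" using rec D HD by simp
  qed
qed

end

section \<open>Optimality conditions\<close>

text \<open>As a function of \<open>d\<close>, the penalty is convex with slopes \<open>- M\<close>
  and \<open>L\<close> on the two sides of 0, and \<open>- z\<close> lies between them.\<close>

lemma edge_penalty_ge:
  fixes L M :: ereal and z d :: real
  assumes "0 \<le> L" "0 \<le> M" and z: "- L \<le> ereal z" "ereal z \<le> M"
  shows "ereal (- z * d) \<le> L * ereal (max 0 d) + M * ereal (max 0 (- d))"
proof (cases "0 \<le> d")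
  case True
  have "ereal (- z) \<le> L" using z(1) by (metis ereal_uminus_le_reorder uminus_ereal.simps(1))
  then have "ereal (- z) * ereal d \<le> L * ereal d"
    using True by (intro ereal_mult_right_mono) auto
  then show ?thesis using True by (auto simp: max_def zero_ereal_def[symmetric])
next
  case False
  have "ereal z * ereal (- d) \<le> M * ereal (- d)"
    using False z(2) by (intro ereal_mult_right_mono) auto
  then show ?thesis using False by (auto simp: max_def zero_ereal_def[symmetric])
qed

text \<open>The subgradient inequality is tight here. An infinite weight is harmless: on the side of
  \<open>d\<close> where it would be paid, it equals the real number \<open>- z\<close> or
  \<open>z\<close>.\<close>

lemma edge_penalty_eq:
  fixes L M :: ereal and z d :: real
  assumes "d > 0 \<Longrightarrow> ereal z = - L" "d < 0 \<Longrightarrow> ereal z = M"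
  shows "L * ereal (max 0 d) + M * ereal (max 0 (- d)) = ereal (- z * d)"
proof -
  consider "d > 0" | "d < 0" | "d = 0" by linarith
  then show ?thesis
  proof cases
    case 1
    then have "L = ereal (- z)" using assms(1) by (metis ereal_uminus_eq_reorder uminus_ereal.simps(1))
    then show ?thesis using 1 by (simp add: zero_ereal_def[symmetric])
  next
    case 2
    then have "M = ereal z" using assms(2) by simp
    then show ?thesis using 2 by (simp add: zero_ereal_def[symmetric])
  qed (simp add: zero_ereal_def[symmetric])
qed

lemma sum_over_edges:
  assumes "finite V" "E \<subseteq> V \<times> V"
  shows "(\<Sum>l\<in>V. \<Sum>k\<in>V. if (l, k) \<in> E then h l k else 0) = (\<Sum>(l, k)\<in>E. h l k)"
proof -
  have "(\<Sum>l\<in>V. \<Sum>k\<in>V. if (l, k) \<in> E then h l k else 0)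
      = (\<Sum>e\<in>V \<times> V. if e \<in> E then (case e of (l, k) \<Rightarrow> h l k) else 0)"
    by (subst sum.cartesian_product) (auto intro!: sum.cong)
  also have "\<dots> = (\<Sum>(l, k)\<in>E. h l k)"
    using assms by (intro sum.mono_neutral_cong_right) auto
  finally show ?thesis .
qed

text \<open>Summation by parts: each edge contributes its flow once with \<open>y\<close> at its
  tail and once, negatively, with \<open>y\<close> at its head.\<close>

lemma sum_net_flow:
  assumes "finite V" "E \<subseteq> V \<times> V"
  shows "(\<Sum>l\<in>V. (\<Sum>k\<in>V. net_flow E z l k) * y l) = (\<Sum>(i, j)\<in>E. z (i, j) * (y i - y j))"
proof -
  have "(\<Sum>l\<in>V. (\<Sum>k\<in>V. net_flow E z l k) * y l) =
      (\<Sum>l\<in>V. \<Sum>k\<in>V. if (l, k) \<in> E then z (l, k) * y l else 0)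
      - (\<Sum>l\<in>V. \<Sum>k\<in>V. if (k, l) \<in> E then z (k, l) * y l else 0)"
    unfolding sum_subtractf[symmetric] sum_distrib_right
    by (intro sum.cong) (auto simp: net_flow_def algebra_simps)
  also have "(\<Sum>l\<in>V. \<Sum>k\<in>V. if (k, l) \<in> E then z (k, l) * y l else 0)
      = (\<Sum>k\<in>V. \<Sum>l\<in>V. if (k, l) \<in> E then z (k, l) * y l else 0)"
    by (rule sum.swap)
  finally show ?thesis
    unfolding sum_over_edges[OF assms] sum_subtractf[symmetric]
    by (simp add: case_prod_beta algebra_simps)
qed

lemma objective_altdef:
  "objective V E f lam mu x = ereal (\<Sum>i\<in>V. f i (x i))
     + (\<Sum>(i, j)\<in>E. lam i j * ereal (max 0 (x i - x j)) + mu i j * ereal (max 0 (- (x i - x j))))"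
  unfolding objective_def by (simp add: sum.distrib case_prod_beta add.assoc)

text \<open>\<open>- z (i, j)\<close> is a subgradient of the edge penalty at
  \<open>x i - x j\<close>. As \<open>z\<close> is real, an infinite weight excludes the order that
  it forbids.\<close>

definition edge_optimal ::
  "('a \<Rightarrow> 'a \<Rightarrow> ereal) \<Rightarrow> ('a \<Rightarrow> 'a \<Rightarrow> ereal) \<Rightarrow> ('a \<Rightarrow> real) \<Rightarrow> ('a \<times> 'a \<Rightarrow> real) \<Rightarrow> 'a \<Rightarrow> 'a \<Rightarrow> bool"
  where "edge_optimal lam mu x z i j \<longleftrightarrow>
    - lam i j \<le> ereal (z (i, j)) \<and> ereal (z (i, j)) \<le> mu i j \<and>
    (x i > x j \<longrightarrow> ereal (z (i, j)) = - lam i j) \<and> (x i < x j \<longrightarrow> ereal (z (i, j)) = mu i j)"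

text \<open>Tangents bound the node terms, and \<open>edge_penalty_ge\<close> the edge terms, from
  below by affine functions that are exact at \<open>x\<close>; summation by parts cancels their
  linear parts. One tangent inequality is strict, so optimality and uniqueness come
  together.\<close>

lemma objective_less:
  assumes V: "finite V" "E \<subseteq> V \<times> V"
    and f: "\<And>i. i \<in> V \<Longrightarrow> smooth_strongly_convex (f i)"
    and nonneg: "\<And>i j. (i, j) \<in> E \<Longrightarrow> 0 \<le> lam i j \<and> 0 \<le> mu i j"
    and edges: "\<And>i j. (i, j) \<in> E \<Longrightarrow> edge_optimal lam mu x z i j"
    and nodes: "\<And>l. l \<in> V \<Longrightarrow> (\<Sum>k\<in>V. net_flow E z l k) = deriv (f l) (x l)"
    and y: "i \<in> V" "y i \<noteq> x i"
  shows "objective V E f lam mu x < objective V E f lam mu y"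
proof -
  have tangent: "f i (x i) + deriv (f i) (x i) * (y i - x i) \<le> f i (y i)"
    "y i \<noteq> x i \<Longrightarrow> f i (x i) + deriv (f i) (x i) * (y i - x i) < f i (y i)" if "i \<in> V" for i
    using smooth_strongly_convex_tangent[OF f[OF that]] by auto
  have "(\<Sum>i\<in>V. f i (x i) + deriv (f i) (x i) * (y i - x i)) < (\<Sum>i\<in>V. f i (y i))"
    using V(1) tangent y by (intro sum_strict_mono_ex1) auto
  moreover have "(\<Sum>i\<in>V. deriv (f i) (x i) * (y i - x i))
      = (\<Sum>l\<in>V. (\<Sum>k\<in>V. net_flow E z l k) * (y l - x l))"
    by (rule sum.cong) (use nodes in auto)
  moreover have "(\<Sum>l\<in>V. (\<Sum>k\<in>V. net_flow E z l k) * (y l - x l))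
      = (\<Sum>(i, j)\<in>E. z (i, j) * (y i - y j)) - (\<Sum>(i, j)\<in>E. z (i, j) * (x i - x j))"
    unfolding sum_net_flow[OF V] sum_subtractf[symmetric]
    by (rule sum.cong) (auto simp: algebra_simps)
  moreover have "(\<Sum>(i, j)\<in>E. - z (i, j) * (w i - w j)) = - (\<Sum>(i, j)\<in>E. z (i, j) * (w i - w j))" for w
    unfolding sum_negf[symmetric] by (rule sum.cong) auto
  ultimately have less: "(\<Sum>i\<in>V. f i (x i)) + (\<Sum>(i, j)\<in>E. - z (i, j) * (x i - x j))
      < (\<Sum>i\<in>V. f i (y i)) + (\<Sum>(i, j)\<in>E. - z (i, j) * (y i - y j))"
    unfolding sum.distrib by simp
  have "objective V E f lam mu x = ereal (\<Sum>i\<in>V. f i (x i))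
      + (\<Sum>(i, j)\<in>E. ereal (- z (i, j) * (x i - x j)))"
    unfolding objective_altdef
  proof (intro arg_cong2[where f = "(+)"] refl sum.cong, clarify)
    fix i j assume e: "(i, j) \<in> E"
    show "lam i j * ereal (max 0 (x i - x j)) + mu i j * ereal (max 0 (- (x i - x j)))
        = ereal (- z (i, j) * (x i - x j))"
      by (rule edge_penalty_eq) (use edges[OF e] in \<open>auto simp: edge_optimal_def\<close>)
  qed
  also have "\<dots> = ereal ((\<Sum>i\<in>V. f i (x i)) + (\<Sum>(i, j)\<in>E. - z (i, j) * (x i - x j)))"
    by (simp add: case_prod_beta)
  also have "\<dots> < ereal ((\<Sum>i\<in>V. f i (y i)) + (\<Sum>(i, j)\<in>E. - z (i, j) * (y i - y j)))"
    using less by simp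
  also have "\<dots> = ereal (\<Sum>i\<in>V. f i (y i)) + (\<Sum>(i, j)\<in>E. ereal (- z (i, j) * (y i - y j)))"
    by (simp add: case_prod_beta)
  also have "\<dots> \<le> objective V E f lam mu y"
    unfolding objective_altdef
  proof (intro add_mono order_refl sum_mono, clarify)
    fix i j assume e: "(i, j) \<in> E"
    show "ereal (- z (i, j) * (y i - y j))
        \<le> lam i j * ereal (max 0 (y i - y j)) + mu i j * ereal (max 0 (- (y i - y j)))"
      by (rule edge_penalty_ge) (use edges[OF e] nonneg[OF e] in \<open>auto simp: edge_optimal_def\<close>)
  qed
  finally show ?thesis .
qed

section \<open>The labelled arborescence and its subtrees on the first \<open>m\<close>
  labels\<close>

locale labelled_tree = labelled_problem E f lam mu
  for E :: "(nat \<times> nat) set" and f :: "nat \<Rightarrow> real \<Rightarrow> real" and lam mu :: "nat \<Rightarrow> nat \<Rightarrow> ereal" +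
  fixes n :: nat
  assumes E_range: "(i, j) \<in> E \<Longrightarrow> 1 \<le> i \<and> i < j \<and> j \<le> n"
    and E_acyclic: "\<nexists>c. undirected_cycle E c"
    and E_parent: "2 \<le> j \<Longrightarrow> j \<le> n \<Longrightarrow> \<exists>i. (i, j) \<in> E"
    and f_smooth: "1 \<le> i \<Longrightarrow> i \<le> n \<Longrightarrow> smooth_strongly_convex (f i)"
    and weights_nonneg: "(i, j) \<in> E \<Longrightarrow> 0 \<le> lam i j \<and> 0 \<le> mu i j"
begin

lemma E_asym: "asym E"
  using E_range by (intro asymI) (metis order.asym)

lemma reach_from_1: "1 \<le> i \<Longrightarrow> i \<le> n \<Longrightarrow> (1, i) \<in> E\<^sup>*"
proof (induction i rule: less_induct)
  case (less i)
  show ?case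
  proof (cases "i = 1")
    case False
    then obtain p where p: "(p, i) \<in> E" using E_parent[of i] less.prems by auto
    then have "(1, p) \<in> E\<^sup>*" using less.IH[of p] E_range[OF p] by auto
    then show ?thesis using p by auto
  qed simp
qed

lemma rooted_treeI:
  assumes "1 \<le> r" "r \<le> n"
  shows "rooted_tree {1..n} E r"
proof
  show "E \<subseteq> {1..n} \<times> {1..n}" by (auto dest: E_range)
  fix i assume i: "i \<in> {1..n}"
  have "(r, 1) \<in> (E\<inverse>)\<^sup>*" using reach_from_1[OF assms] by (simp add: rtrancl_converse)
  then have "(r, 1) \<in> (E \<union> E\<inverse>)\<^sup>*" by (simp add: in_rtrancl_UnI)
  moreover have "(1, i) \<in> (E \<union> E\<inverse>)\<^sup>*"
    using reach_from_1[of i] i in_rtrancl_UnI[of _ E] by simp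
  ultimately show "(r, i) \<in> (E \<union> E\<inverse>)\<^sup>*" by simp
qed (use E_asym E_acyclic assms in auto)

text \<open>Seen from 1, every edge leads from parent to child: otherwise \<open>i\<close> would be
  a child of \<open>j\<close>, whereas by induction on the labels its parent is some predecessor
  \<open>k\<close>, and \<open>k < i < j\<close>. A child has only one parent.\<close>

lemma parent_unique:
  assumes "(i, j) \<in> E" "(i', j) \<in> E"
  shows "i = i'"
proof -
  have n: "1 \<le> n" using E_range[OF assms(1)] by simp
  interpret T: rooted_tree "{1..n}" E 1 using rooted_treeI[of 1] n by simp
  have child: "T.child j i" if "(i, j) \<in> E" for i j
    using that
  proof (induction j arbitrary: i rule: less_induct)
    case (less j)
    have "T.child i j \<or> T.child j i" using T.edge_child less.prems by blast
    moreover have False if ij: "T.child i j"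
    proof -
      have "i \<noteq> 1" using ij T.not_child_root by auto
      then obtain k where k: "(k, i) \<in> E" using E_parent[of i] E_range[OF less.prems] by auto
      then have "T.child i k" using less.IH[OF _ k] E_range[OF less.prems] by simp
      then have "j = k" using T.child_unique ij by blast
      then show False using E_range[OF k] E_range[OF less.prems] by simp
    qed
    ultimately show ?case by blast
  qed
  show ?thesis using child[OF assms(1)] child[OF assms(2)] T.child_unique by blast
qed

lemma attach:
  assumes "1 \<le> m" "m < n"
  shows "1 \<le> attach m" "attach m \<le> m" "(attach m, m + 1) \<in> E"
proof -
  obtain i where i: "(i, m + 1) \<in> E" using E_parent[of "m + 1"] assms by auto
  then have "attach m = i"
    unfolding attach_def using E_range[OF i] i parent_unique by (intro the_equality) auto
  then show "1 \<le> attach m" "attach m \<le> m" "(attach m, m + 1) \<in> E" using E_range[OF i] i by auto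
qed

lemma Em_subset: "Em m \<subseteq> E" "Em m \<subseteq> {1..m} \<times> {1..m}"
  unfolding Em_def by auto

lemma finite_Em: "finite (Em m)"
  by (rule finite_subset[OF Em_subset(2)]) simp

lemma Em_Suc:
  assumes "1 \<le> m" "m < n"
  shows "Em (m + 1) = insert (attach m, m + 1) (Em m)"
proof (intro equalityI subrelI)
  fix i j assume e: "(i, j) \<in> Em (m + 1)"
  then have E: "(i, j) \<in> E" and r: "i \<le> m + 1" "j \<le> m + 1" unfolding Em_def by auto
  then have ij: "1 \<le> i" "i < j" using E_range by auto
  show "(i, j) \<in> insert (attach m, m + 1) (Em m)"
  proof (cases "j = m + 1")
    case True
    then show ?thesis using E attach(3)[OF assms] parent_unique by auto
  next
    case False
    then show ?thesis using E r ij unfolding Em_def by auto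
  qed
next
  fix i j assume "(i, j) \<in> insert (attach m, m + 1) (Em m)"
  then show "(i, j) \<in> Em (m + 1)" using attach[OF assms] unfolding Em_def by auto
qed

lemma Em_n: "Em n = E"
  unfolding Em_def by (auto dest: E_range)

definition kkt :: "nat \<Rightarrow> (nat \<Rightarrow> real) \<Rightarrow> (nat \<times> nat \<Rightarrow> real) \<Rightarrow> bool" where
  "kkt m x z \<longleftrightarrow>
     (\<forall>(i, j)\<in>Em m. edge_optimal lam mu x z i j) \<and>
     (\<forall>l\<in>{1..m}. (\<Sum>k=1..m. net_flow (Em m) z l k) = deriv (f l) (x l))"

lemma kkt_objective_less:
  assumes "kkt n x z" "i \<in> {1..n}" "y i \<noteq> x i"
  shows "objective {1..n} E f lam mu x < objective {1..n} E f lam mu y"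
  by (rule objective_less[where z = z and i = i])
    (use assms f_smooth weights_nonneg Em_subset(2)[of n] in \<open>auto simp: kkt_def Em_n\<close>)

end

section \<open>Consistent states\<close>

lemma strict_mono_inv_deriv:
  assumes "smooth_strongly_convex g"
  shows "strict_mono (inv (deriv g))" "surj (inv (deriv g))"
proof -
  have f_inv: "deriv g (inv (deriv g) y) = y" for y
    using surj_deriv[OF assms] by (rule surj_f_inv_f)
  show "strict_mono (inv (deriv g))"
  proof (rule strict_monoI)
    fix x y :: real assume "x < y"
    then have "deriv g (inv (deriv g) x) < deriv g (inv (deriv g) y)" by (simp only: f_inv)
    then show "inv (deriv g) x < inv (deriv g) y"
      using strict_mono_less[OF strict_mono_deriv[OF assms]] by blast
  qed
  have "inv (deriv g) (deriv g x) = x" for x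
    using strict_mono_imp_inj_on[OF strict_mono_deriv[OF assms]] by (rule inv_f_f)
  then show "surj (inv (deriv g))" by (metis surjI)
qed

lemma the_shift:
  fixes \<phi> :: "real \<Rightarrow> real"
  assumes "strict_mono \<phi>" "surj \<phi>"
  shows "\<phi> (a + (THE d. \<phi> (a + d) = b)) = b"
proof (rule theI')
  obtain c where c: "\<phi> c = b" using assms(2) by (metis surjD)
  show "\<exists>!d. \<phi> (a + d) = b"
  proof (rule ex1I)
    show "\<phi> (a + (c - a)) = b" using c by simp
    fix d assume "\<phi> (a + d) = b"
    then have "a + d = c" using c strict_mono_eq[OF assms(1)] by metis
    then show "d = c - a" by simp
  qed
qed

locale growth_step = labelled_tree +
  fixes m :: nat
  assumes m: "1 \<le> m" "m < n"
begin

abbreviation "r \<equiv> attach m"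

lemmas r = attach[OF m]

text \<open>The whole tree seen from \<open>r\<close> fixes, for all updates of a phase, which end
  of an edge is the far one.\<close>

sublocale G: rooted_tree "{1..n}" E r
  using r m by (intro rooted_treeI) auto

text \<open>\<open>t\<close> is the amount that \<open>r\<close> sends out of the current subtree;
  it will be the flow on the new edge to \<open>m + 1\<close>.\<close>

definition balanced :: "real \<Rightarrow> (nat \<Rightarrow> real) \<Rightarrow> (nat \<times> nat \<Rightarrow> real) \<Rightarrow> bool" where
  "balanced t x z \<longleftrightarrow> (\<forall>l\<in>{1..m}.
     (\<Sum>k=1..m. net_flow (Em m) z l k) + (if l = r then t else 0) = deriv (f l) (x l))"

text \<open>The optimality conditions of the problem on \<open>G\<^sub>m\<close> with the extra term \<open>- t x\<^sub>r\<close>. The inequalities in \<open>gt_set\<close> and \<open>lt_set\<close> are weak: an edge that has just left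
  \<open>eq_set\<close> still has equal end values.\<close>

definition consistent :: "asra_state \<Rightarrow> bool" where
  "consistent s \<longleftrightarrow>
     eq_set s \<union> gt_set s \<union> lt_set s = Em m \<and>
     eq_set s \<inter> gt_set s = {} \<and> eq_set s \<inter> lt_set s = {} \<and> gt_set s \<inter> lt_set s = {} \<and>
     (\<forall>i j. (i, j) \<in> eq_set s \<longrightarrow> xval s i = xval s j \<and>
        - lam i j \<le> ereal (zval s (i, j)) \<and> ereal (zval s (i, j)) \<le> mu i j) \<and>
     (\<forall>i j. (i, j) \<in> gt_set s \<longrightarrow> xval s j \<le> xval s i \<and> ereal (zval s (i, j)) = - lam i j) \<and>
     (\<forall>i j. (i, j) \<in> lt_set s \<longrightarrow> xval s i \<le> xval s j \<and> ereal (zval s (i, j)) = mu i j) \<and>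
     balanced (time s) (xval s) (zval s) \<and>
     deriv (f (m + 1)) (xval s (m + 1)) = - time s"

text \<open>Only signs change. An edge leaving \<open>eq_set\<close> already carries the bound that
  its new sign asks for; an edge entering it has equal end values and a flow at a bound. The weak
  inequalities in \<open>consistent\<close> accept both.\<close>

lemma consistent_relabel:
  assumes "consistent s"
    and "P \<subseteq> eq_set s" "Q \<subseteq> eq_set s" "A \<subseteq> gt_set s" "B \<subseteq> lt_set s"
    and "\<And>i j. (i, j) \<in> P \<Longrightarrow> ereal (zval s (i, j)) = - lam i j"
    and "\<And>i j. (i, j) \<in> Q \<Longrightarrow> ereal (zval s (i, j)) = mu i j"
    and "P \<inter> Q = {}"
    and "\<And>i j. (i, j) \<in> A \<union> B \<Longrightarrow> xval s i = xval s j"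
  shows "consistent (s\<lparr>eq_set := (eq_set s \<union> A \<union> B) - (P \<union> Q),
    gt_set := (gt_set s \<union> P) - A, lt_set := (lt_set s \<union> Q) - B\<rparr>)"
proof -
  \<comment> \<open>A flow at one bound must respect the other bound too once the edge joins
    \<open>eq_set\<close>; nonnegative weights guarantee this.\<close>
  have E: "- lam i j \<le> mu i j" if "(i, j) \<in> Em m" for i j
  proof -
    have "0 \<le> lam i j" "0 \<le> mu i j" using weights_nonneg that Em_subset(1) by blast+
    then show ?thesis using ereal_uminus_le_0_iff order_trans by blast
  qed
  note c = assms(1)[unfolded consistent_def]
  have eq: "xval s i = xval s j \<and> - lam i j \<le> ereal (zval s (i, j)) \<and> ereal (zval s (i, j)) \<le> mu i j"
    if "(i, j) \<in> (eq_set s \<union> A \<union> B) - (P \<union> Q)" for i j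
  proof -
    from that consider "(i, j) \<in> eq_set s" | "(i, j) \<in> A" | "(i, j) \<in> B" by blast
    then show ?thesis
    proof cases
      case 1
      then show ?thesis using c by blast
    next
      case 2
      then have "(i, j) \<in> gt_set s" "(i, j) \<in> Em m" using assms(4) c by blast+
      then show ?thesis using 2 assms(9)[of i j] E[of i j] c by simp
    next
      case 3
      then have "(i, j) \<in> lt_set s" "(i, j) \<in> Em m" using assms(5) c by blast+
      then show ?thesis using 3 assms(9)[of i j] E[of i j] c by simp
    qed
  qed
  have gt: "xval s j \<le> xval s i \<and> ereal (zval s (i, j)) = - lam i j"
    if "(i, j) \<in> (gt_set s \<union> P) - A" for i j
  proof (cases "(i, j) \<in> P")
    case True
    then have "xval s i = xval s j" using assms(2) c by blast
    then show ?thesis using assms(6)[OF True] by simp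
  qed (use that c in blast)
  have lt: "xval s i \<le> xval s j \<and> ereal (zval s (i, j)) = mu i j"
    if "(i, j) \<in> (lt_set s \<union> Q) - B" for i j
  proof (cases "(i, j) \<in> Q")
    case True
    then have "xval s i = xval s j" using assms(3) c by blast
    then show ?thesis using assms(7)[OF True] by simp
  qed (use that c in blast)
  let ?eq = "(eq_set s \<union> A \<union> B) - (P \<union> Q)" and ?gt = "(gt_set s \<union> P) - A"
    and ?lt = "(lt_set s \<union> Q) - B"
  have u: "eq_set s \<union> gt_set s \<union> lt_set s = Em m"
    and d: "eq_set s \<inter> gt_set s = {}" "eq_set s \<inter> lt_set s = {}" "gt_set s \<inter> lt_set s = {}"
    using c by auto
  have "?eq \<union> ?gt \<union> ?lt = Em m" using u d assms(2-5) by blast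
  moreover have "?eq \<inter> ?gt = {}" using d assms(2,4,5) by blast
  moreover have "?eq \<inter> ?lt = {}" using d assms(3-5) by blast
  moreover have "?gt \<inter> ?lt = {}" using d assms(2,3,8) by blast
  ultimately show ?thesis unfolding consistent_def using c eq gt lt by simp
qed

text \<open>In a downward phase an edge whose end \<open>c\<close> far from \<open>r\<close> has the smaller value can only
  merge, and after that only split with \<open>c\<close> staying above. Hence it changes sign at most twice,
  and this potential decreases. In an upward phase the roles of \<open>gt\<close> and \<open>lt\<close> are exchanged.\<close>

definition potential :: "(nat \<times> nat) set \<Rightarrow> (nat \<times> nat) set \<Rightarrow> (nat \<times> nat) set \<Rightarrow> nat" where
  "potential eq gt lt = (\<Sum>(i, j)\<in>Em m.
     if (i, j) \<in> eq then 1
     else if (i, j) \<in> gt \<and> G.child j i \<or> (i, j) \<in> lt \<and> G.child i j then 2 else 0)"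

text \<open>Each relabelled edge loses exactly one unit: \<open>P\<close> and \<open>Q\<close> split
  with the far end on the upper side and drop from 1 to 0, \<open>A\<close> and \<open>B\<close>
  merge with the far end coming from below and drop from 2 to 1.\<close>

lemma potential_less:
  assumes "eq \<union> gt \<union> lt = Em m" "eq \<inter> gt = {}" "eq \<inter> lt = {}" "gt \<inter> lt = {}"
    and "P \<subseteq> eq" "Q \<subseteq> eq" "A \<subseteq> gt" "B \<subseteq> lt"
    and "\<And>i j. (i, j) \<in> P \<union> B \<Longrightarrow> G.child i j" "\<And>i j. (i, j) \<in> Q \<union> A \<Longrightarrow> G.child j i"
    and ne: "P \<union> Q \<union> A \<union> B \<noteq> {}"
  shows "potential ((eq \<union> A \<union> B) - (P \<union> Q)) ((gt \<union> P) - A) ((lt \<union> Q) - B) < potential eq gt lt"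
  unfolding potential_def
proof (rule sum_strict_mono_ex1[OF finite_Em])
  let ?h = "\<lambda>eq gt lt (i, j). if (i, j) \<in> eq then 1::nat
     else if (i, j) \<in> gt \<and> G.child j i \<or> (i, j) \<in> lt \<and> G.child i j then 2 else 0"
  have less: "?h ((eq \<union> A \<union> B) - (P \<union> Q)) ((gt \<union> P) - A) ((lt \<union> Q) - B) (i, j) < ?h eq gt lt (i, j)"
    if "(i, j) \<in> P \<union> Q \<union> A \<union> B" for i j
  proof -
    from that consider "(i, j) \<in> P" | "(i, j) \<in> Q" | "(i, j) \<in> A" | "(i, j) \<in> B" by blast
    then show ?thesis
    proof cases
      case 1
      then have "(i, j) \<in> eq" "(i, j) \<notin> lt" "\<not> G.child j i"
        using assms(3,5) assms(9)[of i j] G.child_antisym by blast+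
      then show ?thesis using 1 assms(10)[of i j] by auto
    next
      case 2
      then have "(i, j) \<in> eq" "(i, j) \<notin> gt" "\<not> G.child i j"
        using assms(2,6) assms(10)[of i j] G.child_antisym by blast+
      then show ?thesis using 2 assms(9)[of i j] by auto
    next
      case 3
      then have "(i, j) \<in> gt" "(i, j) \<notin> eq" "G.child j i" "(i, j) \<notin> P" "(i, j) \<notin> Q"
        using assms(2,5,6,7) assms(10)[of i j] by blast+
      then show ?thesis using 3 by simp
    next
      case 4
      then have "(i, j) \<in> lt" "(i, j) \<notin> eq" "G.child i j" "(i, j) \<notin> P" "(i, j) \<notin> Q"
        using assms(3,5,6,8) assms(9)[of i j] by blast+
      then show ?thesis using 4 by simp
    qed
  qed
  have le: "?h ((eq \<union> A \<union> B) - (P \<union> Q)) ((gt \<union> P) - A) ((lt \<union> Q) - B) (i, j) \<le> ?h eq gt lt (i, j)"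
    if "(i, j) \<in> Em m" for i j
  proof (cases "(i, j) \<in> P \<union> Q \<union> A \<union> B")
    case True
    show ?thesis by (rule less_imp_le[OF less[OF True]])
  qed simp
  then show "\<forall>e\<in>Em m. ?h ((eq \<union> A \<union> B) - (P \<union> Q)) ((gt \<union> P) - A) ((lt \<union> Q) - B) e \<le> ?h eq gt lt e"
    by auto
  obtain i j where "(i, j) \<in> P \<union> Q \<union> A \<union> B" using ne by auto
  moreover have "P \<union> Q \<union> A \<union> B \<subseteq> Em m" using assms(1,5-8) by blast
  ultimately show "\<exists>e\<in>Em m. ?h ((eq \<union> A \<union> B) - (P \<union> Q)) ((gt \<union> P) - A) ((lt \<union> Q) - B) e < ?h eq gt lt e"
    using less by blast
qed

end

section \<open>The moving block\<close>

locale block = growth_step +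
  fixes s :: asra_state
  assumes consistent: "consistent s"
begin

lemma eq_set_Em: "eq_set s \<subseteq> Em m" and gt_set_Em: "gt_set s \<subseteq> Em m" and lt_set_Em: "lt_set s \<subseteq> Em m"
  using consistent unfolding consistent_def by auto

lemma EB_subset: "EB m s \<subseteq> eq_set s" "EB m s \<subseteq> Em m" "EB m s \<subseteq> E"
  unfolding EB_def using eq_set_Em Em_subset(1) by auto

lemma VB_subset: "VB m s \<subseteq> {1..m}"
  unfolding VB_def by auto

lemma finite_VB: "finite (VB m s)"
  using VB_subset finite_subset by blast

lemma r_in_VB: "r \<in> VB m s"
  unfolding VB_def using r by simp

lemma VB_eq_closed: "(i, j) \<in> eq_set s \<Longrightarrow> i \<in> VB m s \<longleftrightarrow> j \<in> VB m s"
proof -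
  assume e: "(i, j) \<in> eq_set s"
  then have "i \<in> {1..m}" "j \<in> {1..m}" using eq_set_Em Em_subset(2) by blast+
  moreover have "(r, i) \<in> (eq_set s \<union> (eq_set s)\<inverse>)\<^sup>* \<longleftrightarrow> (r, j) \<in> (eq_set s \<union> (eq_set s)\<inverse>)\<^sup>*"
    using e by (metis UnCI converse_iff rtrancl.rtrancl_into_rtrancl)
  ultimately show ?thesis unfolding VB_def by blast
qed

text \<open>The block is defined through all of \<open>eq_set\<close>. A chain of such edges that
  starts at \<open>r\<close> never leaves the block, so it runs within \<open>EB\<close>.\<close>

lemma VB_reach:
  assumes "i \<in> VB m s"
  shows "(r, i) \<in> (EB m s \<union> (EB m s)\<inverse>)\<^sup>*"
proof -
  have "(r, i) \<in> (eq_set s \<union> (eq_set s)\<inverse>)\<^sup>*" using assms unfolding VB_def by auto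
  then have "(r, i) \<in> (EB m s \<union> (EB m s)\<inverse>)\<^sup>* \<and> i \<in> VB m s"
  proof (induction rule: rtrancl_induct)
    case base
    then show ?case using r_in_VB by simp
  next
    case (step i j)
    then have "j \<in> VB m s" using VB_eq_closed by blast
    then have "(i, j) \<in> EB m s \<union> (EB m s)\<inverse>" using step unfolding EB_def by auto
    then show ?case using step \<open>j \<in> VB m s\<close> by (meson rtrancl.rtrancl_into_rtrancl)
  qed
  then show ?thesis by simp
qed

sublocale T: rooted_tree "VB m s" "EB m s" r
proof
  show "\<nexists>c. undirected_cycle (EB m s) c"
  proof
    assume "\<exists>c. undirected_cycle (EB m s) c"
    then obtain c where "undirected_cycle (EB m s) c" by blast
    then have "undirected_cycle E c"
      using EB_subset(3) unfolding undirected_cycle_def by (auto elim!: successively_mono)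
    then show False using E_acyclic by blast
  qed
  show "asym (EB m s)" using E_asym EB_subset(3) by (meson asymD asymI subsetD)
  show "EB m s \<subseteq> VB m s \<times> VB m s" unfolding EB_def by auto
qed (use finite_VB r_in_VB VB_reach in auto)

lemma path_to_route: "path_to m s i = T.route i"
  unfolding path_to_def T.route_def ..

lemma G_route: "i \<in> VB m s \<Longrightarrow> G.route i = T.route i"
  using T.route_path EB_subset(3) undirected_path_mono by (metis G.route_eq)

text \<open>A route inside the block is a path of the whole tree and hence its route there. Thus the
  relation \<open>beyond\<close>, which depends on the state, agrees on block edges with the fixed
  orientation used by \<open>potential\<close>.\<close>

lemma G_child_iff:
  assumes "i \<in> VB m s" "j \<in> VB m s"
  shows "G.child i j \<longleftrightarrow> T.child i j"
proof -
  have "i \<in> {1..n}" "j \<in> {1..n}" using assms VB_subset m by fastforce+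
  then show ?thesis unfolding G.child_def T.child_def using assms G_route by simp
qed

text \<open>The ends are parent and child in the whole tree and so, having the same routes, in the
  block tree, where such a pair is joined by an edge of \<open>EB\<close>. In particular no edge
  with sign \<open>>\<close> or \<open><\<close> has both ends in the block.\<close>

lemma EB_iff:
  assumes "(i, j) \<in> Em m" "i \<in> VB m s" "j \<in> VB m s"
  shows "(i, j) \<in> EB m s"
proof -
  have E: "(i, j) \<in> E" using assms(1) Em_subset(1) by auto
  then have "T.child i j \<or> T.child j i" using G.edge_child[of i j] G_child_iff assms by blast
  then have "(i, j) \<in> EB m s \<union> (EB m s)\<inverse>" using T.child_edge by auto
  then show ?thesis using E_asym E EB_subset(3) by (auto dest: asymD)
qed

text \<open>Were \<open>i\<close> the far end, its route would pass through \<open>j\<close>; but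
  that route stays inside the block.\<close>

lemma child_leaving:
  assumes "(i, j) \<in> E \<union> E\<inverse>" "i \<in> VB m s" "j \<notin> VB m s"
  shows "G.child j i"
proof (rule ccontr)
  assume "\<not> G.child j i"
  then have c: "G.child i j" using G.edge_child assms(1) by blast
  then have "j \<in> set (G.route j)" using G.self_in_route unfolding G.child_def by blast
  then have "j \<in> set (T.route i)" using c G_route[OF assms(2)] unfolding G.child_def by auto
  then show False using T.route_subset assms by blast
qed

lemma beyond_iff:
  "i \<in> VB m s \<Longrightarrow> j \<in> VB m s \<Longrightarrow> beyond m s j i \<longleftrightarrow> i \<in> set (T.route j) \<and> i \<noteq> j"
  unfolding beyond_def path_to_route using T.route_psubset_iff by simp

lemma child_beyond: "T.child i j \<Longrightarrow> beyond m s i j"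
  unfolding beyond_def path_to_route T.child_def
  using T.route_psubset_iff[of j i] T.self_in_route[of j] T.distinct_route[of i] by auto

lemma beyond_edge_iff:
  assumes "(i, j) \<in> EB m s \<union> (EB m s)\<inverse>"
  shows "beyond m s i j \<longleftrightarrow> T.child i j"
proof
  assume b: "beyond m s i j"
  have "\<not> T.child j i"
  proof
    assume "T.child j i"
    then have "beyond m s j i" by (rule child_beyond)
    with b show False unfolding beyond_def by auto
  qed
  then show "T.child i j" using T.edge_child assms by blast
qed (rule child_beyond)

lemma CB_descendants: "i \<in> VB m s \<Longrightarrow> CB m s i = T.descendants i"
  unfolding CB_def T.descendants_def using beyond_iff T.self_in_route by auto

lemma xval_VB: "i \<in> VB m s \<Longrightarrow> xval s i = xval s r"
proof -
  assume "i \<in> VB m s"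
  then have "(r, i) \<in> (eq_set s \<union> (eq_set s)\<inverse>)\<^sup>*" unfolding VB_def by auto
  then show ?thesis
    using consistent unfolding consistent_def by (induction rule: rtrancl_induct) auto
qed

text \<open>Net flow from \<open>l\<close> across the border of the block. It stays fixed during an
  update, and \<open>sigma\<close> is its sum over a set of block nodes.\<close>

definition outer :: "nat \<Rightarrow> real" where
  "outer l = (\<Sum>k\<in>{1..m} - VB m s. net_flow (Em m) (zval s) l k)"

lemma sigma_outer:
  assumes "S \<subseteq> VB m s"
  shows "sigma m s S = (\<Sum>l\<in>S. outer l)"
proof -
  let ?K = "{1..m} - VB m s"
  have fin: "finite S" using assms finite_VB finite_subset by blast
  have out: "(\<Sum>e\<in>{(l, k) \<in> Em m. l \<in> S \<and> k \<notin> VB m s}. zval s e)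
      = (\<Sum>l\<in>S. \<Sum>k\<in>?K. if (l, k) \<in> Em m then zval s (l, k) else 0)"
  proof -
    have "(\<Sum>l\<in>S. \<Sum>k\<in>?K. if (l, k) \<in> Em m then zval s (l, k) else 0)
        = (\<Sum>e\<in>S \<times> ?K. if e \<in> Em m then zval s e else 0)"
      by (subst sum.cartesian_product) (auto intro!: sum.cong)
    also have "\<dots> = (\<Sum>e\<in>{(l, k) \<in> Em m. l \<in> S \<and> k \<notin> VB m s}. zval s e)"
      using fin Em_subset(2)[of m] by (intro sum.mono_neutral_cong_right) auto
    finally show ?thesis ..
  qed
  have into: "(\<Sum>e\<in>{(k, l) \<in> Em m. l \<in> S \<and> k \<notin> VB m s}. zval s e)
      = (\<Sum>l\<in>S. \<Sum>k\<in>?K. if (k, l) \<in> Em m then zval s (k, l) else 0)"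
  proof -
    have "(\<Sum>l\<in>S. \<Sum>k\<in>?K. if (k, l) \<in> Em m then zval s (k, l) else 0)
        = (\<Sum>k\<in>?K. \<Sum>l\<in>S. if (k, l) \<in> Em m then zval s (k, l) else 0)"
      by (rule sum.swap)
    also have "\<dots> = (\<Sum>e\<in>?K \<times> S. if e \<in> Em m then zval s e else 0)"
      by (subst sum.cartesian_product) (auto intro!: sum.cong)
    also have "\<dots> = (\<Sum>e\<in>{(k, l) \<in> Em m. l \<in> S \<and> k \<notin> VB m s}. zval s e)"
      using fin Em_subset(2)[of m] by (intro sum.mono_neutral_cong_right) auto
    finally show ?thesis ..
  qed
  show ?thesis
    unfolding sigma_def out into outer_def net_flow_def sum_subtractf ..
qed

lemma net_flow_EB:
  assumes "l \<in> VB m s" "k \<in> VB m s"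
  shows "net_flow (Em m) z l k = net_flow (EB m s) z l k"
  unfolding net_flow_def using assms EB_iff EB_subset(2) by auto

text \<open>An update changes flows on \<open>EB\<close> only: a block node keeps the outer part of
  its divergence, any other node keeps all of it.\<close>

lemma divergence_split:
  assumes z: "\<And>e. e \<notin> EB m s \<Longrightarrow> z e = zval s e"
  shows "l \<in> VB m s \<Longrightarrow> (\<Sum>k=1..m. net_flow (Em m) z l k)
      = (\<Sum>k\<in>VB m s. net_flow (EB m s) z l k) + outer l"
    and "l \<notin> VB m s \<Longrightarrow> (\<Sum>k=1..m. net_flow (Em m) z l k)
      = (\<Sum>k=1..m. net_flow (Em m) (zval s) l k)"
proof -
  have out: "net_flow (Em m) z l k = net_flow (Em m) (zval s) l k"
    if "l \<notin> VB m s \<or> k \<notin> VB m s" for l k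
    using that z[of "(l, k)"] z[of "(k, l)"] unfolding net_flow_def EB_def by auto
  then show "l \<notin> VB m s \<Longrightarrow> (\<Sum>k=1..m. net_flow (Em m) z l k)
      = (\<Sum>k=1..m. net_flow (Em m) (zval s) l k)"
    by (intro sum.cong) auto
  assume l: "l \<in> VB m s"
  have "(\<Sum>k=1..m. net_flow (Em m) z l k)
      = (\<Sum>k\<in>{1..m} - VB m s. net_flow (Em m) z l k) + (\<Sum>k\<in>VB m s. net_flow (Em m) z l k)"
    by (rule sum.subset_diff[OF VB_subset]) simp
  moreover have "(\<Sum>k\<in>{1..m} - VB m s. net_flow (Em m) z l k) = outer l"
    unfolding outer_def by (rule sum.cong) (auto simp: out)
  moreover have "(\<Sum>k\<in>VB m s. net_flow (Em m) z l k) = (\<Sum>k\<in>VB m s. net_flow (EB m s) z l k)"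
    by (rule sum.cong) (auto simp: net_flow_EB[OF l])
  ultimately show "(\<Sum>k=1..m. net_flow (Em m) z l k)
      = (\<Sum>k\<in>VB m s. net_flow (EB m s) z l k) + outer l" by simp
qed

lemma VB_smooth: "l \<in> VB m s \<Longrightarrow> smooth_strongly_convex (f l)"
  using f_smooth VB_subset m by fastforce

lemma sum_smooth:
  assumes "S \<subseteq> VB m s" "S \<noteq> {}"
  shows "smooth_strongly_convex (\<lambda>y. \<Sum>l\<in>S. f l y)"
    and "deriv (\<lambda>y. \<Sum>l\<in>S. f l y) y = (\<Sum>l\<in>S. deriv (f l) y)"
  using assms VB_smooth finite_subset[OF _ finite_VB]
  by (auto intro!: smooth_strongly_convex_sum deriv_sum_smooth)

lemma sum_deriv_mono:
  assumes "S \<subseteq> VB m s" "S \<noteq> {}"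
  shows "strict_mono (\<lambda>y. \<Sum>l\<in>S. deriv (f l) y)" "surj (\<lambda>y. \<Sum>l\<in>S. deriv (f l) y)"
  using strict_mono_deriv[OF sum_smooth(1)[OF assms]] surj_deriv[OF sum_smooth(1)[OF assms]]
  unfolding sum_smooth(2)[OF assms] by simp_all

lemma VB_nonempty: "VB m s \<noteq> {}"
  using r_in_VB by auto

lemma xB_inv: "xB m s t = inv (deriv (\<lambda>y. \<Sum>l\<in>VB m s. f l y)) (t + sigma m s (VB m s))"
  unfolding xB_def by (rule deriv_convex_conjugate[OF sum_smooth(1)[OF order_refl VB_nonempty]])

text \<open>Summing the node conditions over the block cancels all inner flows and leaves this
  single equation for the common value; the conjugate in the algorithm is its solution.\<close>

lemma xB_balance: "(\<Sum>l\<in>VB m s. deriv (f l) (xB m s t)) = t + sigma m s (VB m s)"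
  unfolding xB_inv sum_smooth(2)[OF order_refl VB_nonempty, symmetric]
  using surj_deriv[OF sum_smooth(1)[OF order_refl VB_nonempty]] by (rule surj_f_inv_f)

lemma strict_mono_xB: "strict_mono (xB m s)"
  unfolding strict_mono_def
  using strict_mono_inv_deriv(1)[OF sum_smooth(1)[OF order_refl VB_nonempty]]
  by (simp add: xB_inv strict_mono_less)

lemma surj_xB: "surj (xB m s)"
  unfolding surj_def
proof
  fix y
  obtain u where "y = inv (deriv (\<lambda>y. \<Sum>l\<in>VB m s. f l y)) u"
    using strict_mono_inv_deriv(2)[OF sum_smooth(1)[OF order_refl VB_nonempty]] by (metis surjD)
  then have "y = xB m s (u - sigma m s (VB m s))" unfolding xB_inv by simp
  then show "\<exists>t. y = xB m s t" ..
qed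

text \<open>The flow from \<open>c\<close> to its parent that \<open>divergence_iff\<close> forces
  once the block has the value \<open>xB m s t\<close>.\<close>

definition upward_flow :: "nat \<Rightarrow> real \<Rightarrow> real" where
  "upward_flow c t = (\<Sum>l\<in>T.descendants c. deriv (f l) (xB m s t)) - sigma m s (T.descendants c)"

lemma descendants_VB: "T.descendants c \<subseteq> VB m s"
  unfolding T.descendants_def by auto

text \<open>The block value increases with \<open>t\<close>, and with it the derivatives below
  \<open>c\<close>, while \<open>sigma\<close> is constant. Hence a finite bound is reached at
  exactly one time.\<close>

lemma upward_flow_mono:
  assumes "c \<in> VB m s"
  shows "strict_mono (upward_flow c)" "surj (upward_flow c)"
proof -
  let ?h = "\<lambda>y. \<Sum>l\<in>T.descendants c. deriv (f l) y"
  have ne: "T.descendants c \<noteq> {}" using T.self_descendant[OF assms] by auto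
  note h = sum_deriv_mono[OF descendants_VB ne]
  have eq: "upward_flow c t = ?h (xB m s t) - sigma m s (T.descendants c)" for t
    by (simp add: upward_flow_def)
  show "strict_mono (upward_flow c)"
    unfolding strict_mono_def eq
    using strict_mono_less[OF h(1)] strict_mono_less[OF strict_mono_xB] by simp
  show "surj (upward_flow c)"
    unfolding surj_def
  proof
    fix y
    obtain x where x: "y + sigma m s (T.descendants c) = ?h x" using h(2) by (meson surjD)
    obtain t where "x = xB m s t" using surj_xB by (metis surjD)
    with x show "\<exists>t. y = upward_flow c t" unfolding eq by (intro exI[of _ t]) simp
  qed
qed

lemma VB_not_new: "l \<in> VB m s \<Longrightarrow> l \<noteq> m + 1"
  using VB_subset by auto

lemma xq_VB: "l \<in> VB m s \<Longrightarrow> xq m s t l = xB m s t"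
  unfolding xq_def using VB_not_new by simp

lemma xq_other: "l \<notin> VB m s \<Longrightarrow> l \<noteq> m + 1 \<Longrightarrow> xq m s t l = xval s l"
  unfolding xq_def by simp

text \<open>The two cases of the formula are one quantity, the flow towards \<open>r\<close>, read
  along or against the direction of the edge.\<close>

lemma zq_upward_flow:
  assumes "(i, j) \<in> EB m s"
  shows "T.child i j \<Longrightarrow> zq m s t (i, j) = upward_flow i t"
    and "T.child j i \<Longrightarrow> zq m s t (i, j) = - upward_flow j t"
proof -
  have eq: "(\<Sum>l\<in>CB m s c. deriv (f l) (xq m s t l)) - sigma m s (CB m s c) = upward_flow c t"
    if "c \<in> VB m s" for c
    unfolding CB_descendants[OF that] upward_flow_def
    using descendants_VB[of c] by (simp add: xq_VB subset_iff)
  have V: "i \<in> VB m s" "j \<in> VB m s" using assms T.F_sub by auto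
  have "beyond m s i j \<longleftrightarrow> T.child i j" using beyond_edge_iff assms by blast
  then show "T.child i j \<Longrightarrow> zq m s t (i, j) = upward_flow i t"
    and "T.child j i \<Longrightarrow> zq m s t (i, j) = - upward_flow j t"
    unfolding zq_def using eq[OF V(1)] eq[OF V(2)] T.child_antisym by auto
qed

lemma net_flow_child:
  assumes "T.child c p"
  shows "net_flow (EB m s) (zq m s t) c p = upward_flow c t"
proof -
  have "(c, p) \<in> EB m s \<and> (p, c) \<notin> EB m s \<or> (p, c) \<in> EB m s \<and> (c, p) \<notin> EB m s"
    using T.child_edge[OF assms] T.F_asym by (auto dest: asymD)
  then show ?thesis
    unfolding net_flow_def using zq_upward_flow assms by auto
qed

lemma root_not_below: "T.child c p \<Longrightarrow> r \<notin> T.descendants c"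
  unfolding T.descendants_def using T.not_child_root T.route_root by auto

text \<open>The external term \<open>t\<close> belongs to \<open>r\<close> alone, and
  \<open>r\<close> lies below no child.\<close>

lemma sum_descendants_divergence:
  assumes "T.child c p"
  shows "(\<Sum>l\<in>T.descendants c. deriv (f l) (xB m s t) - outer l - (if l = r then t else 0))
    = upward_flow c t"
  unfolding upward_flow_def sigma_outer[OF descendants_VB] sum_subtractf
  using root_not_below[OF assms] T.finite_descendants by (simp add: sum.delta)

lemma sum_VB_divergence:
  "(\<Sum>l\<in>VB m s. deriv (f l) x - outer l - (if l = r then t else 0))
    = (\<Sum>l\<in>VB m s. deriv (f l) x) - sigma m s (VB m s) - t"
  unfolding sigma_outer[OF order_refl] sum_subtractf
  using r_in_VB finite_VB by (simp add: sum.delta)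

lemma now_divergence:
  assumes "l \<in> VB m s"
  shows "(\<Sum>k\<in>VB m s. net_flow (EB m s) (zval s) l k)
    = deriv (f l) (xval s r) - outer l - (if l = r then time s else 0)"
proof -
  have "(\<Sum>k=1..m. net_flow (Em m) (zval s) l k) + (if l = r then time s else 0)
        = deriv (f l) (xval s l)"
    using consistent assms VB_subset unfolding consistent_def balanced_def by blast
  then show ?thesis
    unfolding xval_VB[OF assms] divergence_split(1)[OF refl assms] by linarith
qed

text \<open>The divergences of the present flows inside the block add up to 0, so the present common
  value solves the summed balance equation; strict monotonicity leaves no other solution.\<close>

lemma xB_now: "xB m s (time s) = xval s r"
proof -
  have "(\<Sum>l\<in>VB m s. deriv (f l) (xval s r) - outer l - (if l = r then time s else 0)) = 0"
    using now_divergence T.divergence_iff[of "zval s"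
      "\<lambda>l. deriv (f l) (xval s r) - outer l - (if l = r then time s else 0)"] by blast
  then have "(\<Sum>l\<in>VB m s. deriv (f l) (xval s r)) = (\<Sum>l\<in>VB m s. deriv (f l) (xB m s (time s)))"
    unfolding sum_VB_divergence xB_balance by simp
  then show ?thesis
    using strict_mono_eq[OF sum_deriv_mono(1)[OF order_refl VB_nonempty]] by metis
qed

text \<open>The present flows have exactly the divergences that determine \<open>zq\<close>, so an
  update starts without a jump.\<close>

lemma zq_now:
  assumes "(i, j) \<in> EB m s"
  shows "zq m s (time s) (i, j) = zval s (i, j)"
proof -
  have flow: "net_flow (EB m s) (zval s) c p = upward_flow c (time s)" if "T.child c p" for c p
    using now_divergence that T.divergence_iff[of "zval s"
      "\<lambda>l. deriv (f l) (xval s r) - outer l - (if l = r then time s else 0)"]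
      sum_descendants_divergence[OF that, of "time s"] unfolding xB_now by auto
  have "(j, i) \<notin> EB m s" using assms T.F_asym by (auto dest: asymD)
  then show ?thesis
    using T.edge_child[of i j] assms flow zq_upward_flow[OF assms] unfolding net_flow_def by fastforce
qed

text \<open>Inside the block the new flows are the solution in \<open>divergence_iff\<close>, whose
  solvability condition is provided by the choice of \<open>xB\<close>. At any other node neither
  the value nor an incident flow has changed.\<close>

lemma balance_after:
  assumes "l \<in> {1..m}"
  shows "(\<Sum>k=1..m. net_flow (Em m) (ztilde m s t) l k) + (if l = r then t else 0)
    = deriv (f l) (xq m s t l)"
proof (cases "l \<in> VB m s")
  case True
  let ?g = "\<lambda>l. deriv (f l) (xB m s t) - outer l - (if l = r then t else 0)"
  have "sum ?g (VB m s) = 0" unfolding sum_VB_divergence xB_balance by simp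
  moreover have "net_flow (EB m s) (ztilde m s t) c p = sum ?g (T.descendants c)"
    if "T.child c p" for c p
  proof -
    have "net_flow (EB m s) (ztilde m s t) c p = net_flow (EB m s) (zq m s t) c p"
      unfolding net_flow_def ztilde_def by simp
    then show ?thesis using net_flow_child[OF that] sum_descendants_divergence[OF that] by simp
  qed
  ultimately have "(\<Sum>k\<in>VB m s. net_flow (EB m s) (ztilde m s t) l k) = ?g l"
    using T.divergence_iff[of "ztilde m s t" ?g] True by blast
  moreover have "(\<Sum>k=1..m. net_flow (Em m) (ztilde m s t) l k)
      = (\<Sum>k\<in>VB m s. net_flow (EB m s) (ztilde m s t) l k) + outer l"
    by (rule divergence_split(1)) (use True in \<open>auto simp: ztilde_def\<close>)
  ultimately show ?thesis using xq_VB[OF True] by simp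
next
  case False
  have "(\<Sum>k=1..m. net_flow (Em m) (ztilde m s t) l k)
      = (\<Sum>k=1..m. net_flow (Em m) (zval s) l k)"
    by (rule divergence_split(2)) (use False in \<open>auto simp: ztilde_def\<close>)
  moreover have "l \<noteq> r" using False r_in_VB by auto
  moreover have "(\<Sum>k=1..m. net_flow (Em m) (zval s) l k) + (if l = r then time s else 0)
        = deriv (f l) (xval s l)"
    using consistent assms unfolding consistent_def balanced_def by blast
  ultimately show ?thesis using xq_other[OF False] assms by simp
qed


section \<open>The new node and its meeting with the block\<close>

lemma new_smooth: "smooth_strongly_convex (f (m + 1))"
  using f_smooth m by simp

lemma xq_new: "xq m s t (m + 1) = inv (deriv (f (m + 1))) (- t)"
  unfolding xq_def using deriv_convex_conjugate[OF new_smooth] by simp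

lemma deriv_xq_new: "deriv (f (m + 1)) (xq m s t (m + 1)) = - t"
  unfolding xq_new using surj_deriv[OF new_smooth] by (rule surj_f_inv_f)

lemma xq_new_now: "xq m s (time s) (m + 1) = xval s (m + 1)"
  using consistent deriv_xq_new[of "time s"] strict_mono_eq[OF strict_mono_deriv[OF new_smooth]]
  unfolding consistent_def by metis

lemma xq_new_antimono: "t < t' \<Longrightarrow> xq m s t' (m + 1) < xq m s t (m + 1)"
  unfolding xq_new using strict_mono_less[OF strict_mono_inv_deriv(1)[OF new_smooth]] by simp

text \<open>Adding the equations of the block and of the new node eliminates \<open>t\<close> and
  leaves one equation for the common value, solvable because one side is the derivative of a
  strongly convex function. The two values move in opposite directions, so the time is
  unique.\<close>

lemma meet_time: "xB m s (time s + meet_time m s) = xq m s (time s + meet_time m s) (m + 1)"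
proof -
  let ?P = "\<lambda>d. xq m s (time s + d) r = xq m s (time s + d) (m + 1)"
  let ?g = "\<lambda>x. (\<Sum>l\<in>VB m s. f l x) + f (m + 1) x"
  have g: "smooth_strongly_convex ?g"
    by (intro smooth_strongly_convex_add sum_smooth new_smooth order_refl VB_nonempty)
  have dg: "deriv ?g x
      = (\<Sum>l\<in>VB m s. deriv (f l) x) + deriv (f (m + 1)) x" for x
    by (intro DERIV_imp_deriv DERIV_add DERIV_sum smooth_strongly_convex_DERIV VB_smooth new_smooth)
  obtain x where "sigma m s (VB m s) = deriv ?g x"
    using surjD[OF surj_deriv[OF g]] by blast
  then have x: "sigma m s (VB m s) = (\<Sum>l\<in>VB m s. deriv (f l) x) + deriv (f (m + 1)) x"
    unfolding dg .
  \<comment> \<open>The time is read off the equation of the new node; the equation of the block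
    then holds by the choice of \<open>x\<close>.\<close>
  define t where "t = - deriv (f (m + 1)) x"
  have "(\<Sum>l\<in>VB m s. deriv (f l) x) = (\<Sum>l\<in>VB m s. deriv (f l) (xB m s t))"
    unfolding xB_balance using x by (simp add: t_def)
  then have "xB m s t = x"
    using strict_mono_eq[OF sum_deriv_mono(1)[OF order_refl VB_nonempty]] by metis
  moreover have "xq m s t (m + 1) = x"
    using deriv_xq_new[of t] strict_mono_eq[OF strict_mono_deriv[OF new_smooth]]
    unfolding t_def by simp
  ultimately have t: "xB m s t = xq m s t (m + 1)" by simp
  have "\<exists>!d. ?P d"
  proof (rule ex1I)
    show "?P (t - time s)" using t by (simp add: xq_VB[OF r_in_VB])
    fix d assume "?P d"
    then have "xB m s (time s + d) = xq m s (time s + d) (m + 1)" by (simp add: xq_VB[OF r_in_VB])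
    then have "time s + d = t"
      using t strict_mono_less[OF strict_mono_xB] xq_new_antimono
      by (metis linorder_neqE_linordered_idom order.asym)
    then show "d = t - time s" by simp
  qed
  then have "?P (meet_time m s)" unfolding meet_time_def by (rule theI')
  then show ?thesis by (simp add: xq_VB[OF r_in_VB])
qed

lemma gap_sign:
  "xq m s (time s + d) (m + 1) \<le> xB m s (time s + d) \<longleftrightarrow> meet_time m s \<le> d"
  "xB m s (time s + d) \<le> xq m s (time s + d) (m + 1) \<longleftrightarrow> d \<le> meet_time m s"
proof -
  have 1: "xq m s (time s + d) (m + 1) < xB m s (time s + d)" if "meet_time m s < d"
    using that meet_time xq_new_antimono[of "time s + meet_time m s" "time s + d"]
      strict_monoD[OF strict_mono_xB, of "time s + meet_time m s" "time s + d"] by simp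
  have 2: "xB m s (time s + d) < xq m s (time s + d) (m + 1)" if "d < meet_time m s"
    using that meet_time xq_new_antimono[of "time s + d" "time s + meet_time m s"]
      strict_monoD[OF strict_mono_xB, of "time s + d" "time s + meet_time m s"] by simp
  show "xq m s (time s + d) (m + 1) \<le> xB m s (time s + d) \<longleftrightarrow> meet_time m s \<le> d"
    "xB m s (time s + d) \<le> xq m s (time s + d) (m + 1) \<longleftrightarrow> d \<le> meet_time m s"
    using 1 2 meet_time by (metis linorder_neqE_linordered_idom order.strict_iff_order not_le order_refl)+
qed

text \<open>The hypotheses concern the edges inside the block and the four kinds of signed edges
  crossing its border. An edge of \<open>eq_set\<close> has both ends inside or both outside, and a
  signed edge never has both inside, so everything else keeps its values and flows.\<close>

lemma consistent_advance:
  assumes EB: "\<And>i j. (i, j) \<in> EB m s \<Longrightarrow>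
      - lam i j \<le> ereal (zq m s t (i, j)) \<and> ereal (zq m s t (i, j)) \<le> mu i j"
    and "\<And>i j. (i, j) \<in> Omega_plus m s \<inter> gt_set s \<Longrightarrow> xval s j \<le> xB m s t"
    and "\<And>i j. (i, j) \<in> Omega_minus m s \<inter> gt_set s \<Longrightarrow> xB m s t \<le> xval s i"
    and "\<And>i j. (i, j) \<in> Omega_plus m s \<inter> lt_set s \<Longrightarrow> xB m s t \<le> xval s j"
    and "\<And>i j. (i, j) \<in> Omega_minus m s \<inter> lt_set s \<Longrightarrow> xval s i \<le> xB m s t"
  shows "consistent (s\<lparr>time := t, xval := xq m s t, zval := ztilde m s t\<rparr>)"
proof -
  note c = consistent[unfolded consistent_def]
  have not_new: "i \<noteq> m + 1 \<and> j \<noteq> m + 1" if "(i, j) \<in> Em m" for i j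
    using that Em_subset(2) by fastforce
  have eq: "xq m s t i = xq m s t j \<and> - lam i j \<le> ereal (ztilde m s t (i, j)) \<and>
      ereal (ztilde m s t (i, j)) \<le> mu i j" if e: "(i, j) \<in> eq_set s" for i j
  proof (cases "i \<in> VB m s")
    case True
    then have "j \<in> VB m s" "(i, j) \<in> EB m s" using VB_eq_closed e unfolding EB_def by auto
    then show ?thesis using True EB xq_VB by (simp add: ztilde_def)
  next
    case False
    then have "j \<notin> VB m s" "(i, j) \<notin> EB m s" using VB_eq_closed e unfolding EB_def by auto
    then show ?thesis using False c e not_new[of i j] eq_set_Em
      by (auto simp: ztilde_def xq_other)
  qed
  have noneq: "(i, j) \<notin> EB m s \<and> \<not> (i \<in> VB m s \<and> j \<in> VB m s)"
    if "(i, j) \<in> Em m" "(i, j) \<notin> eq_set s" for i j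
    using that EB_iff EB_subset(1) by blast
  have gt: "xq m s t j \<le> xq m s t i \<and> ereal (ztilde m s t (i, j)) = - lam i j"
    if e: "(i, j) \<in> gt_set s" for i j
  proof -
    have E: "(i, j) \<in> Em m" "(i, j) \<notin> eq_set s" using e c gt_set_Em by auto
    have z: "ereal (ztilde m s t (i, j)) = - lam i j" "xval s j \<le> xval s i"
      using noneq[OF E] e c unfolding ztilde_def by auto
    consider "i \<in> VB m s" "j \<notin> VB m s" | "i \<notin> VB m s" "j \<in> VB m s" | "i \<notin> VB m s" "j \<notin> VB m s"
      using noneq[OF E] by blast
    then have "xq m s t j \<le> xq m s t i"
      using not_new[OF E(1)] assms(2,3)[of i j] E(1) e z(2)
      by cases (auto simp: xq_VB xq_other Omega_plus_def Omega_minus_def)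
    then show ?thesis using z by simp
  qed
  have lt: "xq m s t i \<le> xq m s t j \<and> ereal (ztilde m s t (i, j)) = mu i j"
    if e: "(i, j) \<in> lt_set s" for i j
  proof -
    have E: "(i, j) \<in> Em m" "(i, j) \<notin> eq_set s" using e c lt_set_Em by auto
    have z: "ereal (ztilde m s t (i, j)) = mu i j" "xval s i \<le> xval s j"
      using noneq[OF E] e c unfolding ztilde_def by auto
    consider "i \<in> VB m s" "j \<notin> VB m s" | "i \<notin> VB m s" "j \<in> VB m s" | "i \<notin> VB m s" "j \<notin> VB m s"
      using noneq[OF E] by blast
    then have "xq m s t i \<le> xq m s t j"
      using not_new[OF E(1)] assms(4,5)[of i j] E(1) e z(2)
      by cases (auto simp: xq_VB xq_other Omega_plus_def Omega_minus_def)
    then show ?thesis using z by simp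
  qed
  have "balanced t (xq m s t) (ztilde m s t)"
    unfolding balanced_def using balance_after by blast
  then show ?thesis
    unfolding consistent_def using c eq gt lt deriv_xq_new[of t] by simp
qed

end

section \<open>Downward updates\<close>

text \<open>The starting value is on or above the level, so monotonicity places the unique solution
  at \<open>d \<le> 0\<close>, and the description denotes it.\<close>

lemma the_shift_nonpos:
  fixes \<phi> :: "real \<Rightarrow> real"
  assumes "strict_mono \<phi>" "surj \<phi>" "b \<le> \<phi> a"
  shows "(THE d. d \<le> 0 \<and> \<phi> (a + d) = b) \<le> 0" "\<phi> (a + (THE d. d \<le> 0 \<and> \<phi> (a + d) = b)) = b"
proof -
  have "d \<le> 0" if "\<phi> (a + d) = b" for d
    using assms(3) that strict_mono_less_eq[OF assms(1), of "a + d" a] by simp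
  then have "(\<lambda>d. d \<le> 0 \<and> \<phi> (a + d) = b) = (\<lambda>d. \<phi> (a + d) = b)" by blast
  then show "\<phi> (a + (THE d. d \<le> 0 \<and> \<phi> (a + d) = b)) = b" using the_shift[OF assms(1,2)] by simp
  then show "(THE d. d \<le> 0 \<and> \<phi> (a + d) = b) \<le> 0"
    using assms(3) strict_mono_less_eq[OF assms(1), of "a + (THE d. d \<le> 0 \<and> \<phi> (a + d) = b)" a] by simp
qed

context block begin

lemma eq_setD:
  assumes "(i, j) \<in> eq_set s"
  shows "xval s i = xval s j" "- lam i j \<le> ereal (zval s (i, j))" "ereal (zval s (i, j)) \<le> mu i j"
  using consistent assms unfolding consistent_def by auto

lemma gt_setD: "(i, j) \<in> gt_set s \<Longrightarrow> xval s j \<le> xval s i"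
  and lt_setD: "(i, j) \<in> lt_set s \<Longrightarrow> xval s i \<le> xval s j"
  using consistent unfolding consistent_def by auto

lemma EB_bounds:
  assumes "(i, j) \<in> EB m s"
  shows "- lam i j \<le> ereal (zq m s (time s) (i, j))" "ereal (zq m s (time s) (i, j)) \<le> mu i j"
    and "0 \<le> lam i j" "0 \<le> mu i j"
proof -
  have "(i, j) \<in> eq_set s" "(i, j) \<in> E" using assms EB_subset by auto
  then show "- lam i j \<le> ereal (zq m s (time s) (i, j))" "ereal (zq m s (time s) (i, j)) \<le> mu i j"
    "0 \<le> lam i j" "0 \<le> mu i j"
    using eq_setD weights_nonneg zq_now[OF assms] by auto
qed

lemma consistent_VB_edges:
  shows "(i, j) \<in> Omega_plus m s \<inter> gt_set s \<Longrightarrow> xval s j \<le> xval s r"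
    and "(i, j) \<in> Omega_minus m s \<inter> gt_set s \<Longrightarrow> xval s r \<le> xval s i"
    and "(i, j) \<in> Omega_plus m s \<inter> lt_set s \<Longrightarrow> xval s r \<le> xval s j"
    and "(i, j) \<in> Omega_minus m s \<inter> lt_set s \<Longrightarrow> xval s i \<le> xval s r"
  using gt_setD[of i j] lt_setD[of i j] xval_VB[of i] xval_VB[of j]
  unfolding Omega_plus_def Omega_minus_def by auto

text \<open>As \<open>t\<close> decreases, so does the flow towards \<open>r\<close>. Hence an edge
  pointing to \<open>r\<close> can only run into \<open>- lam\<close> and an edge pointing away only
  into \<open>mu\<close>; the opposite bound is kept by monotonicity.\<close>

lemma edge_time_minus:
  assumes e: "(i, j) \<in> EB m s"
  shows "edge_time_minus m s (i, j) \<le> 0"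
    and "edge_time_minus m s (i, j) \<le> ereal u \<Longrightarrow> u \<le> 0 \<Longrightarrow>
      - lam i j \<le> ereal (zq m s (time s + u) (i, j)) \<and> ereal (zq m s (time s + u) (i, j)) \<le> mu i j"
    and "edge_time_minus m s (i, j) = ereal u \<Longrightarrow>
      ereal (zq m s (time s + u) (i, j)) = (if beyond m s i j then - lam i j else mu i j)"
proof -
  let ?t = "edge_time_minus m s (i, j)"
  note bounds = EB_bounds[OF e]
  have V: "i \<in> VB m s" "j \<in> VB m s" using e T.F_sub by auto
  have "?t \<le> 0 \<and>
    (?t \<le> ereal u \<longrightarrow> u \<le> 0 \<longrightarrow>
      - lam i j \<le> ereal (zq m s (time s + u) (i, j)) \<and> ereal (zq m s (time s + u) (i, j)) \<le> mu i j) \<and>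
    (?t = ereal u \<longrightarrow>
      ereal (zq m s (time s + u) (i, j)) = (if beyond m s i j then - lam i j else mu i j))" for u
  proof (cases "T.child i j")
    case True
    note b = child_beyond[OF True]
    note zq = zq_upward_flow(1)[OF e True]
    note mono = upward_flow_mono[OF V(1)]
    have upper: "ereal (zq m s (time s + u) (i, j)) \<le> mu i j" if "u \<le> 0" for u
    proof -
      have "zq m s (time s + u) (i, j) \<le> zq m s (time s) (i, j)"
        using that strict_mono_less_eq[OF mono(1)] zq by simp
      then show ?thesis using bounds(2) by (meson ereal_less_eq(3) order_trans)
    qed
    show ?thesis
    proof (cases "lam i j")
      case (real c)
      let ?d = "THE d. d \<le> 0 \<and> upward_flow i (time s + d) = - c"
      have t: "?t = ereal ?d" unfolding edge_time_minus_def using b real zq by simp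
      have "- c \<le> upward_flow i (time s)" using bounds(1) real zq by simp
      note d = the_shift_nonpos[OF mono this]
      have "- lam i j \<le> ereal (zq m s (time s + u) (i, j))" if "?d \<le> u"
      proof -
        have "upward_flow i (time s + ?d) \<le> upward_flow i (time s + u)"
          using that strict_mono_less_eq[OF mono(1)] by simp
        then show ?thesis using d zq real by simp
      qed
      then show ?thesis using t d upper[of u] b zq real by auto
    next
      case PInf
      then have "?t = - \<infinity>" unfolding edge_time_minus_def using b by simp
      then show ?thesis using PInf upper by auto
    next
      case MInf
      then show ?thesis using bounds by simp
    qed
  next
    case False
    then have c: "T.child j i" using T.edge_child e by blast
    have b: "\<not> beyond m s i j" using beyond_edge_iff e False by blast
    note zq = zq_upward_flow(2)[OF e c]
    note mono = upward_flow_mono[OF V(2)]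
    have lower: "- lam i j \<le> ereal (zq m s (time s + u) (i, j))" if "u \<le> 0" for u
    proof -
      have "zq m s (time s) (i, j) \<le> zq m s (time s + u) (i, j)"
        using that strict_mono_less_eq[OF mono(1)] zq by simp
      then show ?thesis using bounds(1) by (meson ereal_less_eq(3) order_trans)
    qed
    show ?thesis
    proof (cases "mu i j")
      case (real c)
      let ?d = "THE d. d \<le> 0 \<and> upward_flow j (time s + d) = - c"
      have "(- upward_flow j (time s + d) = c) = (upward_flow j (time s + d) = - c)" for d by auto
      then have t: "?t = ereal ?d" unfolding edge_time_minus_def using b real zq by simp
      have "- c \<le> upward_flow j (time s)" using bounds(2) real zq by simp
      note d = the_shift_nonpos[OF mono this]
      have "ereal (zq m s (time s + u) (i, j)) \<le> mu i j" if "?d \<le> u"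
      proof -
        have "upward_flow j (time s + ?d) \<le> upward_flow j (time s + u)"
          using that strict_mono_less_eq[OF mono(1)] by simp
        then show ?thesis using d zq real by simp
      qed
      then show ?thesis using t d lower[of u] b zq real by auto
    next
      case PInf
      then have "?t = - \<infinity>" unfolding edge_time_minus_def using b by simp
      then show ?thesis using PInf lower by auto
    next
      case MInf
      then show ?thesis using bounds by simp
    qed
  qed
  then show "?t \<le> 0"
    and "?t \<le> ereal u \<Longrightarrow> u \<le> 0 \<Longrightarrow>
      - lam i j \<le> ereal (zq m s (time s + u) (i, j)) \<and> ereal (zq m s (time s + u) (i, j)) \<le> mu i j"
    and "?t = ereal u \<Longrightarrow>
      ereal (zq m s (time s + u) (i, j)) = (if beyond m s i j then - lam i j else mu i j)"
    by blast+
qed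

text \<open>The falling block meets the highest of the neighbouring values first and is above all of
  them until then. The default \<open>- \<infinity>\<close> for an empty set sets no limit.\<close>

lemma level_minus:
  assumes S: "finite S" "\<And>v. v \<in> S \<Longrightarrow> v \<le> xval s r"
    and \<delta>: "\<delta> = (if S = {} then - \<infinity> else ereal (THE d. xB m s (time s + d) = Max S))"
  shows "\<delta> \<le> 0"
    and "\<delta> \<le> ereal u \<Longrightarrow> v \<in> S \<Longrightarrow> v \<le> xB m s (time s + u)"
    and "\<delta> = ereal u \<Longrightarrow> xB m s (time s + u) \<in> S"
proof -
  have "\<delta> \<le> 0 \<and> (\<delta> \<le> ereal u \<longrightarrow> v \<in> S \<longrightarrow> v \<le> xB m s (time s + u)) \<and>
    (\<delta> = ereal u \<longrightarrow> xB m s (time s + u) \<in> S)" for u v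
  proof (cases "S = {}")
    case False
    let ?d = "THE d. xB m s (time s + d) = Max S"
    have d: "xB m s (time s + ?d) = Max S" using the_shift[OF strict_mono_xB surj_xB] .
    have Max: "Max S \<in> S" using S(1) False by simp
    then have "xB m s (time s + ?d) \<le> xB m s (time s)" using d S(2) xB_now by simp
    then have "?d \<le> 0" unfolding strict_mono_less_eq[OF strict_mono_xB] by simp
    moreover have "v \<le> xB m s (time s + u)" if "?d \<le> u" "v \<in> S"
    proof -
      have "v \<le> xB m s (time s + ?d)" using that(2) S(1) d by simp
      also have "\<dots> \<le> xB m s (time s + u)"
        using that(1) strict_mono_less_eq[OF strict_mono_xB] by simp
      finally show ?thesis .
    qed
    ultimately show ?thesis using \<delta> False d Max by auto
  qed (use \<delta> in simp)
  then show "\<delta> \<le> 0"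
    and "\<delta> \<le> ereal u \<Longrightarrow> v \<in> S \<Longrightarrow> v \<le> xB m s (time s + u)"
    and "\<delta> = ereal u \<Longrightarrow> xB m s (time s + u) \<in> S" by blast+
qed

lemma finite_EB: "finite (EB m s)"
  using EB_subset(2) finite_Em finite_subset by blast

lemma finite_Omega: "finite (Omega_plus m s)" "finite (Omega_minus m s)"
  by (rule finite_subset[OF _ finite_Em], auto simp: Omega_plus_def Omega_minus_def)+

lemma Delta_E_minus:
  shows "Delta_E_minus m s \<le> 0"
    and "(i, j) \<in> EB m s \<Longrightarrow> edge_time_minus m s (i, j) \<le> Delta_E_minus m s"
    and "Delta_E_minus m s = ereal u \<Longrightarrow>
      \<exists>i j. (i, j) \<in> EB m s \<and> edge_time_minus m s (i, j) = Delta_E_minus m s"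
proof -
  let ?D = "edge_time_minus m s ` EB m s"
  have fin: "finite ?D" using finite_EB by simp
  show "Delta_E_minus m s \<le> 0"
  proof (cases "EB m s = {}")
    case False
    then have "Max ?D \<in> ?D" using fin by (intro Max_in) auto
    then show ?thesis using False edge_time_minus(1) unfolding Delta_E_minus_def by auto
  qed (simp add: Delta_E_minus_def)
  show "(i, j) \<in> EB m s \<Longrightarrow> edge_time_minus m s (i, j) \<le> Delta_E_minus m s"
    using fin unfolding Delta_E_minus_def by auto
  assume u: "Delta_E_minus m s = ereal u"
  then have ne: "EB m s \<noteq> {}" unfolding Delta_E_minus_def by auto
  then have "Delta_E_minus m s \<in> ?D" using fin unfolding Delta_E_minus_def by simp
  then obtain e where "e \<in> EB m s" "edge_time_minus m s e = Delta_E_minus m s" by (metis imageE)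
  then show "\<exists>i j. (i, j) \<in> EB m s \<and> edge_time_minus m s (i, j) = Delta_E_minus m s"
    by (metis surj_pair)
qed

lemma Delta_Omega_plus_minus:
  shows "Delta_Omega_plus_minus m s \<le> 0"
    and "Delta_Omega_plus_minus m s \<le> ereal u \<Longrightarrow> (i, j) \<in> Omega_plus m s \<inter> gt_set s \<Longrightarrow>
      xval s j \<le> xB m s (time s + u)"
    and "Delta_Omega_plus_minus m s = ereal u \<Longrightarrow>
      \<exists>i j. (i, j) \<in> Omega_plus m s \<inter> gt_set s \<and> xB m s (time s + u) = xval s j"
proof -
  let ?S = "(\<lambda>(i, j). xval s j) ` (Omega_plus m s \<inter> gt_set s)"
  have S: "finite ?S" "v \<in> ?S \<Longrightarrow> v \<le> xval s r" for v
    using finite_Omega consistent_VB_edges(1) by auto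
  have "Delta_Omega_plus_minus m s =
      (if ?S = {} then - \<infinity> else ereal (THE d. xB m s (time s + d) = Max ?S))"
    unfolding Delta_Omega_plus_minus_def Let_def by simp
  note l = level_minus[OF S this]
  show "Delta_Omega_plus_minus m s \<le> 0" using l(1) .
  show "Delta_Omega_plus_minus m s \<le> ereal u \<Longrightarrow> (i, j) \<in> Omega_plus m s \<inter> gt_set s \<Longrightarrow>
      xval s j \<le> xB m s (time s + u)"
    by (rule l(2)) (auto intro: rev_image_eqI)
  show "Delta_Omega_plus_minus m s = ereal u \<Longrightarrow>
      \<exists>i j. (i, j) \<in> Omega_plus m s \<inter> gt_set s \<and> xB m s (time s + u) = xval s j"
    using l(3) by auto
qed

lemma Delta_Omega_minus_minus:
  shows "Delta_Omega_minus_minus m s \<le> 0"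
    and "Delta_Omega_minus_minus m s \<le> ereal u \<Longrightarrow> (i, j) \<in> Omega_minus m s \<inter> lt_set s \<Longrightarrow>
      xval s i \<le> xB m s (time s + u)"
    and "Delta_Omega_minus_minus m s = ereal u \<Longrightarrow>
      \<exists>i j. (i, j) \<in> Omega_minus m s \<inter> lt_set s \<and> xB m s (time s + u) = xval s i"
proof -
  let ?S = "(\<lambda>(i, j). xval s i) ` (Omega_minus m s \<inter> lt_set s)"
  have S: "finite ?S" "v \<in> ?S \<Longrightarrow> v \<le> xval s r" for v
    using finite_Omega consistent_VB_edges(4) by auto
  have "Delta_Omega_minus_minus m s =
      (if ?S = {} then - \<infinity> else ereal (THE d. xB m s (time s + d) = Max ?S))"
    unfolding Delta_Omega_minus_minus_def Let_def by simp
  note l = level_minus[OF S this]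
  show "Delta_Omega_minus_minus m s \<le> 0" using l(1) .
  show "Delta_Omega_minus_minus m s \<le> ereal u \<Longrightarrow> (i, j) \<in> Omega_minus m s \<inter> lt_set s \<Longrightarrow>
      xval s i \<le> xB m s (time s + u)"
    by (rule l(2)) (auto intro: rev_image_eqI)
  show "Delta_Omega_minus_minus m s = ereal u \<Longrightarrow>
      \<exists>i j. (i, j) \<in> Omega_minus m s \<inter> lt_set s \<and> xB m s (time s + u) = xval s i"
    using l(3) by auto
qed

lemma Delta_minus_nonpos: "Delta_minus m s \<le> 0"
  unfolding Delta_minus_def
  using Delta_E_minus(1) Delta_Omega_plus_minus(1) Delta_Omega_minus_minus(1) by simp

text \<open>An update may stop before \<open>Delta_minus\<close> is used up, so any \<open>u\<close>
  between it and 0 is covered. Neighbours below the block are guarded by \<open>Delta_minus\<close>,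
  neighbours above by the fact that the block moves down.\<close>

lemma Delta_minus_consistent:
  assumes u: "Delta_minus m s \<le> ereal u" "u \<le> 0" and t: "t = time s + u"
  shows "consistent (s\<lparr>time := t, xval := xq m s t, zval := ztilde m s t\<rparr>)"
proof -
  have D: "Delta_E_minus m s \<le> ereal u" "Delta_Omega_plus_minus m s \<le> ereal u"
    "Delta_Omega_minus_minus m s \<le> ereal u"
    using u(1) unfolding Delta_minus_def by auto
  have X: "xB m s t \<le> xval s r"
    using u(2) strict_mono_less_eq[OF strict_mono_xB, of t "time s"] unfolding xB_now t by simp
  show ?thesis
  proof (rule consistent_advance)
    fix i j assume e: "(i, j) \<in> EB m s"
    then show "- lam i j \<le> ereal (zq m s t (i, j)) \<and> ereal (zq m s t (i, j)) \<le> mu i j"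
      unfolding t using edge_time_minus(2)[OF e order_trans[OF Delta_E_minus(2)[OF e] D(1)] u(2)] by simp
  next
    fix i j assume "(i, j) \<in> Omega_plus m s \<inter> gt_set s"
    then show "xval s j \<le> xB m s t" unfolding t by (rule Delta_Omega_plus_minus(2)[OF D(2)])
  next
    fix i j assume "(i, j) \<in> Omega_minus m s \<inter> lt_set s"
    then show "xval s i \<le> xB m s t" unfolding t by (rule Delta_Omega_minus_minus(2)[OF D(3)])
  next
    fix i j assume "(i, j) \<in> Omega_minus m s \<inter> gt_set s"
    then show "xB m s t \<le> xval s i" using X consistent_VB_edges(2) order_trans by blast
  next
    fix i j assume "(i, j) \<in> Omega_plus m s \<inter> lt_set s"
    then show "xB m s t \<le> xval s j" using X consistent_VB_edges(3) order_trans by blast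
  qed
qed

text \<open>A finite \<open>Delta_minus\<close> is caused by some edge; this edge gets relabelled,
  which is what makes the potential drop strictly.\<close>

lemma Delta_minus_attained:
  assumes "Delta_minus m s = ereal u"
  shows "\<exists>i j. (i, j) \<in> EB m s \<and> edge_time_minus m s (i, j) = Delta_minus m s
    \<or> (i, j) \<in> Omega_plus m s \<inter> gt_set s \<and> xB m s (time s + u) = xval s j
    \<or> (i, j) \<in> Omega_minus m s \<inter> lt_set s \<and> xB m s (time s + u) = xval s i"
proof -
  have "Delta_minus m s = Delta_E_minus m s \<or> Delta_minus m s = Delta_Omega_plus_minus m s \<or>
    Delta_minus m s = Delta_Omega_minus_minus m s"
    unfolding Delta_minus_def by (auto simp: max_def)
  then show ?thesis
    using assms Delta_E_minus(3)[of u] Delta_Omega_plus_minus(3)[of u] Delta_Omega_minus_minus(3)[of u]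
    by metis
qed

lemma consistent_found: "consistent (s'\<lparr>found := b\<rparr>) \<longleftrightarrow> consistent s'"
  unfolding consistent_def by simp

text \<open>The three terms of the maximum guard the old edges, the order of block and new node, and
  the lower bound of the new edge, so \<open>t\<close> falls only as far as all of them permit. If
  neither stopping condition holds, an old edge is responsible and changes its sign.\<close>

lemma update_minus:
  assumes lower: "- lam r (m + 1) \<le> ereal (time s)" and gap: "xval s (m + 1) < xval s r"
    and "\<not> found s"
  defines "s' \<equiv> update_minus m s"
  shows "consistent s'" "- lam r (m + 1) \<le> ereal (time s')" "time s' \<le> time s"
    and "xval s' (m + 1) \<le> xval s' r"
    and "found s' \<longleftrightarrow> ereal (time s') = - lam r (m + 1) \<or> xval s' r = xval s' (m + 1)"
    and "\<not> found s' \<Longrightarrow>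
      potential (eq_set s') (gt_set s') (lt_set s') < potential (eq_set s) (gt_set s) (lt_set s)"
proof -
  define D where "D = Delta_minus m s"
  define B where "B = max (ereal (time s) + D)
    (max (ereal (time s + meet_time m s)) (- lam r (m + 1)))"
  define t where "t = real_of_ereal B"
  define u where "u = t - time s"
  have meet: "meet_time m s \<le> 0"
    using gap_sign(1)[of 0] gap xB_now xq_new_now by simp
  have D0: "D \<le> 0" unfolding D_def by (rule Delta_minus_nonpos)
  have "B \<le> ereal (time s)"
    unfolding B_def using D0 meet lower by (cases D) auto
  moreover have ge: "ereal (time s) + D \<le> B" "ereal (time s + meet_time m s) \<le> B"
    "- lam r (m + 1) \<le> B" unfolding B_def by (simp_all add: le_max_iff_disj)
  \<comment> \<open>\<open>B\<close> lies between the reals \<open>time s + meet_time m s\<close>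
    and \<open>time s\<close>, so it is finite even if \<open>Delta_minus\<close> and the weight of
    the new edge are infinite.\<close>
  ultimately have B: "B = ereal t" unfolding t_def by (cases B) auto
  have u: "u \<le> 0" "meet_time m s \<le> u" "t = time s + u" and Du: "D \<le> ereal u"
    using \<open>B \<le> ereal (time s)\<close> ge B unfolding u_def by (auto simp: algebra_simps) (cases D; simp)
  define a where "a = s\<lparr>time := t, xval := xq m s t, zval := ztilde m s t\<rparr>"
  have ca: "consistent a"
    unfolding a_def by (rule Delta_minus_consistent[OF Du[unfolded D_def] u(1,3)])
  have xr: "xq m s t r = xB m s t" by (rule xq_VB[OF r_in_VB])
  have order: "xq m s t (m + 1) \<le> xq m s t r"
    using gap_sign(1)[of u] u(2) unfolding xr u(3)[symmetric] by simp
  define C where "C \<longleftrightarrow> ereal t = - lam r (m + 1) \<or> xq m s t r = xq m s t (m + 1)"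
  define MEp where "MEp = {(i, j) \<in> EB m s. edge_time_minus m s (i, j) = D \<and> beyond m s i j}"
  define MEm where "MEm = {(i, j) \<in> EB m s. edge_time_minus m s (i, j) = D \<and> beyond m s j i}"
  define MOp where "MOp = {(i, j) \<in> Omega_plus m s \<inter> gt_set s.
    xq m s (time s + real_of_ereal D) i = xval s j}"
  define MOm where "MOm = {(i, j) \<in> Omega_minus m s \<inter> lt_set s.
    xq m s (time s + real_of_ereal D) j = xval s i}"
  have s': "s' = (if C then a\<lparr>found := True\<rparr> else
    a\<lparr>eq_set := (eq_set s \<union> MOp \<union> MOm) - (MEp \<union> MEm),
      gt_set := (gt_set s \<union> MEp) - MOp, lt_set := (lt_set s \<union> MEm) - MOm\<rparr>)"
    unfolding s'_def update_minus_def Let_def C_def a_def MEp_def MEm_def MOp_def MOm_def D_def B_def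
      t_def by simp
  have fields: "time s' = t" "xval s' = xq m s t" "found s' \<longleftrightarrow> C"
    unfolding s' a_def using \<open>\<not> found s\<close> by auto
  show "- lam r (m + 1) \<le> ereal (time s')" "time s' \<le> time s" "xval s' (m + 1) \<le> xval s' r"
    "found s' \<longleftrightarrow> ereal (time s') = - lam r (m + 1) \<or> xval s' r = xval s' (m + 1)"
    unfolding fields using ge(3) B u(1,3) order C_def by auto
  have "consistent s' \<and> (\<not> C \<longrightarrow>
      potential (eq_set s') (gt_set s') (lt_set s') < potential (eq_set s) (gt_set s) (lt_set s))"
  proof (cases C)
    case True
    then show ?thesis using ca consistent_found s' by simp
  next
    case False
    then have s': "s' = a\<lparr>eq_set := (eq_set s \<union> MOp \<union> MOm) - (MEp \<union> MEm),
      gt_set := (gt_set s \<union> MEp) - MOp, lt_set := (lt_set s \<union> MEm) - MOm\<rparr>" using s' by simp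
    \<comment> \<open>Continuing excludes the meeting time and the bound of the new edge as the
      maximum. Only the term with \<open>D\<close> remains, and so \<open>D\<close> is real.\<close>
    have "xB m s t \<noteq> xq m s t (m + 1)" using False xr unfolding C_def by simp
    then have "u \<noteq> meet_time m s" using meet_time u(3) by metis
    then have "t \<noteq> time s + meet_time m s" using u(3) by simp
    then have "ereal (time s) + D = ereal t"
      using False B unfolding B_def C_def by (auto simp: max_def split: if_splits)
    then have D: "D = ereal u" unfolding u_def by (cases D) auto
    have t': "time s + real_of_ereal D = t" using D u(3) by simp
    have EBe: "beyond m s i j \<longleftrightarrow> T.child i j" "beyond m s j i \<longleftrightarrow> T.child j i"
      if "(i, j) \<in> EB m s" for i j
      using beyond_edge_iff that by auto
    have z: "ereal (zval a (i, j)) = (if beyond m s i j then - lam i j else mu i j)"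
      if "(i, j) \<in> EB m s" "edge_time_minus m s (i, j) = D" for i j
      using edge_time_minus(3)[OF that(1), of u] that D u(3) unfolding a_def ztilde_def by simp
    have MOp: "i \<in> VB m s" "j \<notin> VB m s" "(i, j) \<in> Em m" "(i, j) \<in> gt_set s" "xB m s t = xval s j"
      if "(i, j) \<in> MOp" for i j
      using that xq_VB[of i t] unfolding MOp_def Omega_plus_def t' by auto
    have MOm: "j \<in> VB m s" "i \<notin> VB m s" "(i, j) \<in> Em m" "(i, j) \<in> lt_set s" "xB m s t = xval s i"
      if "(i, j) \<in> MOm" for i j
      using that xq_VB[of j t] unfolding MOm_def Omega_minus_def t' by auto
    have sub: "MEp \<subseteq> eq_set s" "MEm \<subseteq> eq_set s" "MOp \<subseteq> gt_set s" "MOm \<subseteq> lt_set s"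
      unfolding MEp_def MEm_def MOp_def MOm_def using EB_subset(1) by auto
    have sets: "eq_set a = eq_set s" "gt_set a = gt_set s" "lt_set a = lt_set s"
      unfolding a_def by simp_all
    have "consistent (a\<lparr>eq_set := (eq_set a \<union> MOp \<union> MOm) - (MEp \<union> MEm),
      gt_set := (gt_set a \<union> MEp) - MOp, lt_set := (lt_set a \<union> MEm) - MOm\<rparr>)"
    proof (rule consistent_relabel[OF ca])
      show "MEp \<subseteq> eq_set a" "MEm \<subseteq> eq_set a" "MOp \<subseteq> gt_set a" "MOm \<subseteq> lt_set a"
        unfolding sets by (fact sub)+
      show "ereal (zval a (i, j)) = - lam i j" if "(i, j) \<in> MEp" for i j
        using that z unfolding MEp_def by auto
      show "ereal (zval a (i, j)) = mu i j" if "(i, j) \<in> MEm" for i j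
        using that z[of i j] EBe[of i j] T.child_antisym unfolding MEm_def by auto
      show "MEp \<inter> MEm = {}"
        using EBe T.child_antisym unfolding MEp_def MEm_def by auto
      show "xval a i = xval a j" if "(i, j) \<in> MOp \<union> MOm" for i j
        using that
      proof
        assume e: "(i, j) \<in> MOp"
        then have "j \<noteq> m + 1" using MOp(3) Em_subset(2) by fastforce
        then show ?thesis unfolding a_def using MOp[OF e] xq_VB xq_other by simp
      next
        assume e: "(i, j) \<in> MOm"
        then have "i \<noteq> m + 1" using MOm(3) Em_subset(2) by fastforce
        then show ?thesis unfolding a_def using MOm[OF e] xq_VB xq_other by simp
      qed
    qed
    then have "consistent s'" unfolding s' sets .
    moreover have "potential ((eq_set s \<union> MOp \<union> MOm) - (MEp \<union> MEm)) ((gt_set s \<union> MEp) - MOp)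
        ((lt_set s \<union> MEm) - MOm) < potential (eq_set s) (gt_set s) (lt_set s)"
    proof (rule potential_less[OF _ _ _ _ sub])
      show "G.child i j" if "(i, j) \<in> MEp \<union> MOm" for i j
        using that
      proof
        assume e: "(i, j) \<in> MEp"
        then show ?thesis using EBe[of i j] G_child_iff[of i j] T.F_sub unfolding MEp_def by auto
      next
        assume e: "(i, j) \<in> MOm"
        then have "(j, i) \<in> E \<union> E\<inverse>" using MOm(3) Em_subset(1) by blast
        then show ?thesis using child_leaving MOm(1,2)[OF e] by blast
      qed
      show "G.child j i" if "(i, j) \<in> MEm \<union> MOp" for i j
        using that
      proof
        assume e: "(i, j) \<in> MEm"
        then show ?thesis using EBe[of i j] G_child_iff[of j i] T.F_sub unfolding MEm_def by auto
      next
        assume e: "(i, j) \<in> MOp"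
        then have "(i, j) \<in> E \<union> E\<inverse>" using MOp(3) Em_subset(1) by blast
        then show ?thesis using child_leaving MOp(1,2)[OF e] by blast
      qed
      obtain i j where "(i, j) \<in> EB m s \<and> edge_time_minus m s (i, j) = D
        \<or> (i, j) \<in> Omega_plus m s \<inter> gt_set s \<and> xB m s t = xval s j
        \<or> (i, j) \<in> Omega_minus m s \<inter> lt_set s \<and> xB m s t = xval s i"
        using Delta_minus_attained[OF D[unfolded D_def]] u(3) unfolding D_def by blast
      then have "(i, j) \<in> MEp \<union> MEm \<union> MOp \<union> MOm"
      proof (elim disjE conjE)
        assume e: "(i, j) \<in> EB m s" "edge_time_minus m s (i, j) = D"
        then have "T.child i j \<or> T.child j i" using T.edge_child by blast
        then show ?thesis using e EBe unfolding MEp_def MEm_def by auto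
      next
        assume "(i, j) \<in> Omega_plus m s \<inter> gt_set s" "xB m s t = xval s j"
        then show ?thesis unfolding MOp_def t' using xq_VB[of i t] by (auto simp: Omega_plus_def)
      next
        assume "(i, j) \<in> Omega_minus m s \<inter> lt_set s" "xB m s t = xval s i"
        then show ?thesis unfolding MOm_def t' using xq_VB[of j t] by (auto simp: Omega_minus_def)
      qed
      then show "MEp \<union> MEm \<union> MOp \<union> MOm \<noteq> {}" by auto
    qed (use consistent in \<open>auto simp: consistent_def\<close>)
    ultimately show ?thesis unfolding s' by simp
  qed
  then show "consistent s'" "\<not> found s' \<Longrightarrow>
      potential (eq_set s') (gt_set s') (lt_set s') < potential (eq_set s) (gt_set s) (lt_set s)"
    using fields(3) by blast+
qed

end

section \<open>Upward updates\<close>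

lemma the_shift_nonneg:
  fixes \<phi> :: "real \<Rightarrow> real"
  assumes "strict_mono \<phi>" "surj \<phi>" "\<phi> a \<le> b"
  shows "0 \<le> (THE d. 0 \<le> d \<and> \<phi> (a + d) = b)" "\<phi> (a + (THE d. 0 \<le> d \<and> \<phi> (a + d) = b)) = b"
proof -
  have "0 \<le> d" if "\<phi> (a + d) = b" for d
    using assms(3) that strict_mono_less_eq[OF assms(1), of a "a + d"] by simp
  then have "(\<lambda>d. 0 \<le> d \<and> \<phi> (a + d) = b) = (\<lambda>d. \<phi> (a + d) = b)" by blast
  then show "\<phi> (a + (THE d. 0 \<le> d \<and> \<phi> (a + d) = b)) = b" using the_shift[OF assms(1,2)] by simp
  then show "0 \<le> (THE d. 0 \<le> d \<and> \<phi> (a + d) = b)"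
    using assms(3) strict_mono_less_eq[OF assms(1), of a "a + (THE d. 0 \<le> d \<and> \<phi> (a + d) = b)"] by simp
qed

context block begin

text \<open>The flow towards \<open>r\<close> now increases, so an edge pointing to \<open>r\<close>
  is stopped by \<open>mu\<close> and one pointing away by \<open>- lam\<close>.\<close>

lemma edge_time_plus:
  assumes e: "(i, j) \<in> EB m s"
  shows "0 \<le> edge_time_plus m s (i, j)"
    and "ereal u \<le> edge_time_plus m s (i, j) \<Longrightarrow> 0 \<le> u \<Longrightarrow>
      - lam i j \<le> ereal (zq m s (time s + u) (i, j)) \<and> ereal (zq m s (time s + u) (i, j)) \<le> mu i j"
    and "edge_time_plus m s (i, j) = ereal u \<Longrightarrow>
      ereal (zq m s (time s + u) (i, j)) = (if beyond m s i j then mu i j else - lam i j)"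
proof -
  let ?t = "edge_time_plus m s (i, j)"
  note bounds = EB_bounds[OF e]
  have V: "i \<in> VB m s" "j \<in> VB m s" using e T.F_sub by auto
  have "0 \<le> ?t \<and>
    (ereal u \<le> ?t \<longrightarrow> 0 \<le> u \<longrightarrow>
      - lam i j \<le> ereal (zq m s (time s + u) (i, j)) \<and> ereal (zq m s (time s + u) (i, j)) \<le> mu i j) \<and>
    (?t = ereal u \<longrightarrow>
      ereal (zq m s (time s + u) (i, j)) = (if beyond m s i j then mu i j else - lam i j))" for u
  proof (cases "T.child i j")
    case True
    note b = child_beyond[OF True]
    note zq = zq_upward_flow(1)[OF e True]
    note mono = upward_flow_mono[OF V(1)]
    have lower: "- lam i j \<le> ereal (zq m s (time s + u) (i, j))" if "0 \<le> u" for u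
    proof -
      have "zq m s (time s) (i, j) \<le> zq m s (time s + u) (i, j)"
        using that strict_mono_less_eq[OF mono(1)] zq by simp
      then show ?thesis using bounds(1) by (meson ereal_less_eq(3) order_trans)
    qed
    show ?thesis
    proof (cases "mu i j")
      case (real c)
      let ?d = "THE d. 0 \<le> d \<and> upward_flow i (time s + d) = c"
      have t: "?t = ereal ?d" unfolding edge_time_plus_def using b real zq by simp
      have "upward_flow i (time s) \<le> c" using bounds(2) real zq by simp
      note d = the_shift_nonneg[OF mono this]
      have "ereal (zq m s (time s + u) (i, j)) \<le> mu i j" if "u \<le> ?d"
      proof -
        have "upward_flow i (time s + u) \<le> upward_flow i (time s + ?d)"
          using that strict_mono_less_eq[OF mono(1)] by simp
        then show ?thesis using d zq real by simp
      qed
      then show ?thesis using t d lower[of u] b zq real by auto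
    next
      case PInf
      then have "?t = \<infinity>" unfolding edge_time_plus_def using b by simp
      then show ?thesis using PInf lower by auto
    next
      case MInf
      then show ?thesis using bounds by simp
    qed
  next
    case False
    then have c: "T.child j i" using T.edge_child e by blast
    have b: "\<not> beyond m s i j" using beyond_edge_iff e False by blast
    note zq = zq_upward_flow(2)[OF e c]
    note mono = upward_flow_mono[OF V(2)]
    have upper: "ereal (zq m s (time s + u) (i, j)) \<le> mu i j" if "0 \<le> u" for u
    proof -
      have "zq m s (time s + u) (i, j) \<le> zq m s (time s) (i, j)"
        using that strict_mono_less_eq[OF mono(1)] zq by simp
      then show ?thesis using bounds(2) by (meson ereal_less_eq(3) order_trans)
    qed
    show ?thesis
    proof (cases "lam i j")
      case (real c)
      let ?d = "THE d. 0 \<le> d \<and> upward_flow j (time s + d) = c"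
      have t: "?t = ereal ?d" unfolding edge_time_plus_def using b real zq by simp
      have "upward_flow j (time s) \<le> c" using bounds(1) real zq by simp
      note d = the_shift_nonneg[OF mono this]
      have "- lam i j \<le> ereal (zq m s (time s + u) (i, j))" if "u \<le> ?d"
      proof -
        have "upward_flow j (time s + u) \<le> upward_flow j (time s + ?d)"
          using that strict_mono_less_eq[OF mono(1)] by simp
        then show ?thesis using d zq real by simp
      qed
      then show ?thesis using t d upper[of u] b zq real by auto
    next
      case PInf
      then have "?t = \<infinity>" unfolding edge_time_plus_def using b by simp
      then show ?thesis using PInf upper by auto
    next
      case MInf
      then show ?thesis using bounds by simp
    qed
  qed
  then show "0 \<le> ?t"
    and "ereal u \<le> ?t \<Longrightarrow> 0 \<le> u \<Longrightarrow>
      - lam i j \<le> ereal (zq m s (time s + u) (i, j)) \<and> ereal (zq m s (time s + u) (i, j)) \<le> mu i j"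
    and "?t = ereal u \<Longrightarrow>
      ereal (zq m s (time s + u) (i, j)) = (if beyond m s i j then mu i j else - lam i j)"
    by blast+
qed

text \<open>The rising block meets the lowest of the neighbouring values first.\<close>

lemma level_plus:
  assumes S: "finite S" "\<And>v. v \<in> S \<Longrightarrow> xval s r \<le> v"
    and \<delta>: "\<delta> = (if S = {} then \<infinity> else ereal (THE d. xB m s (time s + d) = Min S))"
  shows "0 \<le> \<delta>"
    and "ereal u \<le> \<delta> \<Longrightarrow> v \<in> S \<Longrightarrow> xB m s (time s + u) \<le> v"
    and "\<delta> = ereal u \<Longrightarrow> xB m s (time s + u) \<in> S"
proof -
  have "0 \<le> \<delta> \<and> (ereal u \<le> \<delta> \<longrightarrow> v \<in> S \<longrightarrow> xB m s (time s + u) \<le> v) \<and>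
    (\<delta> = ereal u \<longrightarrow> xB m s (time s + u) \<in> S)" for u v
  proof (cases "S = {}")
    case False
    let ?d = "THE d. xB m s (time s + d) = Min S"
    have d: "xB m s (time s + ?d) = Min S" using the_shift[OF strict_mono_xB surj_xB] .
    have Min: "Min S \<in> S" using S(1) False by simp
    then have "xB m s (time s) \<le> xB m s (time s + ?d)" using d S(2) xB_now by simp
    then have "0 \<le> ?d" unfolding strict_mono_less_eq[OF strict_mono_xB] by simp
    moreover have "xB m s (time s + u) \<le> v" if "u \<le> ?d" "v \<in> S"
    proof -
      have "xB m s (time s + u) \<le> xB m s (time s + ?d)"
        using that(1) strict_mono_less_eq[OF strict_mono_xB] by simp
      also have "\<dots> \<le> v" using that(2) S(1) d by simp
      finally show ?thesis .
    qed
    ultimately show ?thesis using \<delta> False d Min by auto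
  qed (use \<delta> in simp)
  then show "0 \<le> \<delta>"
    and "ereal u \<le> \<delta> \<Longrightarrow> v \<in> S \<Longrightarrow> xB m s (time s + u) \<le> v"
    and "\<delta> = ereal u \<Longrightarrow> xB m s (time s + u) \<in> S" by blast+
qed

lemma Delta_E_plus:
  shows "0 \<le> Delta_E_plus m s"
    and "(i, j) \<in> EB m s \<Longrightarrow> Delta_E_plus m s \<le> edge_time_plus m s (i, j)"
    and "Delta_E_plus m s = ereal u \<Longrightarrow>
      \<exists>i j. (i, j) \<in> EB m s \<and> edge_time_plus m s (i, j) = Delta_E_plus m s"
proof -
  let ?D = "edge_time_plus m s ` EB m s"
  have fin: "finite ?D" using finite_EB by simp
  show "0 \<le> Delta_E_plus m s"
  proof (cases "EB m s = {}")
    case False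
    then have "Min ?D \<in> ?D" using fin by (intro Min_in) auto
    then show ?thesis using False edge_time_plus(1) unfolding Delta_E_plus_def by auto
  qed (simp add: Delta_E_plus_def)
  show "(i, j) \<in> EB m s \<Longrightarrow> Delta_E_plus m s \<le> edge_time_plus m s (i, j)"
    using fin unfolding Delta_E_plus_def by auto
  assume u: "Delta_E_plus m s = ereal u"
  then have ne: "EB m s \<noteq> {}" unfolding Delta_E_plus_def by auto
  then have "Delta_E_plus m s \<in> ?D" using fin unfolding Delta_E_plus_def by simp
  then obtain e where "e \<in> EB m s" "edge_time_plus m s e = Delta_E_plus m s" by (metis imageE)
  then show "\<exists>i j. (i, j) \<in> EB m s \<and> edge_time_plus m s (i, j) = Delta_E_plus m s"
    by (metis surj_pair)
qed

lemma Delta_Omega_plus_plus: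
  shows "0 \<le> Delta_Omega_plus_plus m s"
    and "ereal u \<le> Delta_Omega_plus_plus m s \<Longrightarrow> (i, j) \<in> Omega_plus m s \<inter> lt_set s \<Longrightarrow>
      xB m s (time s + u) \<le> xval s j"
    and "Delta_Omega_plus_plus m s = ereal u \<Longrightarrow>
      \<exists>i j. (i, j) \<in> Omega_plus m s \<inter> lt_set s \<and> xB m s (time s + u) = xval s j"
proof -
  let ?S = "(\<lambda>(i, j). xval s j) ` (Omega_plus m s \<inter> lt_set s)"
  have S: "finite ?S" "v \<in> ?S \<Longrightarrow> xval s r \<le> v" for v
    using finite_Omega consistent_VB_edges(3) by auto
  have "Delta_Omega_plus_plus m s =
      (if ?S = {} then \<infinity> else ereal (THE d. xB m s (time s + d) = Min ?S))"
    unfolding Delta_Omega_plus_plus_def Let_def by simp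
  note l = level_plus[OF S this]
  show "0 \<le> Delta_Omega_plus_plus m s" using l(1) .
  show "ereal u \<le> Delta_Omega_plus_plus m s \<Longrightarrow> (i, j) \<in> Omega_plus m s \<inter> lt_set s \<Longrightarrow>
      xB m s (time s + u) \<le> xval s j"
    by (rule l(2)) (auto intro: rev_image_eqI)
  show "Delta_Omega_plus_plus m s = ereal u \<Longrightarrow>
      \<exists>i j. (i, j) \<in> Omega_plus m s \<inter> lt_set s \<and> xB m s (time s + u) = xval s j"
    using l(3) by auto
qed

lemma Delta_Omega_minus_plus:
  shows "0 \<le> Delta_Omega_minus_plus m s"
    and "ereal u \<le> Delta_Omega_minus_plus m s \<Longrightarrow> (i, j) \<in> Omega_minus m s \<inter> gt_set s \<Longrightarrow>
      xB m s (time s + u) \<le> xval s i"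
    and "Delta_Omega_minus_plus m s = ereal u \<Longrightarrow>
      \<exists>i j. (i, j) \<in> Omega_minus m s \<inter> gt_set s \<and> xB m s (time s + u) = xval s i"
proof -
  let ?S = "(\<lambda>(i, j). xval s i) ` (Omega_minus m s \<inter> gt_set s)"
  have S: "finite ?S" "v \<in> ?S \<Longrightarrow> xval s r \<le> v" for v
    using finite_Omega consistent_VB_edges(2) by auto
  have "Delta_Omega_minus_plus m s =
      (if ?S = {} then \<infinity> else ereal (THE d. xB m s (time s + d) = Min ?S))"
    unfolding Delta_Omega_minus_plus_def Let_def by simp
  note l = level_plus[OF S this]
  show "0 \<le> Delta_Omega_minus_plus m s" using l(1) .
  show "ereal u \<le> Delta_Omega_minus_plus m s \<Longrightarrow> (i, j) \<in> Omega_minus m s \<inter> gt_set s \<Longrightarrow>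
      xB m s (time s + u) \<le> xval s i"
    by (rule l(2)) (auto intro: rev_image_eqI)
  show "Delta_Omega_minus_plus m s = ereal u \<Longrightarrow>
      \<exists>i j. (i, j) \<in> Omega_minus m s \<inter> gt_set s \<and> xB m s (time s + u) = xval s i"
    using l(3) by auto
qed

lemma Delta_plus_nonneg: "0 \<le> Delta_plus m s"
  unfolding Delta_plus_def
  using Delta_E_plus(1) Delta_Omega_plus_plus(1) Delta_Omega_minus_plus(1) by simp

lemma Delta_plus_consistent:
  assumes u: "ereal u \<le> Delta_plus m s" "0 \<le> u" and t: "t = time s + u"
  shows "consistent (s\<lparr>time := t, xval := xq m s t, zval := ztilde m s t\<rparr>)"
proof -
  have D: "ereal u \<le> Delta_E_plus m s" "ereal u \<le> Delta_Omega_plus_plus m s"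
    "ereal u \<le> Delta_Omega_minus_plus m s"
    using u(1) unfolding Delta_plus_def by auto
  have X: "xval s r \<le> xB m s t"
    using u(2) strict_mono_less_eq[OF strict_mono_xB, of "time s" t] unfolding xB_now t by simp
  show ?thesis
  proof (rule consistent_advance)
    fix i j assume e: "(i, j) \<in> EB m s"
    then show "- lam i j \<le> ereal (zq m s t (i, j)) \<and> ereal (zq m s t (i, j)) \<le> mu i j"
      unfolding t using edge_time_plus(2)[OF e order_trans[OF D(1) Delta_E_plus(2)[OF e]] u(2)] by simp
  next
    fix i j assume "(i, j) \<in> Omega_plus m s \<inter> lt_set s"
    then show "xB m s t \<le> xval s j" unfolding t by (rule Delta_Omega_plus_plus(2)[OF D(2)])
  next
    fix i j assume "(i, j) \<in> Omega_minus m s \<inter> gt_set s"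
    then show "xB m s t \<le> xval s i" unfolding t by (rule Delta_Omega_minus_plus(2)[OF D(3)])
  next
    fix i j assume "(i, j) \<in> Omega_minus m s \<inter> lt_set s"
    then show "xval s i \<le> xB m s t" using X consistent_VB_edges(4) order_trans by blast
  next
    fix i j assume "(i, j) \<in> Omega_plus m s \<inter> gt_set s"
    then show "xval s j \<le> xB m s t" using X consistent_VB_edges(1) order_trans by blast
  qed
qed

lemma Delta_plus_attained:
  assumes "Delta_plus m s = ereal u"
  shows "\<exists>i j. (i, j) \<in> EB m s \<and> edge_time_plus m s (i, j) = Delta_plus m s
    \<or> (i, j) \<in> Omega_plus m s \<inter> lt_set s \<and> xB m s (time s + u) = xval s j
    \<or> (i, j) \<in> Omega_minus m s \<inter> gt_set s \<and> xB m s (time s + u) = xval s i"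
proof -
  have "Delta_plus m s = Delta_E_plus m s \<or> Delta_plus m s = Delta_Omega_plus_plus m s \<or>
    Delta_plus m s = Delta_Omega_minus_plus m s"
    unfolding Delta_plus_def by (auto simp: min_def)
  then show ?thesis
    using assms Delta_E_plus(3)[of u] Delta_Omega_plus_plus(3)[of u] Delta_Omega_minus_plus(3)[of u]
    by metis
qed

text \<open>The order is reversed against the downward case: a rising block absorbs neighbours above
  it, and the far parts that split off stay below. Hence the potential is taken with
  \<open>gt_set\<close> and \<open>lt_set\<close> exchanged.\<close>

lemma update_plus:
  assumes upper: "ereal (time s) \<le> mu r (m + 1)" and gap: "xval s r < xval s (m + 1)"
    and "\<not> found s"
  defines "s' \<equiv> update_plus m s"
  shows "consistent s'" "ereal (time s') \<le> mu r (m + 1)" "time s \<le> time s'"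
    and "xval s' r \<le> xval s' (m + 1)"
    and "found s' \<longleftrightarrow> ereal (time s') = mu r (m + 1) \<or> xval s' r = xval s' (m + 1)"
    and "\<not> found s' \<Longrightarrow>
      potential (eq_set s') (lt_set s') (gt_set s') < potential (eq_set s) (lt_set s) (gt_set s)"
proof -
  define D where "D = Delta_plus m s"
  define B where "B = min (ereal (time s) + D)
    (min (ereal (time s + meet_time m s)) (mu r (m + 1)))"
  define t where "t = real_of_ereal B"
  define u where "u = t - time s"
  have meet: "0 \<le> meet_time m s"
    using gap_sign(2)[of 0] gap xB_now xq_new_now by simp
  have D0: "0 \<le> D" unfolding D_def by (rule Delta_plus_nonneg)
  have "ereal (time s) \<le> B"
    unfolding B_def using D0 meet upper by (cases D) auto
  moreover have ge: "B \<le> ereal (time s) + D" "B \<le> ereal (time s + meet_time m s)"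
    "B \<le> mu r (m + 1)" unfolding B_def by (simp_all add: min_le_iff_disj)
  ultimately have B: "B = ereal t" unfolding t_def by (cases B) auto
  have u: "0 \<le> u" "u \<le> meet_time m s" "t = time s + u" and Du: "ereal u \<le> D"
    using \<open>ereal (time s) \<le> B\<close> ge B unfolding u_def by (auto simp: algebra_simps) (cases D; simp)
  define a where "a = s\<lparr>time := t, xval := xq m s t, zval := ztilde m s t\<rparr>"
  have ca: "consistent a"
    unfolding a_def by (rule Delta_plus_consistent[OF Du[unfolded D_def] u(1,3)])
  have xr: "xq m s t r = xB m s t" by (rule xq_VB[OF r_in_VB])
  have order: "xq m s t r \<le> xq m s t (m + 1)"
    using gap_sign(2)[of u] u(2) unfolding xr u(3)[symmetric] by simp
  define C where "C \<longleftrightarrow> ereal t = mu r (m + 1) \<or> xq m s t r = xq m s t (m + 1)"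
  define MEp where "MEp = {(i, j) \<in> EB m s. edge_time_plus m s (i, j) = D \<and> beyond m s i j}"
  define MEm where "MEm = {(i, j) \<in> EB m s. edge_time_plus m s (i, j) = D \<and> beyond m s j i}"
  define MOp where "MOp = {(i, j) \<in> Omega_plus m s \<inter> lt_set s.
    xq m s (time s + real_of_ereal D) i = xval s j}"
  define MOm where "MOm = {(i, j) \<in> Omega_minus m s \<inter> gt_set s.
    xq m s (time s + real_of_ereal D) j = xval s i}"
  have s': "s' = (if C then a\<lparr>found := True\<rparr> else
    a\<lparr>eq_set := (eq_set s \<union> MOp \<union> MOm) - (MEp \<union> MEm),
      gt_set := (gt_set s \<union> MEm) - MOm, lt_set := (lt_set s \<union> MEp) - MOp\<rparr>)"
    unfolding s'_def update_plus_def Let_def C_def a_def MEp_def MEm_def MOp_def MOm_def D_def B_def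
      t_def by simp
  have fields: "time s' = t" "xval s' = xq m s t" "found s' \<longleftrightarrow> C"
    unfolding s' a_def using \<open>\<not> found s\<close> by auto
  show "ereal (time s') \<le> mu r (m + 1)" "time s \<le> time s'" "xval s' r \<le> xval s' (m + 1)"
    "found s' \<longleftrightarrow> ereal (time s') = mu r (m + 1) \<or> xval s' r = xval s' (m + 1)"
    unfolding fields using ge(3) B u(1,3) order C_def by auto
  have "consistent s' \<and> (\<not> C \<longrightarrow>
      potential (eq_set s') (lt_set s') (gt_set s') < potential (eq_set s) (lt_set s) (gt_set s))"
  proof (cases C)
    case True
    then show ?thesis using ca consistent_found s' by simp
  next
    case False
    then have s': "s' = a\<lparr>eq_set := (eq_set s \<union> MOp \<union> MOm) - (MEp \<union> MEm),
      gt_set := (gt_set s \<union> MEm) - MOm, lt_set := (lt_set s \<union> MEp) - MOp\<rparr>" using s' by simp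
    have "xB m s t \<noteq> xq m s t (m + 1)" using False xr unfolding C_def by simp
    then have "u \<noteq> meet_time m s" using meet_time u(3) by metis
    then have "t \<noteq> time s + meet_time m s" using u(3) by simp
    then have "ereal (time s) + D = ereal t"
      using False B unfolding B_def C_def by (auto simp: min_def split: if_splits)
    then have D: "D = ereal u" unfolding u_def by (cases D) auto
    have t': "time s + real_of_ereal D = t" using D u(3) by simp
    have EBe: "beyond m s i j \<longleftrightarrow> T.child i j" "beyond m s j i \<longleftrightarrow> T.child j i"
      if "(i, j) \<in> EB m s" for i j
      using beyond_edge_iff that by auto
    have z: "ereal (zval a (i, j)) = (if beyond m s i j then mu i j else - lam i j)"
      if "(i, j) \<in> EB m s" "edge_time_plus m s (i, j) = D" for i j
      using edge_time_plus(3)[OF that(1), of u] that D u(3) unfolding a_def ztilde_def by simp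
    have MOp: "i \<in> VB m s" "j \<notin> VB m s" "(i, j) \<in> Em m" "(i, j) \<in> lt_set s" "xB m s t = xval s j"
      if "(i, j) \<in> MOp" for i j
      using that xq_VB[of i t] unfolding MOp_def Omega_plus_def t' by auto
    have MOm: "j \<in> VB m s" "i \<notin> VB m s" "(i, j) \<in> Em m" "(i, j) \<in> gt_set s" "xB m s t = xval s i"
      if "(i, j) \<in> MOm" for i j
      using that xq_VB[of j t] unfolding MOm_def Omega_minus_def t' by auto
    have sub: "MEp \<subseteq> eq_set s" "MEm \<subseteq> eq_set s" "MOp \<subseteq> lt_set s" "MOm \<subseteq> gt_set s"
      unfolding MEp_def MEm_def MOp_def MOm_def using EB_subset(1) by auto
    have sets: "eq_set a = eq_set s" "lt_set a = lt_set s" "gt_set a = gt_set s"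
      unfolding a_def by simp_all
    have "consistent (a\<lparr>eq_set := (eq_set a \<union> MOm \<union> MOp) - (MEm \<union> MEp),
      gt_set := (gt_set a \<union> MEm) - MOm, lt_set := (lt_set a \<union> MEp) - MOp\<rparr>)"
    proof (rule consistent_relabel[OF ca])
      show "MEm \<subseteq> eq_set a" "MEp \<subseteq> eq_set a" "MOm \<subseteq> gt_set a" "MOp \<subseteq> lt_set a"
        unfolding sets by (fact sub)+
      show "ereal (zval a (i, j)) = mu i j" if "(i, j) \<in> MEp" for i j
        using that z unfolding MEp_def by auto
      show "ereal (zval a (i, j)) = - lam i j" if "(i, j) \<in> MEm" for i j
        using that z[of i j] EBe[of i j] T.child_antisym unfolding MEm_def by auto
      show "MEm \<inter> MEp = {}"
        using EBe T.child_antisym unfolding MEp_def MEm_def by auto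
      show "xval a i = xval a j" if "(i, j) \<in> MOm \<union> MOp" for i j
        using that
      proof
        assume e: "(i, j) \<in> MOm"
        then have "i \<noteq> m + 1" using MOm(3) Em_subset(2) by fastforce
        then show ?thesis unfolding a_def using MOm[OF e] xq_VB xq_other by simp
      next
        assume e: "(i, j) \<in> MOp"
        then have "j \<noteq> m + 1" using MOp(3) Em_subset(2) by fastforce
        then show ?thesis unfolding a_def using MOp[OF e] xq_VB xq_other by simp
      qed
    qed
    then have "consistent s'" unfolding s' sets by (simp only: Un_ac)
    moreover have "potential ((eq_set s \<union> MOp \<union> MOm) - (MEp \<union> MEm)) ((lt_set s \<union> MEp) - MOp)
        ((gt_set s \<union> MEm) - MOm) < potential (eq_set s) (lt_set s) (gt_set s)"
    \<comment> \<open>Here \<open>lt_set\<close> stands in the place of \<open>gt\<close>: edges of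
      \<open>MEp\<close> split into it, and edges of \<open>MOp\<close> merge out of it.\<close>
    proof (rule potential_less[OF _ _ _ _ sub])
      show "G.child i j" if "(i, j) \<in> MEp \<union> MOm" for i j
        using that
      proof
        assume e: "(i, j) \<in> MEp"
        then show ?thesis using EBe[of i j] G_child_iff[of i j] T.F_sub unfolding MEp_def by auto
      next
        assume e: "(i, j) \<in> MOm"
        then have "(j, i) \<in> E \<union> E\<inverse>" using MOm(3) Em_subset(1) by blast
        then show ?thesis using child_leaving MOm(1,2)[OF e] by blast
      qed
      show "G.child j i" if "(i, j) \<in> MEm \<union> MOp" for i j
        using that
      proof
        assume e: "(i, j) \<in> MEm"
        then show ?thesis using EBe[of i j] G_child_iff[of j i] T.F_sub unfolding MEm_def by auto
      next
        assume e: "(i, j) \<in> MOp"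
        then have "(i, j) \<in> E \<union> E\<inverse>" using MOp(3) Em_subset(1) by blast
        then show ?thesis using child_leaving MOp(1,2)[OF e] by blast
      qed
      obtain i j where "(i, j) \<in> EB m s \<and> edge_time_plus m s (i, j) = D
        \<or> (i, j) \<in> Omega_plus m s \<inter> lt_set s \<and> xB m s t = xval s j
        \<or> (i, j) \<in> Omega_minus m s \<inter> gt_set s \<and> xB m s t = xval s i"
        using Delta_plus_attained[OF D[unfolded D_def]] u(3) unfolding D_def by blast
      then have "(i, j) \<in> MEp \<union> MEm \<union> MOp \<union> MOm"
      proof (elim disjE conjE)
        assume e: "(i, j) \<in> EB m s" "edge_time_plus m s (i, j) = D"
        then have "T.child i j \<or> T.child j i" using T.edge_child by blast
        then show ?thesis using e EBe unfolding MEp_def MEm_def by auto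
      next
        assume "(i, j) \<in> Omega_plus m s \<inter> lt_set s" "xB m s t = xval s j"
        then show ?thesis unfolding MOp_def t' using xq_VB[of i t] by (auto simp: Omega_plus_def)
      next
        assume "(i, j) \<in> Omega_minus m s \<inter> gt_set s" "xB m s t = xval s i"
        then show ?thesis unfolding MOm_def t' using xq_VB[of j t] by (auto simp: Omega_minus_def)
      qed
      then show "MEp \<union> MEm \<union> MOp \<union> MOm \<noteq> {}" by auto
    qed (use consistent in \<open>auto simp: consistent_def\<close>)
    ultimately show ?thesis unfolding s' by simp
  qed
  then show "consistent s'" "\<not> found s' \<Longrightarrow>
      potential (eq_set s') (lt_set s') (gt_set s') < potential (eq_set s) (lt_set s) (gt_set s)"
    using fields(3) by blast+
qed

end

section \<open>Correctness of the algorithm\<close>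

context growth_step begin

text \<open>At time 0 the new node sits at the minimiser of \<open>f (m + 1)\<close> and exchanges
  nothing with \<open>r\<close>, so \<open>balanced\<close> is the node condition of
  \<open>kkt\<close>.\<close>

lemma initial_consistent:
  assumes kkt: "kkt m x z"
  defines "x0 \<equiv> x(m + 1 := deriv (convex_conjugate (f (m + 1))) 0)"
  shows "consistent \<lparr>time = 0, xval = x0, zval = z,
      eq_set = {(i, j) \<in> Em m. x0 i = x0 j},
      gt_set = {(i, j) \<in> Em m. x0 i > x0 j},
      lt_set = {(i, j) \<in> Em m. x0 i < x0 j}, found = b\<rparr>"
    and "deriv (f (m + 1)) (x0 (m + 1)) = 0" "x0 r = x r"
proof -
  have smooth: "smooth_strongly_convex (f (m + 1))" using f_smooth m by simp
  show new: "deriv (f (m + 1)) (x0 (m + 1)) = 0"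
    unfolding x0_def deriv_convex_conjugate[OF smooth]
    using surj_f_inv_f[OF surj_deriv[OF smooth]] by simp
  show "x0 r = x r" unfolding x0_def using r by simp
  have old: "x0 l = x l" if "l \<in> {1..m}" for l unfolding x0_def using that by simp
  have edges: "edge_optimal lam mu x0 z i j" if "(i, j) \<in> Em m" for i j
  proof -
    have "i \<in> {1..m}" "j \<in> {1..m}" using that Em_subset(2) by blast+
    then show ?thesis using kkt that old unfolding kkt_def edge_optimal_def by auto
  qed
  have "balanced 0 x0 z" using kkt old unfolding balanced_def kkt_def by simp
  then show "consistent \<lparr>time = 0, xval = x0, zval = z,
      eq_set = {(i, j) \<in> Em m. x0 i = x0 j},
      gt_set = {(i, j) \<in> Em m. x0 i > x0 j},
      lt_set = {(i, j) \<in> Em m. x0 i < x0 j}, found = b\<rparr>"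
    unfolding consistent_def using new edges by (auto simp: edge_optimal_def)
qed

text \<open>The amount \<open>time s\<close> sent out by \<open>r\<close> becomes the flow on the
  new edge; its arrival at \<open>m + 1\<close> is accounted for by the last equation in
  \<open>consistent\<close>.\<close>

lemma consistent_kkt:
  assumes c: "consistent s"
    and e: "edge_optimal lam mu (xval s) ((zval s)((r, m + 1) := time s)) r (m + 1)"
  shows "kkt (m + 1) (xval s) ((zval s)((r, m + 1) := time s))"
proof -
  define z where "z = (zval s)((r, m + 1) := time s)"
  have new: "(r, m + 1) \<notin> Em m" using Em_subset(2) by fastforce
  have edges: "edge_optimal lam mu (xval s) z i j" if "(i, j) \<in> Em m" for i j
  proof -
    \<comment> \<open>For an edge at one of its bounds, the inequality for the other bound follows
      from \<open>- lam i j \<le> 0\<close> and \<open>0 \<le> mu i j\<close>.\<close>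
    have w: "- lam i j \<le> 0" "0 \<le> mu i j" using weights_nonneg that Em_subset(1) by auto
    have z: "z (i, j) = zval s (i, j)" using that new unfolding z_def by auto
    have "(i, j) \<in> eq_set s \<or> (i, j) \<in> gt_set s \<or> (i, j) \<in> lt_set s"
      using that c unfolding consistent_def by blast
    then show ?thesis
      unfolding edge_optimal_def z using c order_trans[OF w] unfolding consistent_def
      by (elim disjE) fastforce+
  qed
  have old: "net_flow (Em (m + 1)) z l k = net_flow (Em m) (zval s) l k"
    if "l \<in> {1..m}" "k \<in> {1..m}" for l k
    using that unfolding net_flow_def Em_Suc[OF m] z_def by auto
  have out: "net_flow (Em (m + 1)) z l (m + 1) = (if l = r then time s else 0)" if "l \<in> {1..m}" for l
    using that new Em_subset(2)[of m] unfolding net_flow_def Em_Suc[OF m] z_def by auto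
  have self: "net_flow (Em (m + 1)) z l l = 0" for l
    unfolding net_flow_def by simp
  have nodes: "(\<Sum>k=1..m+1. net_flow (Em (m + 1)) z l k) = deriv (f l) (xval s l)"
    if "l \<in> {1..m + 1}" for l
  proof (cases "l = m + 1")
    case True
    have "(\<Sum>k=1..m+1. net_flow (Em (m + 1)) z l k) = (\<Sum>k=1..m. net_flow (Em (m + 1)) z l k)"
      using self[of "m + 1"] True by simp
    also have "\<dots> = (\<Sum>k=1..m. if k = r then - time s else 0)"
    proof (rule sum.cong[OF refl])
      fix k assume "k \<in> {1..m}"
      then show "net_flow (Em (m + 1)) z l k = (if k = r then - time s else 0)"
        unfolding True net_flow_swap[of _ _ "m + 1" k] using out[of k] by simp
    qed
    also have "\<dots> = - time s" using r by simp
    finally show ?thesis using True c unfolding consistent_def by simp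
  next
    case False
    then have l: "l \<in> {1..m}" using that by auto
    have "(\<Sum>k=1..m+1. net_flow (Em (m + 1)) z l k)
        = (\<Sum>k=1..m. net_flow (Em (m + 1)) z l k) + (if l = r then time s else 0)"
      using out[OF l] by simp
    also have "(\<Sum>k=1..m. net_flow (Em (m + 1)) z l k) = (\<Sum>k=1..m. net_flow (Em m) (zval s) l k)"
      by (rule sum.cong) (use old l in auto)
    finally show ?thesis using c l unfolding consistent_def balanced_def by simp
  qed
  show ?thesis
    unfolding z_def[symmetric] kkt_def using edges nodes e[folded z_def] Em_Suc[OF m] by auto
qed

section \<open>Loop invariants, termination and the main loop\<close>

definition down_invariant :: "asra_state \<Rightarrow> bool" where
  "down_invariant s \<longleftrightarrow> consistent s \<and> - lam r (m + 1) \<le> ereal (time s) \<and> time s \<le> 0 \<and>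
     xval s (m + 1) \<le> xval s r \<and>
     (found s \<longrightarrow> ereal (time s) = - lam r (m + 1) \<or> xval s r = xval s (m + 1)) \<and>
     (\<not> found s \<longrightarrow> xval s r \<noteq> xval s (m + 1))"

definition up_invariant :: "asra_state \<Rightarrow> bool" where
  "up_invariant s \<longleftrightarrow> consistent s \<and> ereal (time s) \<le> mu r (m + 1) \<and> 0 \<le> time s \<and>
     xval s r \<le> xval s (m + 1) \<and>
     (found s \<longrightarrow> ereal (time s) = mu r (m + 1) \<or> xval s r = xval s (m + 1)) \<and>
     (\<not> found s \<longrightarrow> xval s r \<noteq> xval s (m + 1))"

lemma down_step:
  assumes "down_invariant s" "\<not> found s"
  defines "s' \<equiv> update_minus m s"
  shows "down_invariant s'"
    and "\<not> found s' \<Longrightarrow>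
      potential (eq_set s') (gt_set s') (lt_set s') < potential (eq_set s) (gt_set s) (lt_set s)"
proof -
  interpret block E f lam mu n m s
    using assms(1) unfolding down_invariant_def by unfold_locales auto
  have "- lam r (m + 1) \<le> ereal (time s)" "xval s (m + 1) < xval s r" "time s \<le> 0"
    using assms(1,2) unfolding down_invariant_def by auto
  note step = update_minus[OF this(1,2) assms(2), folded s'_def] and this(3)
  then show "down_invariant s'" unfolding down_invariant_def by auto
  show "\<not> found s' \<Longrightarrow>
      potential (eq_set s') (gt_set s') (lt_set s') < potential (eq_set s) (gt_set s) (lt_set s)"
    using step(6) .
qed

lemma up_step:
  assumes "up_invariant s" "\<not> found s"
  defines "s' \<equiv> update_plus m s"
  shows "up_invariant s'"
    and "\<not> found s' \<Longrightarrow>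
      potential (eq_set s') (lt_set s') (gt_set s') < potential (eq_set s) (lt_set s) (gt_set s)"
proof -
  interpret block E f lam mu n m s
    using assms(1) unfolding up_invariant_def by unfold_locales auto
  have "ereal (time s) \<le> mu r (m + 1)" "xval s r < xval s (m + 1)" "0 \<le> time s"
    using assms(1,2) unfolding up_invariant_def by auto
  note step = update_plus[OF this(1,2) assms(2), folded s'_def] and this(3)
  then show "up_invariant s'" unfolding up_invariant_def by auto
  show "\<not> found s' \<Longrightarrow>
      potential (eq_set s') (lt_set s') (gt_set s') < potential (eq_set s) (lt_set s) (gt_set s)"
    using step(6) .
qed

lemma down_loop:
  assumes "down_invariant s"
  obtains s' where "while_option (\<lambda>s. \<not> found s) (update_minus m) s = Some s'"
    "down_invariant s'" "found s'"
proof -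
  \<comment> \<open>The update that sets \<open>found\<close> leaves the signs as they are, so the
    potential does not drop there; \<open>Suc\<close> makes the measure decrease in that step
    too.\<close>
  have "\<exists>s'. while_option (\<lambda>s. \<not> found s) (update_minus m) s = Some s'"
    by (rule measure_while_option_Some[where P = down_invariant and f = "\<lambda>s.
        if found s then 0 else Suc (potential (eq_set s) (gt_set s) (lt_set s))"])
      (use assms down_step in auto)
  then obtain s' where s': "while_option (\<lambda>s. \<not> found s) (update_minus m) s = Some s'" by blast
  moreover have "down_invariant s'"
    using while_option_rule[where P = down_invariant, OF _ s' assms] down_step(1) by blast
  moreover have "found s'" using while_option_stop[OF s'] by simp
  ultimately show thesis using that by blast
qed

lemma up_loop:
  assumes "up_invariant s"
  obtains s' where "while_option (\<lambda>s. \<not> found s) (update_plus m) s = Some s'"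
    "up_invariant s'" "found s'"
proof -
  have "\<exists>s'. while_option (\<lambda>s. \<not> found s) (update_plus m) s = Some s'"
    by (rule measure_while_option_Some[where P = up_invariant and f = "\<lambda>s.
        if found s then 0 else Suc (potential (eq_set s) (lt_set s) (gt_set s))"])
      (use assms up_step in auto)
  then obtain s' where s': "while_option (\<lambda>s. \<not> found s) (update_plus m) s = Some s'" by blast
  moreover have "up_invariant s'"
    using while_option_rule[where P = up_invariant, OF _ s' assms] up_step(1) by blast
  moreover have "found s'" using while_option_stop[OF s'] by simp
  ultimately show thesis using that by blast
qed

text \<open>On exit the invariant yields optimality of the new edge: the order of its end values is
  known, \<open>t\<close> lies between 0 and the bound belonging to that order, and either the bound
  is attained or the values agree.\<close>

lemma generate_kkt:
  assumes kkt: "kkt m x z"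
  shows "\<exists>x' z'. generate m (x, z) = Some (x', z') \<and> kkt (m + 1) x' z'"
proof -
  define x0 where "x0 = x(m + 1 := deriv (convex_conjugate (f (m + 1))) 0)"
  define d0 where "d0 = deriv (f (m + 1)) (x r)"
  define s0 where "s0 = \<lparr>time = 0, xval = x0, zval = z,
      eq_set = {(i, j) \<in> Em m. x0 i = x0 j},
      gt_set = {(i, j) \<in> Em m. x0 i > x0 j},
      lt_set = {(i, j) \<in> Em m. x0 i < x0 j}, found = (d0 = 0)\<rparr>"
  have s0: "consistent s0" and new: "deriv (f (m + 1)) (x0 (m + 1)) = 0" and x0r: "x0 r = x r"
    using initial_consistent[OF kkt] unfolding s0_def x0_def by blast+
  have w: "0 \<le> lam r (m + 1)" "0 \<le> mu r (m + 1)" using weights_nonneg[OF r(3)] by auto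
  have mono: "strict_mono (deriv (f (m + 1)))" using strict_mono_deriv f_smooth m by simp
  have sign: "d0 = 0 \<longleftrightarrow> x r = x0 (m + 1)" "0 < d0 \<longleftrightarrow> x0 (m + 1) < x r"
    unfolding d0_def using strict_mono_eq[OF mono, of "x r" "x0 (m + 1)"]
      strict_mono_less[OF mono, of "x0 (m + 1)" "x r"] new by auto
  have gen: "generate m (x, z) = map_option (\<lambda>s. (xval s, (zval s)((r, m + 1) := time s)))
      (while_option (\<lambda>s. \<not> found s) (if d0 > 0 then update_minus m else update_plus m) s0)"
    unfolding generate_def s0_def x0_def d0_def Let_def by simp
  have "\<exists>s. while_option (\<lambda>s. \<not> found s) (if d0 > 0 then update_minus m else update_plus m) s0 = Some s
      \<and> consistent s \<and> edge_optimal lam mu (xval s) ((zval s)((r, m + 1) := time s)) r (m + 1)"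
  proof (cases "d0 > 0")
    case True
    then have "down_invariant s0"
      using s0 w sign x0r unfolding down_invariant_def by (simp add: s0_def zero_ereal_def[symmetric])
    then obtain s where s: "while_option (\<lambda>s. \<not> found s) (update_minus m) s0 = Some s"
      "down_invariant s" "found s" by (rule down_loop)
    have "ereal (time s) \<le> 0" using s(2) unfolding down_invariant_def by simp
    then have "ereal (time s) \<le> mu r (m + 1)" using w(2) by (rule order_trans)
    then have "edge_optimal lam mu (xval s) ((zval s)((r, m + 1) := time s)) r (m + 1)"
      using s unfolding down_invariant_def edge_optimal_def by auto
    then show ?thesis using True s unfolding down_invariant_def by simp
  next
    case False
    \<comment> \<open>This branch includes \<open>d0 = 0\<close>: \<open>found\<close> holds from
      the start, the loop returns \<open>s0\<close>, and equal end values settle the new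
      edge.\<close>
    then have "up_invariant s0"
      using s0 w sign x0r unfolding up_invariant_def by (auto simp: s0_def zero_ereal_def[symmetric])
    then obtain s where s: "while_option (\<lambda>s. \<not> found s) (update_plus m) s0 = Some s"
      "up_invariant s" "found s" by (rule up_loop)
    have "- lam r (m + 1) \<le> 0" using w(1) by simp
    moreover have "0 \<le> ereal (time s)" using s(2) unfolding up_invariant_def by simp
    ultimately have "- lam r (m + 1) \<le> ereal (time s)" by (rule order_trans)
    then have "edge_optimal lam mu (xval s) ((zval s)((r, m + 1) := time s)) r (m + 1)"
      using s unfolding up_invariant_def edge_optimal_def by auto
    then show ?thesis using False s unfolding up_invariant_def by simp
  qed
  then show ?thesis unfolding gen using consistent_kkt by auto
qed

end

context labelled_tree begin

lemma run_kkt: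
  assumes "1 \<le> n"
  shows "\<exists>x z. run n = Some (x, z) \<and> kkt n x z"
proof -
  define x1 :: "nat \<Rightarrow> real" where "x1 = undefined(1 := deriv (convex_conjugate (f 1)) 0)"
  have "\<exists>x z. fold (\<lambda>m r. Option.bind r (generate m)) [1..<k] (Some (x1, undefined)) = Some (x, z)
      \<and> kkt k x z" if "1 \<le> k" "k \<le> n" for k
    using that
  proof (induction k rule: dec_induct)
    case base
    have "Em 1 = {}" unfolding Em_def by (auto dest: E_range)
    moreover note smooth = f_smooth[OF order_refl assms]
    moreover have "deriv (f 1) (deriv (convex_conjugate (f 1)) 0) = 0"
      unfolding deriv_convex_conjugate[OF smooth] by (rule surj_f_inv_f[OF surj_deriv[OF smooth]])
    ultimately have "kkt 1 x1 undefined"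
      unfolding kkt_def by (simp add: net_flow_def x1_def)
    moreover have "fold (\<lambda>m r. Option.bind r (generate m)) [1..<1] (Some (x1, undefined))
        = Some (x1, undefined)" by simp
    ultimately show ?case by blast
  next
    case (step k)
    then obtain x z where xz: "fold (\<lambda>m r. Option.bind r (generate m)) [1..<k] (Some (x1, undefined))
        = Some (x, z)" "kkt k x z" using Suc_leD by blast
    interpret growth_step E f lam mu n k
      using step by unfold_locales auto
    show ?case using generate_kkt[OF xz(2)] xz(1) step.hyps by simp
  qed
  then show ?thesis unfolding run_def x1_def using assms by blast
qed

text \<open>After the transport to \<open>V\<close> and back, the computed point is known on the
  labels \<open>{1..n}\<close> only.\<close>

lemma kkt_cong:
  assumes "kkt n x z" "\<And>i. i \<in> {1..n} \<Longrightarrow> x' i = x i"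
  shows "kkt n x' z"
proof -
  have "edge_optimal lam mu x' z i j" if "(i, j) \<in> Em n" for i j
  proof -
    have "i \<in> {1..n}" "j \<in> {1..n}" using that Em_subset(2) by blast+
    then show ?thesis using assms that unfolding kkt_def edge_optimal_def by auto
  qed
  then show ?thesis using assms unfolding kkt_def by auto
qed

end

section \<open>From the labels back to the given tree\<close>

lemma undirected_cycle_map:
  assumes c: "undirected_cycle F c" and inj: "inj_on l N" and N: "F \<subseteq> N \<times> N"
    and edges: "\<And>i j. (i, j) \<in> F \<Longrightarrow> (l i, l j) \<in> A"
  shows "undirected_cycle A (map l c)"
proof -
  have c': "3 \<le> length c" "distinct c" "successively (\<lambda>a b. (a, b) \<in> F \<union> F\<inverse>) c"
    "(last c, hd c) \<in> F \<union> F\<inverse>" using c unfolding undirected_cycle_def by auto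
  then have ne: "c \<noteq> []" by auto
  \<comment> \<open>\<open>l\<close> is injective on \<open>N\<close> only, so the nodes of the
    cycle have to be located there; each of them is an end of an edge.\<close>
  have "v \<in> N" if "v \<in> set c" for v
  proof -
    obtain p q where pq: "c = p @ v # q" using \<open>v \<in> set c\<close> by (meson split_list)
    then show ?thesis
      using c'(3,4) N by (cases p rule: rev_cases) (auto simp: successively_append_iff)
  qed
  then have "distinct (map l c)" using c'(2) inj_on_subset[OF inj] by (simp add: distinct_map subset_iff)
  moreover have "successively (\<lambda>a b. (a, b) \<in> A \<union> A\<inverse>) (map l c)"
    unfolding successively_map using c'(3) by (rule successively_mono) (use edges in auto)
  moreover have "(last (map l c), hd (map l c)) \<in> A \<union> A\<inverse>"
    using c'(4) edges ne by (auto simp: last_map hd_map)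
  ultimately show ?thesis using c'(1) unfolding undirected_cycle_def by simp
qed

text \<open>The sum over \<open>A\<close> is the link: labelled edges correspond to \<open>A\<close>
  through \<open>l\<close>, and \<open>E\<close> corresponds to \<open>A\<close> by turning the
  reversed edges. Turning an edge exchanges its two penalties, which is compensated by exchanging
  \<open>lam\<close> and \<open>mu\<close>.\<close>

lemma objective_relabel:
  fixes lam mu :: "'a \<Rightarrow> 'a \<Rightarrow> ereal"
  assumes fin: "finite V" and asym: "asym E" "asym A" and AE: "A \<union> A\<inverse> = E \<union> E\<inverse>"
    and AV: "A \<subseteq> V \<times> V" and l: "bij_betw l N V"
  defines "lam' \<equiv> \<lambda>i j. if (i, j) \<in> E then lam i j else mu j i"
    and "mu' \<equiv> \<lambda>i j. if (i, j) \<in> E then mu i j else lam j i"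
  shows "objective N {(i, j). i \<in> N \<and> j \<in> N \<and> (l i, l j) \<in> A} (\<lambda>i. f (l i))
      (\<lambda>i j. lam' (l i) (l j)) (\<lambda>i j. mu' (l i) (l j)) (y \<circ> l) = objective V E f lam mu y"
proof -
  let ?E' = "{(i, j). i \<in> N \<and> j \<in> N \<and> (l i, l j) \<in> A}"
  let ?c = "\<lambda>lam mu (i, j). lam i j * ereal (max 0 (y i - y j)) + mu i j * ereal (max 0 (- (y i - y j)))"
  let ?turn = "\<lambda>(i, j). if (i, j) \<in> A then (i, j) else (j, i)"
  have inj: "inj_on l N" and img: "l ` N = V" using l unfolding bij_betw_def by auto
  have "bij_betw (map_prod l l) ?E' A"
  proof (rule bij_betw_imageI)
    show "inj_on (map_prod l l) ?E'" using inj by (auto simp: inj_on_def)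
    show "map_prod l l ` ?E' = A"
    proof (intro equalityI subrelI)
      fix a b assume ab: "(a, b) \<in> A"
      then obtain i j where "a = l i" "b = l j" "i \<in> N" "j \<in> N" using AV img by auto
      then show "(a, b) \<in> map_prod l l ` ?E'" using ab by (intro image_eqI[of _ _ "(i, j)"]) auto
    qed auto
  qed
  from sum.reindex_bij_betw[OF this, of "?c lam' mu'"]
  have 1: "(\<Sum>(i, j)\<in>?E'. lam' (l i) (l j) * ereal (max 0 (y (l i) - y (l j)))
      + mu' (l i) (l j) * ereal (max 0 (- (y (l i) - y (l j))))) = sum (?c lam' mu') A"
    by (simp add: case_prod_beta)
  have "bij_betw ?turn E A"
  proof (rule bij_betw_imageI)
    show "inj_on ?turn E"
      using asym(1) by (auto simp: inj_on_def split: if_splits dest: asymD)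
    show "?turn ` E = A"
    proof (intro equalityI subrelI)
      fix a b assume ab: "(a, b) \<in> A"
      then have "(b, a) \<notin> A" using asym(2) by (auto dest: asymD)
      moreover have "(a, b) \<in> E \<or> (b, a) \<in> E" using ab AE by blast
      ultimately show "(a, b) \<in> ?turn ` E" using ab
        by (auto intro: image_eqI[of _ _ "(a, b)"] image_eqI[of _ _ "(b, a)"])
    next
      fix a b assume "(a, b) \<in> ?turn ` E"
      then show "(a, b) \<in> A" using AE by (auto split: if_splits)
    qed
  qed
  from sum.reindex_bij_betw[OF this, of "?c lam' mu'"]
  have "sum (?c lam' mu') A = (\<Sum>e\<in>E. ?c lam' mu' (?turn e))" by simp
  also have "\<dots> = sum (?c lam mu) E"
  proof (rule sum.cong[OF refl])
    fix e assume "e \<in> E"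
    moreover obtain i j where "e = (i, j)" by fastforce
    ultimately have e: "e = (i, j)" "(i, j) \<in> E" "(j, i) \<notin> E"
      using asym(1) by (auto dest: asymD)
    then show "?c lam' mu' (?turn e) = ?c lam mu e"
      by (simp add: lam'_def mu'_def add.commute)
  qed
  finally have 2: "sum (?c lam' mu') A = sum (?c lam mu) E" .
  have "(\<Sum>i\<in>N. f (l i) (y (l i))) = (\<Sum>v\<in>V. f v (y v))"
    by (rule sum.reindex_bij_betw[OF l])
  then show ?thesis unfolding objective_altdef using 1 2 by simp
qed

theorem theorem1:
  fixes V :: "'a set" and E A :: "('a \<times> 'a) set" and l :: "nat \<Rightarrow> 'a"
    and f :: "'a \<Rightarrow> real \<Rightarrow> real" and lam mu :: "'a \<Rightarrow> 'a \<Rightarrow> ereal"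
  assumes "directed_tree V E"
    and "\<And>i x. i \<in> V \<Longrightarrow> f i differentiable (at x)"
    and "\<And>i. i \<in> V \<Longrightarrow> strongly_convex (f i)"
    and "\<And>i j. (i, j) \<in> E \<Longrightarrow> 0 \<le> lam i j \<and> 0 \<le> mu i j"
    and "normalization V E A l"
  shows "\<exists>x. asra V E f lam mu A l = Some x \<and> the_optimal_solution V E f lam mu x"
proof -
  define n where "n = card V"
  define lam' where "lam' = (\<lambda>i j. if (i, j) \<in> E then lam i j else mu j i)"
  define mu' where "mu' = (\<lambda>i j. if (i, j) \<in> E then mu i j else lam j i)"
  define E' where "E' = {(i, j). i \<in> {1..n} \<and> j \<in> {1..n} \<and> (l i, l j) \<in> A}"
  define f' where "f' = (\<lambda>i. f (l i))"
  define lam'' where "lam'' = (\<lambda>i j. lam' (l i) (l j))"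
  define mu'' where "mu'' = (\<lambda>i j. mu' (l i) (l j))"
  have fin: "finite V" and ne: "V \<noteq> {}" and asymE: "asym E"
    using assms(1) unfolding directed_tree_def by auto
  have AE: "A \<union> A\<inverse> = E \<union> E\<inverse>" and bij: "bij_betw l {1..n} V" and root: "in_degree A (l 1) = 0"
    and order: "\<And>i j. i \<in> {1..n} \<Longrightarrow> j \<in> {1..n} \<Longrightarrow> (l i, l j) \<in> A \<Longrightarrow> i < j"
    and AV: "A \<subseteq> V \<times> V" and asymA: "asym A" and acycA: "\<nexists>c. undirected_cycle A c"
    and root_unique: "\<exists>!r. r \<in> V \<and> in_degree A r = 0"
    using assms(5) unfolding normalization_def arborescence_def directed_tree_def n_def by auto
  have inj: "inj_on l {1..n}" and img: "l ` {1..n} = V" using bij unfolding bij_betw_def by auto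
  have n: "1 \<le> n" unfolding n_def using fin ne by (simp add: Suc_le_eq card_gt_0_iff)
  interpret labelled_tree E' f' lam'' mu'' n
  proof
    show "1 \<le> i \<and> i < j \<and> j \<le> n" if "(i, j) \<in> E'" for i j
      using that order unfolding E'_def by auto
    show "\<nexists>c. undirected_cycle E' c"
    proof
      assume "\<exists>c. undirected_cycle E' c"
      then obtain c where c: "undirected_cycle E' c" by blast
      have "undirected_cycle A (map l c)"
        by (rule undirected_cycle_map[OF c inj]) (auto simp: E'_def)
      then show False using acycA by blast
    qed
    show "\<exists>i. (i, j) \<in> E'" if j: "2 \<le> j" "j \<le> n" for j
    proof -
      have V: "l j \<in> V" "l 1 \<in> V" using img j n by auto
      have "l j \<noteq> l 1" using inj_onD[OF inj, of j 1] j by auto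
      \<comment> \<open>The root is the only node without an incoming edge, and it carries the label
        1.\<close>
      then have "in_degree A (l j) \<noteq> 0" using root_unique root V by (metis (full_types))
      then have "{e \<in> A. snd e = l j} \<noteq> {}" unfolding in_degree_def by (metis card.empty)
      then obtain a where a: "(a, l j) \<in> A" by auto
      then obtain i where "i \<in> {1..n}" "a = l i" using AV img by blast
      then show ?thesis using a j unfolding E'_def by auto
    qed
    show "smooth_strongly_convex (f' i)" if "1 \<le> i" "i \<le> n" for i
    proof -
      have "l i \<in> V" using that img by auto
      then show ?thesis using assms(2,3) unfolding smooth_strongly_convex_def f'_def by blast
    qed
    show "0 \<le> lam'' i j \<and> 0 \<le> mu'' i j" if "(i, j) \<in> E'" for i j
    proof -
      have "(l i, l j) \<in> E \<or> (l j, l i) \<in> E" using that AE unfolding E'_def by blast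
      then show ?thesis using assms(4) unfolding lam''_def mu''_def lam'_def mu'_def by auto
    qed
  qed
  obtain x z where run: "run n = Some (x, z)" and kkt: "kkt n x z" using run_kkt[OF n] by blast
  define X where "X = (\<lambda>v\<in>V. x (the_inv_into {1..n} l v))"
  have asra: "asra V E f lam mu A l = Some X"
    using run unfolding asra_def Let_def X_def n_def lam''_def mu''_def lam'_def mu'_def E'_def f'_def
    by simp
  have "(X \<circ> l) i = x i" if "i \<in> {1..n}" for i
    using that img the_inv_into_f_f[OF inj that] unfolding X_def by auto
  then have kktX: "kkt n (X \<circ> l) z" by (rule kkt_cong[OF kkt])
  have obj: "objective {1..n} E' f' lam'' mu'' (y \<circ> l) = objective V E f lam mu y" for y
    unfolding E'_def f'_def lam''_def mu''_def lam'_def mu'_def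
    by (rule objective_relabel[OF fin asymE asymA AE AV bij])
  have X: "X \<in> V \<rightarrow>\<^sub>E UNIV" unfolding X_def by simp
  \<comment> \<open>Two different extensional functions on \<open>V\<close> differ at a node of
    \<open>V\<close>, hence at some label, where the strict comparison applies.\<close>
  have less: "objective V E f lam mu X < objective V E f lam mu y" if y: "y \<in> V \<rightarrow>\<^sub>E UNIV" "y \<noteq> X" for y
  proof -
    obtain v where v: "v \<in> V" "y v \<noteq> X v" using PiE_ext[OF y(1) X] y(2) by blast
    then obtain i where "i \<in> {1..n}" "v = l i" using img by blast
    then have "i \<in> {1..n}" "(y \<circ> l) i \<noteq> (X \<circ> l) i" using v(2) by auto
    from kkt_objective_less[OF kktX, of _ "y \<circ> l", OF this] show ?thesis unfolding obj .
  qed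
  have "the_optimal_solution V E f lam mu X"
    unfolding the_optimal_solution_def
  proof (intro equalityI subsetI)
    fix y assume "y \<in> {y. is_arg_min (objective V E f lam mu) (\<lambda>y. y \<in> V \<rightarrow>\<^sub>E UNIV) y}"
    then have "y \<in> V \<rightarrow>\<^sub>E UNIV" "\<not> objective V E f lam mu X < objective V E f lam mu y"
      using X unfolding is_arg_min_def by auto
    then show "y \<in> {X}" using less by auto
  next
    fix y assume "y \<in> {X}"
    moreover have "\<not> objective V E f lam mu w < objective V E f lam mu X" if "w \<in> V \<rightarrow>\<^sub>E UNIV" for w
      using less[OF that] by (cases "w = X") auto
    ultimately show "y \<in> {y. is_arg_min (objective V E f lam mu) (\<lambda>y. y \<in> V \<rightarrow>\<^sub>E UNIV) y}"
      using X unfolding is_arg_min_def by auto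
  qed
  then show ?thesis using asra by blast
qed

end
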